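(* Let $\lambda>0$, $k>0$ and fix $0<\lambda_1<\lambda_0<\lambda$. Assume the following. (F) There are $q>2$, $\epsilon>0$ with $q-1-\epsilon>0$, and sequences $\alpha_1=(\alpha_{1i})_{i\in\mathbb Z},\alpha_2=(\alpha_{2i})_{i\in\mathbb Z}\in\ell^1$ such that $f:\ell^2\to\ell^2$, $(f(u))_i=f_i(u_i)$, is locally Lipschitz with $|f_i(a)-f_i(b)|\le\gamma(R)|a-b|$ whenever $|a|,|b|\le R$, where $\gamma:\mathbb R^+\to\mathbb R^+$ is bounded on bounded intervals, and $|f_i(a)|\le\alpha_{1i}|a|^{q-1-\epsilon}+\alpha_{2i}$. (G1) $g(t,u)=(g_i(t,u_i))_{i\in\mathbb Z}$, each $(t,a)\mapsto g_i(t,a)$ is continuous and differentiable in $a$, and there is $\beta>0$ with $g_i(t,a)a\le-\beta|a|^q+\psi_{1i}(t)$, $\frac{\partial g_i}{\partial a}(t,a)\le\psi_{2i}(t)$, $|g_i(t,a)|\le\psi_{3i}(t)|a|^{q-1}+\psi_{4i}(t)$, where $\psi_1\in L^1_{\rm loc}(\mathbb R;\ell^1)$, $\psi_2,\psi_3\in L^\infty_{\rm loc}(\mathbb R;\ell^\infty)$, $\psi_4\in L^2_{\rm loc}(\mathbb R;\ell^2)$. (G2) $\int_{-\infty}^0 e^{\lambda_1 s}(\|\psi_1(s)\|_1+\|\psi_4(s)\|^2)\,ds<\infty$ and $\psi_3\in L^\infty((-\infty,0];\ell^\infty)$. (H1) $h:\mathbb R\to\ell^2\cap\ell^q$ is differentiable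 as an $\ell^2$-valued map, $h\in L^2_{\rm loc}(\mathbb R;\ell^2)\cap L^q_{\rm loc}(\mathbb R;\ell^q)$ and $h'\in L^2_{\rm loc}(\mathbb R;\ell^2)$. (H2) $\int_{-\infty}^0 e^{\lambda_1 s}(\|h(s)\|^2+\|h(s)\|_q^q+\|h'(s)\|^2)\,ds<\infty$. Let $\mathcal A$ be the unique pullback random $\mathcal D$-attractor of the nonautonomous random dynamical system $\varphi$ on $\ell^2$ (see context). Then for a given generalized Banach limit $\mathrm{LIM}_{t\to-\infty}$ and a mapping $\xi:\mathbb R\times\Omega\to\ell^2$ with $\{\xi(\tau,\omega)\}_{(\tau,\omega)\in\mathbb R\times\Omega}\in\mathcal D$ such that $\xi(\tau,\theta_\tau\omega)$ is continuous in $\tau$, there exists a family of Borel probability measures $\{\mu_{\tau,\omega}\}_{(\tau,\omega)\in\mathbb R\times\Omega}$ on $\ell^2$ such that the support of $\mu_{\tau,\omega}$ is contained in $\mathcal A(\tau,\omega)$ and for all $\Upsilon\in C(\ell^2)$, all $t\in\mathbb R$ and $\mathbb P$-a.s. $\omega\in\Omega$, $$\mathop{\mathrm{LIM}}_{\tau\to-\infty}\frac1{t-\tau}\int_\tau^t\Upsilon(\varphi(t-s,s,\theta_s\omega,\xi(s,\theta_s\omega)))\,ds=\int_{\mathcal A(t,\theta_t\omega)}\Upsilon(u)\,\mu_{t,\theta_t\omega}(du)=\int_{\ell^2}\Upsilon(u)\,\mu_{t,\theta_t\omega}(du)$$ $$=\mathop{\mathrm{LIM}}_{\tau\to-\infty}\frac1{t-\tau}\int_\tau^t\int_{\ell^2}\Upsilon(\varphi(t-s,s,\theta_s\omega,u))\,\mu_{s,\theta_s\omega}(du)\,ds.$$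 Additionally, $\mu_{\tau,\omega}$ is invariant in the sense that for all $\tau\in\mathbb R$ and $\mathbb P$-a.s. $\omega\in\Omega$, $$\int_{\mathcal A(\tau+t,\theta_t\omega)}\Upsilon(u)\,\mu_{\tau+t,\theta_t\omega}(du)=\int_{\mathcal A(\tau,\omega)}\Upsilon(\varphi(t,\tau,\omega,u))\,\mu_{\tau,\omega}(du)\quad\text{for all }t\ge0.$$
   Context: Spaces. For $p\in[1,\infty)$, $\ell^p$ is the Banach space of real bi-infinite sequences with $\|u\|_p^p=\sum_{i\in\mathbb Z}|u_i|^p<\infty$; $\ell^\infty$ is the space of bounded bi-infinite sequences with the sup norm $\|\cdot\|_\infty$; $\ell^2$ has inner product $(u,v)=\sum_i u_iv_i$ and norm $\|\cdot\|$. $C(\ell^2)$ is the set of continuous real functions on $\ell^2$. $(Au)_i=2u_i-u_{i-1}-u_{i+1}$. Probability space. On $\{\omega\in C(\mathbb R):\omega(0)=0\}$ with the compact-open topology take the Borel $\sigma$-algebra $\mathcal F$ and Wiener measure $\mathbb P$; $\theta_t\omega(\cdot)=\omega(\cdot+t)-\omega(t)$. Put $z(\theta_t\omega)=-\int_{-\infty}^0 e^{s}\,\theta_t\omega(s)\,ds$. $\Omega$ is a $\theta_t$-invariant set of full measure such that for all $\omega\in\Omega$, $t\mapsto z(\theta_t\omega)$ is continuous and $\lim_{t\to\pm\infty}z(\theta_t\omega)/t=\lim_{t\to\pm\infty}\frac1t\int_0^t z(\theta_s\omega)ds=0$; we work on $\Omega$. $W(\omega)(t)=\omega(t)$. Equation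 ($k>0$). $du=-[A(Au+f(u))+\lambda u-g(t,u)]dt+(ku+h(t))dW(t)$, $t>\tau$, $u(\tau)=u_\tau\in\ell^2$. It is solved through the random equation $\frac{dv}{dt}=F(t,\omega,v)$, $v(\tau)=v_\tau$, with $F(t,\omega,v)=-A^2v+(kz(\theta_t\omega)-\lambda)v+e^{-kz(\theta_t\omega)}\big(-Af(e^{kz(\theta_t\omega)}v-k^{-1}h(t))+g(t,e^{kz(\theta_t\omega)}v-k^{-1}h(t))\big)+k^{-1}e^{-kz(\theta_t\omega)}(A^2h(t)+\lambda h(t)+h'(t))$, whose unique global solution is denoted $v(t,\tau,\omega,v_\tau)$. The solution of the stochastic equation is $u(t,\tau,\omega,u_\tau)=e^{kz(\theta_t\omega)}v\big(t,\tau,\omega,e^{-kz(\theta_\tau\omega)}(u_\tau+k^{-1}h(\tau))\big)-k^{-1}h(t)$, and $\varphi(t,\tau,\omega,u_\tau)=u(t+\tau,\tau,\theta_{-\tau}\omega,u_\tau)$ for $t\ge0$. Random sets and attractors. A nonautonomous random set in $X$ is a family of nonempty subsets $D(\tau,\omega)\subset X$, $(\tau,\omega)\in\mathbb R\times\Omega$, such that $\omega\mapsto d_X(x,D(\tau,\omega))$ is measurable for every $(x,\tau)$. $\mathcal D$ is the collection of all nonautonomous random sets $D$ in $\ell^2$ with $\lim_{s\to-\infty}e^{\lambda_0 s+2k\int_s^0z(\theta_r\omega)dr-2kz(\theta_s\omega)}\|D(\tau+s,\theta_s\omega)\|^2=0$ for every $\tau\in\mathbb R,\omega\in\Omega$,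 where $\|D\|=\sup_{u\in D}\|u\|$. A pullback random $\mathcal D$-attractor in $X=\ell^2$ for $\varphi$ is a nonautonomous random set $\mathcal A$ such that: (1) $\mathcal A(\tau,\omega)$ is compact for all $\tau$ and $\mathbb P$-a.s. $\omega$; (2) $\varphi(t,\tau,\omega,\mathcal A(\tau,\omega))=\mathcal A(\tau+t,\theta_t\omega)$ for all $t\ge0$; (3) for every $D\in\mathcal D$, $\lim_{t\to+\infty}\mathrm{dist}_X(\varphi(t,\tau-t,\theta_{-t}\omega,D(\tau-t,\theta_{-t}\omega)),\mathcal A(\tau,\omega))=0$, with $\mathrm{dist}_X(B,C)=\sup_{b\in B}\inf_{c\in C}\|b-c\|_X$; (4) there is a closed set $K\in\mathcal D$ with $\mathcal A\subset K$. Under the hypotheses of the claim such an $\mathcal A$ exists and is unique. A generalized Banach limit $\mathrm{LIM}_{t\to-\infty}$ is any linear functional defined for arbitrary bounded real functions on $(-\infty,a]$ (some $a\in\mathbb R$) such that $\mathrm{LIM}_{t\to-\infty}\zeta(t)\ge0$ for nonnegative $\zeta$, and $\mathrm{LIM}_{t\to-\infty}\zeta(t)=\lim_{t\to-\infty}\zeta(t)$ if the latter limit exists. *)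

theory Defs
  imports "HOL-Probability.Probability"
begin

definition ell :: "ereal \<Rightarrow> (int \<Rightarrow> real) set" where
  "ell p = (if p = \<infinity> then {u. bounded (range u)}
            else {u. (\<lambda>i. \<bar>u i\<bar> powr real_of_ereal p) summable_on UNIV})"

definition ell_norm :: "ereal \<Rightarrow> (int \<Rightarrow> real) \<Rightarrow> real" where
  "ell_norm p u = (if p = \<infinity> then (SUP i. \<bar>u i\<bar>)
                   else (\<Sum>\<^sub>\<infinity>i. \<bar>u i\<bar> powr real_of_ereal p) powr (1 / real_of_ereal p))"

text \<open>The Hilbert space \<open>\<ell>\<^sup>2\<close> is made a type, so that continuity, compactness, the Borel sets,
  derivatives and the Bochner integral are the library notions.\<close>

typedef ell2 = "ell (ereal 2)" morphisms coord ell2_of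
  by (rule exI[of _ "\<lambda>_. 0"]) (simp add: ell_def)

lemma abs_powr_2: "\<bar>x::real\<bar> powr 2 = x\<^sup>2"
  by (cases "x = 0") (simp_all add: powr_numeral)

lemma ell_2_iff: "u \<in> ell (ereal 2) \<longleftrightarrow> (\<lambda>i. (u i)\<^sup>2) summable_on UNIV"
  by (simp add: ell_def abs_powr_2)

lemma coord_summable: "(\<lambda>i. (coord u i)\<^sup>2) summable_on UNIV"
  using coord[of u] by (simp add: ell_2_iff)

lemma coord_mult_summable: "(\<lambda>i. coord u i * coord v i) summable_on UNIV"
proof -
  have "(\<lambda>i. (coord u i)\<^sup>2 + (coord v i)\<^sup>2) summable_on UNIV"
    by (intro summable_on_add coord_summable)
  then have "(\<lambda>i. norm (coord u i * coord v i)) summable_on UNIV"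
  proof (rule summable_on_comparison_test)
    fix i
    have "2 * (\<bar>coord u i\<bar> * \<bar>coord v i\<bar>) \<le> (coord u i)\<^sup>2 + (coord v i)\<^sup>2"
      using sum_squares_bound[of "\<bar>coord u i\<bar>" "\<bar>coord v i\<bar>"] by simp
    moreover have "0 \<le> \<bar>coord u i\<bar> * \<bar>coord v i\<bar>" by simp
    ultimately show "norm (coord u i * coord v i) \<le> (coord u i)\<^sup>2 + (coord v i)\<^sup>2"
      unfolding real_norm_def abs_mult by linarith
  qed simp
  then show ?thesis by (rule abs_summable_summable)
qed

lemma ell_2_add: assumes "u \<in> ell (ereal 2)" "v \<in> ell (ereal 2)" shows "(\<lambda>i. u i + v i) \<in> ell (ereal 2)"
proof -
  have "(\<lambda>i. (u i)\<^sup>2 + (v i)\<^sup>2 + 2 * (u i * v i)) summable_on UNIV"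
    using coord_mult_summable[of "ell2_of u" "ell2_of v"] assms
    by (intro summable_on_add summable_on_cmult_right) (simp_all add: ell2_of_inverse ell_2_iff)
  then show ?thesis by (simp add: ell_2_iff power2_sum mult.assoc)
qed

lemma ell_2_scale: assumes "u \<in> ell (ereal 2)" shows "(\<lambda>i. c * u i) \<in> ell (ereal 2)"
  using summable_on_cmult_right[of "\<lambda>i. (u i)\<^sup>2" UNIV "c\<^sup>2"] assms
  by (simp add: ell_2_iff power_mult_distrib)

instantiation ell2 :: real_inner
begin

definition "0 = ell2_of (\<lambda>_. 0)"
definition "u + v = ell2_of (\<lambda>i. coord u i + coord v i)"
definition "- u = ell2_of (\<lambda>i. - coord u i)"
definition "u - v = ell2_of (\<lambda>i. coord u i - coord v i)"
definition "scaleR c u = ell2_of (\<lambda>i. c * coord u i)"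
definition "inner u v = (\<Sum>\<^sub>\<infinity>i. coord u i * coord v i)"
definition norm_ell2_def: "norm u = sqrt (inner u u)" for u :: ell2
definition sgn_ell2_def: "sgn u = inverse (norm u) *\<^sub>R u" for u :: ell2
definition dist_ell2_def: "dist u v = norm (u - v)" for u v :: ell2
definition uniformity_ell2_def [code del]:
  "(uniformity :: (ell2 \<times> ell2) filter) = (INF e\<in>{0 <..}. principal {(x, y). dist x y < e})"
definition open_ell2_def [code del]:
  "open (U :: ell2 set) \<longleftrightarrow> (\<forall>x\<in>U. eventually (\<lambda>(x', y). x' = x \<longrightarrow> y \<in> U) uniformity)"

lemma coord_zero [simp]: "coord 0 i = 0"
  by (simp add: zero_ell2_def ell2_of_inverse ell_2_iff)

lemma coord_add [simp]: "coord (u + v) i = coord u i + coord v i"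
  by (simp add: plus_ell2_def ell2_of_inverse ell_2_add coord)

lemma coord_scaleR [simp]: "coord (c *\<^sub>R u) i = c * coord u i"
  by (simp add: scaleR_ell2_def ell2_of_inverse ell_2_scale coord)

lemma coord_uminus [simp]: "coord (- u) i = - coord u i"
  using ell_2_scale[OF coord, of "-1" u] by (simp add: uminus_ell2_def ell2_of_inverse)

lemma coord_diff [simp]: "coord (u - v) i = coord u i - coord v i"
  using ell_2_add[OF coord ell_2_scale[OF coord, of "-1" v], of u]
  by (simp add: minus_ell2_def ell2_of_inverse)

lemma ell2_eqI: "(\<And>i. coord u i = coord v i) \<Longrightarrow> u = v"
  by (simp add: coord_inject[symmetric] fun_eq_iff)

instance
proof
  fix u v w :: ell2 and a b :: real
  show "u + v + w = u + (v + w)" "u + v = v + u" "0 + u = u" "- u + u = 0" "u - v = u + - v"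
    "a *\<^sub>R (u + v) = a *\<^sub>R u + a *\<^sub>R v" "(a + b) *\<^sub>R u = a *\<^sub>R u + b *\<^sub>R u"
    "a *\<^sub>R b *\<^sub>R u = (a * b) *\<^sub>R u" "1 *\<^sub>R u = u"
    by (auto intro!: ell2_eqI simp: algebra_simps)
  show "inner u v = inner v u"
    by (simp add: inner_ell2_def mult.commute)
  show "inner (u + v) w = inner u w + inner v w"
    by (simp add: inner_ell2_def distrib_right infsum_add coord_mult_summable)
  show "inner (a *\<^sub>R u) v = a * inner u v"
    by (simp add: inner_ell2_def mult.assoc infsum_cmult_right')
  show "0 \<le> inner u u"
    by (simp add: inner_ell2_def infsum_nonneg)
  show "inner u u = 0 \<longleftrightarrow> u = 0"
  proof
    assume "inner u u = 0"
    then have "coord u i * coord u i = 0" for i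
      by (intro nonneg_infsum_le_0D[of "\<lambda>i. coord u i * coord u i" UNIV])
        (simp_all add: inner_ell2_def coord_mult_summable)
    then show "u = 0" by (auto intro!: ell2_eqI)
  qed (simp add: inner_ell2_def)
qed (fact norm_ell2_def sgn_ell2_def dist_ell2_def uniformity_ell2_def open_ell2_def)+

end

lemma norm_ell2_sq: "(norm u)\<^sup>2 = (\<Sum>\<^sub>\<infinity>i. (coord u i)\<^sup>2)"
  by (simp add: power2_norm_eq_inner inner_ell2_def flip: power2_eq_square)

lemma norm_ell2_eq_ell_norm: "norm u = ell_norm (ereal 2) (coord u)"
proof -
  have "norm u = sqrt (\<Sum>\<^sub>\<infinity>i. (coord u i)\<^sup>2)"
    by (metis norm_ell2_sq norm_ge_zero real_sqrt_unique)
  then show ?thesis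
    by (simp add: ell_norm_def abs_powr_2 powr_half_sqrt infsum_nonneg)
qed

lemma sum_coord_le_norm: "finite I \<Longrightarrow> (\<Sum>i\<in>I. (coord u i)\<^sup>2) \<le> (norm u)\<^sup>2"
  unfolding norm_ell2_sq by (rule finite_sum_le_infsum) (auto intro: coord_summable)

lemma abs_coord_le_norm: "\<bar>coord u i\<bar> \<le> norm u"
  using sum_coord_le_norm[of "{i}" u] by (simp add: abs_le_square_iff[symmetric])

instance ell2 :: complete_space
proof
  fix X :: "nat \<Rightarrow> ell2"
  assume X: "Cauchy X"
  have "Cauchy (\<lambda>n. coord (X n) i)" for i
  proof (rule metric_CauchyI)
    fix e :: real assume "0 < e"
    then obtain M where M: "\<And>m n. m \<ge> M \<Longrightarrow> n \<ge> M \<Longrightarrow> dist (X m) (X n) < e"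
      using X by (meson metric_CauchyD)
    show "\<exists>M. \<forall>m\<ge>M. \<forall>n\<ge>M. dist (coord (X m) i) (coord (X n) i) < e"
      using M abs_coord_le_norm[of "X _ - X _" i]
      by (metis coord_diff dist_norm order_le_less_trans real_norm_def)
  qed
  then have "\<forall>i. \<exists>l. (\<lambda>n. coord (X n) i) \<longlonglongrightarrow> l"
    by (simp add: real_Cauchy_convergent convergent_def[symmetric])
  then obtain y where y: "\<And>i. (\<lambda>n. coord (X n) i) \<longlonglongrightarrow> y i"
    by metis
  have part: "(\<Sum>i\<in>I. (coord (X n) i - y i)\<^sup>2) \<le> e\<^sup>2"
    if M: "\<And>m n. m \<ge> M \<Longrightarrow> n \<ge> M \<Longrightarrow> dist (X m) (X n) < e" and "n \<ge> M" "finite I" for e M n I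
  proof (rule LIMSEQ_le_const2)
    show "(\<lambda>m. \<Sum>i\<in>I. (coord (X n) i - coord (X m) i)\<^sup>2) \<longlonglongrightarrow> (\<Sum>i\<in>I. (coord (X n) i - y i)\<^sup>2)"
      by (intro tendsto_intros y)
    show "\<exists>N. \<forall>m\<ge>N. (\<Sum>i\<in>I. (coord (X n) i - coord (X m) i)\<^sup>2) \<le> e\<^sup>2"
    proof (intro exI[of _ M] allI impI)
      fix m assume "M \<le> m"
      then have "norm (X n - X m) \<le> e"
        using M[OF \<open>n \<ge> M\<close>] by (simp add: dist_norm less_imp_le)
      then have "(norm (X n - X m))\<^sup>2 \<le> e\<^sup>2"
        by (intro power_mono) auto
      then show "(\<Sum>i\<in>I. (coord (X n) i - coord (X m) i)\<^sup>2) \<le> e\<^sup>2"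
        using sum_coord_le_norm[OF \<open>finite I\<close>, of "X n - X m"] by simp
    qed
  qed
  have mem: "(\<lambda>i. coord (X n) i - y i) \<in> ell (ereal 2)"
    if "\<And>m n. m \<ge> M \<Longrightarrow> n \<ge> M \<Longrightarrow> dist (X m) (X n) < e" "n \<ge> M" for e M n
    unfolding ell_2_iff
    by (rule nonneg_bdd_above_summable_on) (auto intro!: bdd_aboveI2[where M = "e\<^sup>2"] part[OF that])
  obtain M where M: "\<And>m n. m \<ge> M \<Longrightarrow> n \<ge> M \<Longrightarrow> dist (X m) (X n) < 1"
    using X by (meson metric_CauchyD zero_less_one)
  have "(\<lambda>i. coord (X M) i - y i) \<in> ell (ereal 2)"
    by (rule mem[of M 1 M]) (use M in auto)
  from ell_2_add[OF coord[of "X M"] ell_2_scale[OF this, of "-1"]]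
  have yin: "y \<in> ell (ereal 2)" by simp
  define Y where "Y = ell2_of y"
  have cY: "coord Y i = y i" for i
    using yin by (simp add: Y_def ell2_of_inverse)
  have "X \<longlonglongrightarrow> Y"
  proof (rule metric_LIMSEQ_I)
    fix r :: real assume "0 < r"
    then obtain M where M: "\<And>m n. m \<ge> M \<Longrightarrow> n \<ge> M \<Longrightarrow> dist (X m) (X n) < r/2"
      using X by (meson metric_CauchyD half_gt_zero)
    have "dist (X n) Y < r" if "n \<ge> M" for n
    proof -
      have "(norm (X n - Y))\<^sup>2 \<le> (r/2)\<^sup>2"
        unfolding norm_ell2_sq using coord_summable[of "X n - Y"]
        by (intro infsum_le_finite_sums) (simp_all add: cY part[OF M that])
      then have "norm (X n - Y) \<le> r/2"
        using \<open>0 < r\<close> by (simp add: power2_le_iff_abs_le)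
      then show ?thesis using \<open>0 < r\<close> by (simp add: dist_norm)
    qed
    then show "\<exists>no. \<forall>n\<ge>no. dist (X n) Y < r" by blast
  qed
  then show "convergent X" by (rule convergentI)
qed

instance ell2 :: banach ..

lemma ell2_dense: "\<exists>Q :: ell2 set. countable Q \<and> (\<forall>u e. 0 < e \<longrightarrow> (\<exists>q\<in>Q. dist q u < e))"
proof -
  define S :: "(int \<times> rat) list \<Rightarrow> int \<Rightarrow> real" where
    "S xs = (\<lambda>i. case map_of xs i of None \<Rightarrow> 0 | Some r \<Rightarrow> real_of_rat r)" for xs
  have S_in: "S xs \<in> ell (ereal 2)" for xs
    unfolding ell_2_iff
    by (rule finite_nonzero_values_imp_summable_on, rule finite_subset[of _ "fst ` set xs"])
      (auto simp: S_def map_of_eq_None_iff split: option.splits dest: map_of_SomeD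
        intro: rev_image_eqI)
  have "\<exists>q\<in>range (\<lambda>xs. ell2_of (S xs)). dist q u < e" if "0 < e" for u e
  proof -
    define d where "d = e\<^sup>2 / 2"
    have "0 < d" using that by (simp add: d_def)
    obtain I where I: "finite I" "dist (\<Sum>i\<in>I. (coord u i)\<^sup>2) ((norm u)\<^sup>2) \<le> d / 2"
      using infsum_finite_approximation[OF coord_summable[of u], of "d/2"] \<open>0 < d\<close>
      unfolding norm_ell2_sq by auto
    define b where "b = d / (real (card I) + 1)"
    have "0 < b" using \<open>0 < d\<close> by (simp add: b_def)
    have "\<exists>r :: rat. (real_of_rat r - coord u i)\<^sup>2 \<le> b" for i
    proof -
      obtain r where "coord u i - sqrt b < real_of_rat r" "real_of_rat r < coord u i + sqrt b"
        using of_rat_dense[of "coord u i - sqrt b" "coord u i + sqrt b"] \<open>0 < b\<close> by auto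
      then have "\<bar>real_of_rat r - coord u i\<bar> \<le> sqrt b" by auto
      then have "\<bar>real_of_rat r - coord u i\<bar>\<^sup>2 \<le> (sqrt b)\<^sup>2" by (intro power_mono) auto
      then show ?thesis using \<open>0 < b\<close> by auto
    qed
    then obtain r where r: "\<And>i. (real_of_rat (r i) - coord u i)\<^sup>2 \<le> b" by metis
    obtain ks where ks: "set ks = I" using finite_list[OF I(1)] by blast
    define q where "q = ell2_of (S (map (\<lambda>i. (i, r i)) ks))"
    have q: "coord q i = (if i \<in> I then real_of_rat (r i) else 0)" for i
      unfolding q_def ell2_of_inverse[OF S_in] using ks
      by (simp add: S_def map_of_map_restrict restrict_map_def)
    have "(norm (q - u))\<^sup>2 \<le> d / 2 + d"
      unfolding norm_ell2_sq
    proof (rule infsum_le_finite_sums[OF coord_summable])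
      fix J :: "int set" assume J: "finite J"
      have "(\<Sum>i\<in>J. (coord (q - u) i)\<^sup>2)
          = (\<Sum>i\<in>J\<inter>I. (coord (q - u) i)\<^sup>2) + (\<Sum>i\<in>J-I. (coord (q - u) i)\<^sup>2)"
        using sum.Int_Diff[OF J] by blast
      also have "(\<Sum>i\<in>J\<inter>I. (coord (q - u) i)\<^sup>2) \<le> (\<Sum>i\<in>J\<inter>I. b)"
        by (intro sum_mono) (simp add: q r)
      also have "(\<Sum>i\<in>J\<inter>I. b) \<le> real (card I) * b"
        using card_mono[OF I(1), of "J \<inter> I"] \<open>0 < b\<close> by simp
      also have "\<dots> \<le> d"
        using \<open>0 < d\<close> by (simp add: b_def field_simps)
      also have "(\<Sum>i\<in>J-I. (coord (q - u) i)\<^sup>2) = (\<Sum>i\<in>J-I. (coord u i)\<^sup>2)"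
        by (intro sum.cong) (auto simp: q)
      also have "\<dots> = (\<Sum>i\<in>J\<union>I. (coord u i)\<^sup>2) - (\<Sum>i\<in>I. (coord u i)\<^sup>2)"
        using sum_diff[of "J \<union> I" I "\<lambda>i. (coord u i)\<^sup>2"] J I(1) by (simp add: Un_Diff)
      also have "\<dots> \<le> d / 2"
        using sum_coord_le_norm[of "J \<union> I" u] J I(1) I(2)[unfolded dist_real_def abs_le_iff]
        by auto
      finally show "(\<Sum>i\<in>J. (coord (q - u) i)\<^sup>2) \<le> d / 2 + d" by simp
    qed
    also have "\<dots> < e\<^sup>2"
      using \<open>0 < e\<close> by (simp add: d_def)
    finally have "dist q u < e"
      using that by (simp add: dist_norm power2_less_imp_less)
    then show ?thesis unfolding q_def by blast
  qed
  then show ?thesis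
    by (intro exI[of _ "range (\<lambda>xs. ell2_of (S xs))"]) auto
qed

instance ell2 :: second_countable_topology
proof
  obtain Q :: "ell2 set" where Q: "countable Q" "\<And>u e. 0 < e \<Longrightarrow> \<exists>q\<in>Q. dist q u < e"
    using ell2_dense by blast
  define B where "B = (\<lambda>(q, n). ball q (1 / Suc n)) ` (Q \<times> (UNIV :: nat set))"
  have "topological_basis B"
  proof (rule topological_basisI)
    fix U :: "ell2 set" and u assume "open U" "u \<in> U"
    then obtain e where e: "0 < e" "ball u e \<subseteq> U"
      by (meson openE)
    obtain n where n: "1 / real (Suc n) < e / 2"
      using nat_approx_posE[of "e/2"] e by auto
    obtain q where q: "q \<in> Q" "dist q u < 1 / Suc n"
      using Q(2)[of "1 / Suc n" u] by auto
    have "ball q (1 / Suc n) \<subseteq> ball u e"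
    proof
      fix w assume "w \<in> ball q (1 / Suc n)"
      then have "dist u w \<le> dist q u + dist q w" "dist q w < 1 / Suc n"
        using dist_triangle2[of u w q] by (auto simp: dist_commute)
      then show "w \<in> ball u e" using q n by simp
    qed
    then show "\<exists>B'\<in>B. u \<in> B' \<and> B' \<subseteq> U"
      using q e(2) by (intro bexI[of _ "ball q (1 / Suc n)"]) (auto simp: B_def)
  qed (auto simp: B_def)
  then show "\<exists>B :: ell2 set set. countable B \<and> open = generate_topology B"
    using Q(1) by (intro exI[of _ B]) (auto simp: B_def topological_basis_imp_subbasis)
qed

instance ell2 :: polish_space ..

text \<open>Strong measurability is taken with respect to the \<open>\<ell>\<^sup>r\<close> norm, hence has its usual meaning
  for the non-separable space \<open>\<ell>\<^sup>\<infinity>\<close> as well. An element of a Bochner space is represented by a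
  function with values in \<open>\<ell>\<^sup>r\<close> at every point.\<close>

definition strongly_measurable :: "real set \<Rightarrow> ereal \<Rightarrow> (real \<Rightarrow> int \<Rightarrow> real) \<Rightarrow> bool" where
  "strongly_measurable I r f \<longleftrightarrow>
     (\<exists>s :: nat \<Rightarrow> real \<Rightarrow> int \<Rightarrow> real.
        (\<forall>n. simple_function (lebesgue_on I) (s n) \<and> s n ` I \<subseteq> ell r) \<and>
        (AE t in lebesgue_on I. (\<lambda>n. ell_norm r (\<lambda>i. s n t i - f t i)) \<longlonglongrightarrow> 0))"

definition bochner_L :: "ereal \<Rightarrow> real set \<Rightarrow> ereal \<Rightarrow> (real \<Rightarrow> int \<Rightarrow> real) set" where
  "bochner_L p I r = {f. (\<forall>t\<in>I. f t \<in> ell r) \<and> strongly_measurable I r f \<and>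
     (if p = \<infinity> then \<exists>C. AE t in lebesgue_on I. ell_norm r (f t) \<le> C
      else integrable (lebesgue_on I) (\<lambda>t. ell_norm r (f t) powr real_of_ereal p))}"

definition bochner_L_loc :: "ereal \<Rightarrow> ereal \<Rightarrow> (real \<Rightarrow> int \<Rightarrow> real) set" where
  "bochner_L_loc p r = {f. \<forall>a b. f \<in> bochner_L p {a..b} r}"

definition paths :: "(real \<Rightarrow> real) set" where
  "paths = {\<omega>. continuous_on UNIV \<omega> \<and> \<omega> 0 = 0}"

definition compact_open :: "(real \<Rightarrow> real) topology" where
  "compact_open = topology_generated_by {{\<omega> \<in> paths. \<omega> ` K \<subseteq> U} | K U. compact K \<and> open U}"

definition path_borel :: "(real \<Rightarrow> real) measure" where
  "path_borel = sigma paths {G. openin compact_open G}"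

text \<open>The two-sided Wiener measure: the unique probability measure under which the coordinate
  process has independent increments, normally distributed with mean \<open>0\<close> and variance the length
  of the time interval.\<close>

definition wiener_measure :: "(real \<Rightarrow> real) measure \<Rightarrow> bool" where
  "wiener_measure P \<longleftrightarrow> prob_space P \<and> space P = paths \<and> sets P = sets path_borel \<and>
     (\<forall>s t. s < t \<longrightarrow> distributed P lborel (\<lambda>\<omega>. \<omega> t - \<omega> s) (normal_density 0 (sqrt (t - s)))) \<and>
     (\<forall>t :: nat \<Rightarrow> real. strict_mono t \<longrightarrow>
        prob_space.indep_vars P (\<lambda>_. borel) (\<lambda>i \<omega>. \<omega> (t (Suc i)) - \<omega> (t i)) UNIV)"

definition path_shift :: "real \<Rightarrow> (real \<Rightarrow> real) \<Rightarrow> real \<Rightarrow> real" where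
  "path_shift t \<omega> = (\<lambda>s. \<omega> (s + t) - \<omega> t)"

definition zOU :: "(real \<Rightarrow> real) \<Rightarrow> real" where
  "zOU \<omega> = - (LBINT s:{..0}. exp s * \<omega> s)"

text \<open>The integrability condition only says that \<open>zOU\<close> is given by a convergent integral on
  the set.\<close>

definition admissible_paths :: "(real \<Rightarrow> real) measure \<Rightarrow> (real \<Rightarrow> real) set \<Rightarrow> bool" where
  "admissible_paths P \<Omega> \<longleftrightarrow> \<Omega> \<in> sets P \<and> (AE \<omega> in P. \<omega> \<in> \<Omega>) \<and> (\<forall>t. path_shift t ` \<Omega> = \<Omega>) \<and>
     (\<forall>\<omega>\<in>\<Omega>. set_integrable lborel {..0} (\<lambda>s. exp s * \<omega> s) \<and>
        continuous_on UNIV (\<lambda>t. zOU (path_shift t \<omega>)) \<and>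
        ((\<lambda>t. zOU (path_shift t \<omega>) / t) \<longlongrightarrow> 0) at_top \<and>
        ((\<lambda>t. zOU (path_shift t \<omega>) / t) \<longlongrightarrow> 0) at_bot \<and>
        ((\<lambda>t. 1 / t * (LBINT s=0..t. zOU (path_shift s \<omega>))) \<longlongrightarrow> 0) at_top \<and>
        ((\<lambda>t. 1 / t * (LBINT s=0..t. zOU (path_shift s \<omega>))) \<longlongrightarrow> 0) at_bot)"

definition lapA :: "ell2 \<Rightarrow> ell2" where
  "lapA u = ell2_of (\<lambda>i. 2 * coord u i - coord u (i - 1) - coord u (i + 1))"

definition nemytskii :: "(int \<Rightarrow> real \<Rightarrow> real) \<Rightarrow> ell2 \<Rightarrow> ell2" where
  "nemytskii f u = ell2_of (\<lambda>i. f i (coord u i))"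

definition rhsF :: "real \<Rightarrow> real \<Rightarrow> (int \<Rightarrow> real \<Rightarrow> real) \<Rightarrow> (real \<Rightarrow> int \<Rightarrow> real \<Rightarrow> real) \<Rightarrow>
    (real \<Rightarrow> ell2) \<Rightarrow> (real \<Rightarrow> ell2) \<Rightarrow> real \<Rightarrow> (real \<Rightarrow> real) \<Rightarrow> ell2 \<Rightarrow> ell2" where
  "rhsF lam k f g h h' t \<omega> v =
     (let z = zOU (path_shift t \<omega>); u = exp (k * z) *\<^sub>R v - (1 / k) *\<^sub>R h t in
        - lapA (lapA v) + (k * z - lam) *\<^sub>R v
        + exp (- k * z) *\<^sub>R (- lapA (nemytskii f u) + nemytskii (g t) u)
        + (exp (- k * z) / k) *\<^sub>R (lapA (lapA (h t)) + lam *\<^sub>R h t + h' t))"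

text \<open>Solutions are understood in the Caratheodory sense, since \<open>rhsF\<close> need not be continuous
  in \<open>t\<close>.\<close>

definition solves_ivp :: "(real \<Rightarrow> ell2 \<Rightarrow> ell2) \<Rightarrow> real \<Rightarrow> ell2 \<Rightarrow> (real \<Rightarrow> ell2) \<Rightarrow> bool" where
  "solves_ivp G \<tau> v0 w \<longleftrightarrow> continuous_on {\<tau>..} w \<and>
     (\<forall>t\<ge>\<tau>. integrable (lebesgue_on {\<tau>..t}) (\<lambda>s. G s (w s)) \<and>
        w t = v0 + integral\<^sup>L (lebesgue_on {\<tau>..t}) (\<lambda>s. G s (w s)))"

definition sol_u :: "real \<Rightarrow> (real \<Rightarrow> ell2) \<Rightarrow> (real \<Rightarrow> real \<Rightarrow> (real \<Rightarrow> real) \<Rightarrow> ell2 \<Rightarrow> ell2) \<Rightarrow>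
    real \<Rightarrow> real \<Rightarrow> (real \<Rightarrow> real) \<Rightarrow> ell2 \<Rightarrow> ell2" where
  "sol_u k h v t \<tau> \<omega> u\<^sub>\<tau> =
     exp (k * zOU (path_shift t \<omega>)) *\<^sub>R
       v t \<tau> \<omega> (exp (- k * zOU (path_shift \<tau> \<omega>)) *\<^sub>R (u\<^sub>\<tau> + (1 / k) *\<^sub>R h \<tau>)) - (1 / k) *\<^sub>R h t"

definition cocycle :: "real \<Rightarrow> (real \<Rightarrow> ell2) \<Rightarrow> (real \<Rightarrow> real \<Rightarrow> (real \<Rightarrow> real) \<Rightarrow> ell2 \<Rightarrow> ell2) \<Rightarrow>
    real \<Rightarrow> real \<Rightarrow> (real \<Rightarrow> real) \<Rightarrow> ell2 \<Rightarrow> ell2" where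
  "cocycle k h v t \<tau> \<omega> u\<^sub>\<tau> = sol_u k h v (t + \<tau>) \<tau> (path_shift (- \<tau>) \<omega>) u\<^sub>\<tau>"

text \<open>Random sets are indexed by all functions \<open>real \<Rightarrow> real\<close>; only the values at \<open>\<omega> \<in> \<Omega>\<close>
  matter.\<close>

definition random_set :: "(real \<Rightarrow> real) measure \<Rightarrow> (real \<Rightarrow> real) set \<Rightarrow>
    (real \<Rightarrow> (real \<Rightarrow> real) \<Rightarrow> ell2 set) \<Rightarrow> bool" where
  "random_set P \<Omega> D \<longleftrightarrow> (\<forall>\<tau>. \<forall>\<omega>\<in>\<Omega>. D \<tau> \<omega> \<noteq> {}) \<and>
     (\<forall>x \<tau>. (\<lambda>\<omega>. infdist x (D \<tau> \<omega>)) \<in> borel_measurable (restrict_space P \<Omega>))"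

definition set_norm :: "ell2 set \<Rightarrow> ennreal" where
  "set_norm D = (SUP u\<in>D. ennreal (norm u))"

definition tempered :: "(real \<Rightarrow> real) measure \<Rightarrow> (real \<Rightarrow> real) set \<Rightarrow> real \<Rightarrow> real \<Rightarrow>
    (real \<Rightarrow> (real \<Rightarrow> real) \<Rightarrow> ell2 set) set" where
  "tempered P \<Omega> lam0 k = {D. random_set P \<Omega> D \<and>
     (\<forall>\<tau>. \<forall>\<omega>\<in>\<Omega>.
        ((\<lambda>s. ennreal (exp (lam0 * s + 2 * k * (LBINT r=s..0. zOU (path_shift r \<omega>))
                            - 2 * k * zOU (path_shift s \<omega>)))
              * (set_norm (D (\<tau> + s) (path_shift s \<omega>)))\<^sup>2) \<longlongrightarrow> 0) at_bot)}"

definition semidist :: "ell2 set \<Rightarrow> ell2 set \<Rightarrow> ennreal" where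
  "semidist B C = (SUP b\<in>B. ennreal (infdist b C))"

definition pullback_attractor :: "(real \<Rightarrow> real) measure \<Rightarrow> (real \<Rightarrow> real) set \<Rightarrow>
    (real \<Rightarrow> (real \<Rightarrow> real) \<Rightarrow> ell2 set) set \<Rightarrow>
    (real \<Rightarrow> real \<Rightarrow> (real \<Rightarrow> real) \<Rightarrow> ell2 \<Rightarrow> ell2) \<Rightarrow>
    (real \<Rightarrow> (real \<Rightarrow> real) \<Rightarrow> ell2 set) \<Rightarrow> bool" where
  "pullback_attractor P \<Omega> \<D> \<phi> \<A> \<longleftrightarrow> random_set P \<Omega> \<A> \<and>
     (\<forall>\<tau>. AE \<omega> in P. \<omega> \<in> \<Omega> \<longrightarrow> compact (\<A> \<tau> \<omega>)) \<and>
     (\<forall>\<tau>. \<forall>\<omega>\<in>\<Omega>. \<forall>t\<ge>0. \<phi> t \<tau> \<omega> ` \<A> \<tau> \<omega> = \<A> (\<tau> + t) (path_shift t \<omega>)) \<and>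
     (\<forall>D\<in>\<D>. \<forall>\<tau>. \<forall>\<omega>\<in>\<Omega>.
        ((\<lambda>t. semidist (\<phi> t (\<tau> - t) (path_shift (- t) \<omega>) ` D (\<tau> - t) (path_shift (- t) \<omega>)) (\<A> \<tau> \<omega>))
           \<longlongrightarrow> 0) at_top) \<and>
     (\<exists>K\<in>\<D>. \<forall>\<tau>. \<forall>\<omega>\<in>\<Omega>. closed (K \<tau> \<omega>) \<and> \<A> \<tau> \<omega> \<subseteq> K \<tau> \<omega>)"

text \<open>A function on \<open>(-\<infinity>,a]\<close> is represented by an arbitrary extension to the real line; by
  linearity and the last condition the value of the functional does not depend on the extension.\<close>

definition generalized_Banach_limit :: "((real \<Rightarrow> real) \<Rightarrow> real) \<Rightarrow> bool" where
  "generalized_Banach_limit L \<longleftrightarrow>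
     (\<exists>a. let B = {\<zeta> :: real \<Rightarrow> real. bounded (\<zeta> ` {..a})} in
        (\<forall>\<zeta>\<in>B. \<forall>\<eta>\<in>B. L (\<lambda>t. \<zeta> t + \<eta> t) = L \<zeta> + L \<eta>) \<and>
        (\<forall>\<zeta>\<in>B. \<forall>c. L (\<lambda>t. c * \<zeta> t) = c * L \<zeta>) \<and>
        (\<forall>\<zeta>\<in>B. (\<forall>t\<le>a. 0 \<le> \<zeta> t) \<longrightarrow> 0 \<le> L \<zeta>) \<and>
        (\<forall>\<zeta>\<in>B. \<forall>l. (\<zeta> \<longlongrightarrow> l) at_bot \<longrightarrow> L \<zeta> = l))"

definition measure_support :: "ell2 measure \<Rightarrow> ell2 set" where
  "measure_support \<mu> = {x. \<forall>U. open U \<and> x \<in> U \<longrightarrow> 0 < emeasure \<mu> U}"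

end

theory Submission
  imports Defs
begin

text \<open>
  Along a fixed path \<open>\<omega>\<close> the cocycle becomes a process \<open>U(t,s)\<close> with \<open>U(t,s)U(s,r) = U(t,r)\<close>, and
  \<open>K(t) = \<A>(t, \<theta>\<^sub>t\<omega>)\<close> attracts \<open>U(t,s)\<xi>(s)\<close> as \<open>s \<rightarrow> -\<infinity>\<close>. A one-sided Lipschitz estimate for the vector
  field makes \<open>s \<mapsto> U(t,s)\<xi>(s)\<close> continuous, so the averages of \<open>\<Upsilon>(U(t,s)\<xi>(s))\<close> over \<open>[\<tau>,t]\<close> are
  well-defined and bounded in \<open>\<tau>\<close>, and their generalized limit is a positive functional of \<open>\<Upsilon>\<close> that
  only depends on the restriction of \<open>\<Upsilon>\<close> to the compact set \<open>K(t)\<close>. The Riesz theorem represents it by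
  a probability measure on \<open>K(t)\<close>. Moving the end point of the average from \<open>t\<close> to \<open>s\<close> does not change
  the limit, which is the invariance of the measures. Finally \<open>K(t)\<close> is compact for all \<open>t\<close>
  simultaneously for almost every \<open>\<omega>\<close>, because the Wiener measure is invariant under the shifts.
\<close>

section \<open>Shift invariance of the Wiener measure\<close>

text \<open>The derivative of \<open>g\<close> in its last argument is bounded only from above, and
  the vector field is merely integrable in time. Two solutions are therefore compared through the
  square of their distance, which is never differentiated: an integral identity obtained from
  Fubini, Gronwall's lemma, and a continuity argument that keeps the solutions in the ball where the
  constants hold replace the usual computation. Solutions started at different times share no
  initial value; the earlier one is first carried to the later of the two starting times and
  compared there.

  The state space is not locally compact and the observables may be unbounded, so the measure is not
  obtained from compactly supported test functions. It is built from an outer measure, and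
  compactness of K(t) enters in the proof of countable subadditivity.

  The measures are chosen orbit by orbit. The pair (\<tau>, \<omega>) lies on the orbit of the base
  path \<open>path_shift (- \<tau>) \<omega>\<close>, and the choice made for that base path is the
  one used at (\<tau>, \<omega>), so different choices cannot clash.\<close>

lemma openin_compact_open_subset: "openin compact_open G \<Longrightarrow> G \<subseteq> paths"
  by (drule openin_subset) (auto simp: compact_open_def)

lemma space_path_borel [simp]: "space path_borel = paths"
  and sets_path_borel: "sets path_borel = sigma_sets paths {G. openin compact_open G}"
  using openin_compact_open_subset by (simp_all add: path_borel_def Pow_def subset_iff)

section \<open>Cylinder sets generate the Borel sets of the compact-open topology\<close>

definition cylinders :: "(real \<Rightarrow> real) set set" where
  "cylinders = {{\<omega> \<in> paths. \<forall>t\<in>F. \<omega> t \<in> B t} | F B. finite F \<and> range B \<subseteq> sets borel}"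

lemma cylindersI:
  "finite F \<Longrightarrow> (\<And>t. B t \<in> sets borel) \<Longrightarrow> {\<omega> \<in> paths. \<forall>t\<in>F. \<omega> t \<in> B t} \<in> cylinders"
  unfolding cylinders_def by blast

lemma Int_stable_cylinders: "Int_stable cylinders"
proof (rule Int_stableI)
  fix X Y assume "X \<in> cylinders" "Y \<in> cylinders"
  then obtain F B F' B' where X: "X = {\<omega> \<in> paths. \<forall>t\<in>F. \<omega> t \<in> B t}" "finite F" "range B \<subseteq> sets borel"
    and Y: "Y = {\<omega> \<in> paths. \<forall>t\<in>F'. \<omega> t \<in> B' t}" "finite F'" "range B' \<subseteq> sets borel"
    unfolding cylinders_def by blast
  have "X \<inter> Y = {\<omega> \<in> paths. \<forall>t\<in>F \<union> F'. (t \<in> F \<longrightarrow> \<omega> t \<in> B t) \<and> (t \<in> F' \<longrightarrow> \<omega> t \<in> B' t)}"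
    unfolding X(1) Y(1) by blast
  \<comment> \<open>Each family of constraints is padded by \<open>UNIV\<close> off its own index
    set, so that both can be read over \<open>F \<union> F'\<close>.\<close>
  also have "\<dots> = {\<omega> \<in> paths. \<forall>t\<in>F \<union> F'. \<omega> t \<in> (if t \<in> F then B t else UNIV) \<inter> (if t \<in> F' then B' t else UNIV)}"
    by (intro Collect_cong conj_cong ball_cong refl) simp
  also have "\<dots> \<in> cylinders"
    using X(2,3) Y(2,3) by (intro cylindersI) (simp_all add: image_subset_iff)
  finally show "X \<inter> Y \<in> cylinders" .
qed

lemma measurable_eval_path_borel: "(\<lambda>\<omega>. \<omega> t) \<in> borel_measurable path_borel"
proof (rule borel_measurableI)
  fix S :: "real set" assume "open S"
  then have "openin compact_open {\<omega> \<in> paths. \<omega> ` {t} \<subseteq> S}"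
    unfolding compact_open_def
    by (intro topology_generated_by_Basis CollectI exI[of _ "{t}"] exI[of _ S]) simp
  then have "{\<omega> \<in> paths. \<omega> ` {t} \<subseteq> S} \<in> sets path_borel"
    unfolding sets_path_borel by (intro sigma_sets.Basic) simp
  moreover have "{\<omega> \<in> paths. \<omega> ` {t} \<subseteq> S} = (\<lambda>\<omega>. \<omega> t) -` S \<inter> space path_borel" by auto
  ultimately show "(\<lambda>\<omega>. \<omega> t) -` S \<inter> space path_borel \<in> sets path_borel" by simp
qed

text \<open>Rational end points make this family countable, so that open sets become countable
  unions of finite intersections. The condition \<open>a < b\<close> guarantees a rational time
  inside the interval.\<close>

definition windows :: "(real \<Rightarrow> real) set set" where
  "windows = {{\<omega> \<in> paths. \<omega> ` {a..b} \<subseteq> {c<..<d}} | a b c d. a \<in> \<rat> \<and> b \<in> \<rat> \<and> c \<in> \<rat> \<and> d \<in> \<rat> \<and> a < b}"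

lemma windowsI:
  "a \<in> \<rat> \<Longrightarrow> b \<in> \<rat> \<Longrightarrow> c \<in> \<rat> \<Longrightarrow> d \<in> \<rat> \<Longrightarrow> a < b \<Longrightarrow> {\<omega> \<in> paths. \<omega> ` {a..b} \<subseteq> {c<..<d}} \<in> windows"
  unfolding windows_def by blast

lemma countable_windows: "countable windows"
proof -
  have "windows \<subseteq> (\<lambda>(a, b, c, d). {\<omega> \<in> paths. \<omega> ` {a..b} \<subseteq> {c<..<d}}) ` (\<rat> \<times> \<rat> \<times> \<rat> \<times> \<rat>)"
  proof
    fix X assume "X \<in> windows"
    then obtain a b c d where "X = {\<omega> \<in> paths. \<omega> ` {a..b} \<subseteq> {c<..<d}}"
      and "(a, b, c, d) \<in> \<rat> \<times> \<rat> \<times> \<rat> \<times> \<rat>"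
      unfolding windows_def by auto
    then show "X \<in> (\<lambda>(a, b, c, d). {\<omega> \<in> paths. \<omega> ` {a..b} \<subseteq> {c<..<d}}) ` (\<rat> \<times> \<rat> \<times> \<rat> \<times> \<rat>)"
      by (intro image_eqI[of _ _ "(a, b, c, d)"]) auto
  qed
  then show ?thesis
    by (rule countable_subset) (intro countable_image countable_SIGMA countable_rat)
qed

text \<open>The image of \<open>{a..b}\<close> under a path is compact, so if it lies in the open
  interval it keeps a margin \<open>1 / Suc n\<close> from both ends. Conversely, a closed margin
  that holds at all rational times holds everywhere by continuity. Both quantifiers are
  countable.\<close>

lemma window_generated:
  assumes "X \<in> windows" shows "X \<in> sigma_sets paths cylinders"
proof -
  interpret sigma_algebra paths "sigma_sets paths cylinders"
    by (rule sigma_algebra_sigma_sets) (auto simp: cylinders_def)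
  obtain a b c d where X: "X = {\<omega> \<in> paths. \<omega> ` {a..b} \<subseteq> {c<..<d}}" and "a < b"
    using assms unfolding windows_def by blast
  define E where "E n r = {\<omega> \<in> paths. \<forall>t\<in>{r}. \<omega> t \<in> {c + 1 / Suc n..d - 1 / Suc n}}" for n :: nat and r :: real
  have "X = (\<Union>n. \<Inter>r\<in>\<rat> \<inter> {a..b}. E n r)"
  proof (intro equalityI subsetI)
    fix \<omega> assume w: "\<omega> \<in> X"
    then have cont: "continuous_on {a..b} \<omega>" and p: "\<omega> \<in> paths"
      unfolding X paths_def by (auto intro: continuous_on_subset)
    have im: "compact (\<omega> ` {a..b})" "\<omega> ` {a..b} \<noteq> {}"
      using cont \<open>a < b\<close> by (auto intro: compact_continuous_image)
    obtain m where m: "m \<in> \<omega> ` {a..b}" "\<And>y. y \<in> \<omega> ` {a..b} \<Longrightarrow> m \<le> y"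
      using compact_attains_inf[OF im] by blast
    obtain M where M: "M \<in> \<omega> ` {a..b}" "\<And>y. y \<in> \<omega> ` {a..b} \<Longrightarrow> y \<le> M"
      using compact_attains_sup[OF im] by blast
    have "c < m" "M < d" using w m(1) M(1) unfolding X by auto
    then obtain n where n: "1 / real (Suc n) < min (m - c) (d - M)"
      using nat_approx_posE[of "min (m - c) (d - M)"] by auto
    have "\<omega> \<in> E n r" if "r \<in> {a..b}" for r
      using m(2)[of "\<omega> r"] M(2)[of "\<omega> r"] n p that unfolding E_def by auto
    then show "\<omega> \<in> (\<Union>n. \<Inter>r\<in>\<rat> \<inter> {a..b}. E n r)" by blast
  next
    fix \<omega> assume "\<omega> \<in> (\<Union>n. \<Inter>r\<in>\<rat> \<inter> {a..b}. E n r)"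
    then obtain n where "\<omega> \<in> (\<Inter>r\<in>\<rat> \<inter> {a..b}. E n r)" by (rule UN_E)
    then have n: "\<omega> \<in> E n r" if "r \<in> \<rat>" "r \<in> {a..b}" for r
      using that by (elim INT_D) blast
    obtain r0 where "r0 \<in> \<rat>" "a < r0" "r0 < b" using Rats_dense_in_real[OF \<open>a < b\<close>] by blast
    then have p: "\<omega> \<in> paths" using n[of r0] by (auto simp: E_def)
    have cont: "continuous_on UNIV \<omega>" using p by (simp add: paths_def)
    have "\<omega> x \<in> {c + 1 / Suc n..d - 1 / Suc n}" if x: "x \<in> {a..b}" for x
    proof (rule ccontr)
      let ?V = "\<omega> -` (- {c + 1 / Suc n..d - 1 / Suc n})"
      assume "\<omega> x \<notin> {c + 1 / Suc n..d - 1 / Suc n}"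
      then have "x \<in> ?V" by blast
      moreover have "open ?V" using cont by (intro open_vimage) auto
      ultimately obtain r where r: "r > 0" "ball x r \<subseteq> ?V" using openE by blast
      \<comment> \<open>The two-sided choice of \<open>y\<close> keeps it in \<open>{a..b}\<close>
        as well as in the ball, even when \<open>x\<close> is an end point.\<close>
      obtain y where y: "y \<in> \<rat>" "max a (x - r) < y" "y < min b (x + r)"
        using Rats_dense_in_real[of "max a (x - r)" "min b (x + r)"] x r \<open>a < b\<close> by auto
      then have "y \<in> ball x r" by (auto simp: dist_real_def)
      moreover have "y \<notin> ?V" using n[of y] y by (auto simp: E_def)
      ultimately show False using r by blast
    qed
    then have "\<omega> ` {a..b} \<subseteq> {c + 1 / Suc n..d - 1 / Suc n}" by blast
    also have "\<dots> \<subseteq> {c<..<d}"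
    proof
      fix y assume "y \<in> {c + 1 / real (Suc n)..d - 1 / real (Suc n)}"
      moreover have "0 < 1 / real (Suc n)" by simp
      ultimately show "y \<in> {c<..<d}"
        unfolding atLeastAtMost_iff greaterThanLessThan_iff by linarith
    qed
    finally show "\<omega> \<in> X" unfolding X using p by simp
  qed
  also have "\<dots> \<in> sigma_sets paths cylinders"
  proof (intro countable_UN subsetI, elim imageE)
    fix n :: nat
    have "\<rat> \<inter> {a..b} \<noteq> {}" using Rats_dense_in_real[OF \<open>a < b\<close>] by force
    moreover have "E n r \<in> sigma_sets paths cylinders" for r
      unfolding E_def by (intro sigma_sets.Basic cylindersI) auto
    ultimately have "(\<Inter>r\<in>\<rat> \<inter> {a..b}. E n r) \<in> sigma_sets paths cylinders"
      by (intro countable_INT' countable_Int1 countable_rat) auto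
    then show "x \<in> sigma_sets paths cylinders" if "x = (\<Inter>r\<in>\<rat> \<inter> {a..b}. E n r)" for x
      using that by simp
  qed
  finally show ?thesis .
qed

text \<open>Induction on the generation of the topology. For a subbasic set, continuity gives each
  point of \<open>K\<close> a rational time interval that \<omega> maps into a rational interval
  inside \<open>U\<close>; finitely many of these time intervals cover \<open>K\<close>. The
  intersection with \<open>paths\<close> covers the case \<open>T = {}\<close>, where
  \<open>\<Inter>T\<close> is everything.\<close>

lemma compact_open_window_nbhd:
  assumes "openin compact_open G" "\<omega> \<in> G"
  shows "\<exists>T. finite T \<and> T \<subseteq> windows \<and> \<omega> \<in> \<Inter>T \<and> paths \<inter> \<Inter>T \<subseteq> G"
proof -
  have "generate_topology_on {{\<omega> \<in> paths. \<omega> ` K \<subseteq> U} |K U. compact K \<and> open U} G"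
    using assms(1) unfolding compact_open_def openin_topology_generated_by_iff .
  then show ?thesis using assms(2)
  proof (induction arbitrary: \<omega> rule: generate_topology_on.induct)
    case Empty
    then show ?case by simp
  next
    case (Int a b)
    obtain T T' where T: "finite T" "T \<subseteq> windows" "\<omega> \<in> \<Inter>T" "paths \<inter> \<Inter>T \<subseteq> a"
      and T': "finite T'" "T' \<subseteq> windows" "\<omega> \<in> \<Inter>T'" "paths \<inter> \<Inter>T' \<subseteq> b"
      using Int.IH(1)[of \<omega>] Int.IH(2)[of \<omega>] Int.prems by blast
    show ?case by (rule exI[of _ "T \<union> T'"]) (use T T' in auto)
  next
    case (UN \<K>)
    then obtain k where "k \<in> \<K>" "\<omega> \<in> k" by blast
    then obtain T where "finite T" "T \<subseteq> windows" "\<omega> \<in> \<Inter>T" "paths \<inter> \<Inter>T \<subseteq> k"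
      using UN.IH[of k \<omega>] by metis
    then show ?case using \<open>k \<in> \<K>\<close> by (intro exI[of _ T]) auto
  next
    case (Basis s)
    then obtain K U where s: "s = {\<omega> \<in> paths. \<omega> ` K \<subseteq> U}" and "compact K" "open U" by blast
    have cont: "continuous_on UNIV \<omega>" and p: "\<omega> \<in> paths"
      using Basis.prems by (auto simp: s paths_def)
    have "\<exists>a b c d. a \<in> \<rat> \<and> b \<in> \<rat> \<and> c \<in> \<rat> \<and> d \<in> \<rat> \<and> a < x \<and> x < b \<and> \<omega> ` {a..b} \<subseteq> {c<..<d} \<and> {c<..<d} \<subseteq> U"
      if "x \<in> K" for x
    proof -
      have "\<omega> x \<in> U" using that Basis.prems by (auto simp: s)
      then obtain e where e: "e > 0" "ball (\<omega> x) e \<subseteq> U" using \<open>open U\<close> openE by blast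
      obtain c where c: "c \<in> \<rat>" "\<omega> x - e < c" "c < \<omega> x" using Rats_dense_in_real[of "\<omega> x - e" "\<omega> x"] e by auto
      obtain d where d: "d \<in> \<rat>" "\<omega> x < d" "d < \<omega> x + e" using Rats_dense_in_real[of "\<omega> x" "\<omega> x + e"] e by auto
      have sub: "{c<..<d} \<subseteq> U"
        using e(2) c d by (force simp: subset_iff dist_real_def)
      have "open (\<omega> -` {c<..<d})" using cont by (simp add: open_vimage)
      moreover have "x \<in> \<omega> -` {c<..<d}" using c d by simp
      ultimately obtain r where r: "r > 0" "ball x r \<subseteq> \<omega> -` {c<..<d}" using openE by blast
      obtain a where a: "a \<in> \<rat>" "x - r < a" "a < x" using Rats_dense_in_real[of "x - r" x] r by auto
      obtain b where b: "b \<in> \<rat>" "x < b" "b < x + r" using Rats_dense_in_real[of x "x + r"] r by auto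
      have "{a..b} \<subseteq> ball x r" using a b by (auto simp: dist_real_def)
      then have "\<omega> ` {a..b} \<subseteq> {c<..<d}" using r(2) by blast
      then show ?thesis using a b c d sub by blast
    qed
    then obtain a b c d where abcd: "\<And>x. x \<in> K \<Longrightarrow> a x \<in> \<rat> \<and> b x \<in> \<rat> \<and> c x \<in> \<rat> \<and> d x \<in> \<rat> \<and> a x < x \<and> x < b x
        \<and> \<omega> ` {a x..b x} \<subseteq> {c x<..<d x} \<and> {c x<..<d x} \<subseteq> U"
      by metis
    have "K \<subseteq> (\<Union>x\<in>K. {a x<..<b x})" using abcd by force
    then obtain J where J: "J \<subseteq> K" "finite J" "K \<subseteq> (\<Union>x\<in>J. {a x<..<b x})"
      using compactE_image[OF \<open>compact K\<close>, of K "\<lambda>x. {a x<..<b x}"] by auto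
    define W where "W x = {\<eta> \<in> paths. \<eta> ` {a x..b x} \<subseteq> {c x<..<d x}}" for x
    show ?case
    proof (intro exI[of _ "W ` J"] conjI)
      show "W ` J \<subseteq> windows"
      proof
        fix X assume "X \<in> W ` J"
        then obtain x where "x \<in> J" "X = W x" by blast
        then have "x \<in> K" "a x < b x" using J(1) abcd[of x] by auto
        then show "X \<in> windows"
          unfolding \<open>X = W x\<close> W_def using abcd[of x] by (intro windowsI) simp_all
      qed
      show "\<omega> \<in> \<Inter> (W ` J)"
        using abcd J(1) p by (auto simp: W_def)
      show "paths \<inter> \<Inter> (W ` J) \<subseteq> s"
      proof
        fix \<eta> assume e: "\<eta> \<in> paths \<inter> \<Inter> (W ` J)"
        have "\<eta> y \<in> U" if y: "y \<in> K" for y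
        proof -
          obtain x where "x \<in> J" "y \<in> {a x<..<b x}" using J(3) y by blast
          then have "\<eta> \<in> W x" "y \<in> {a x..b x}" using e by auto
          then have "\<eta> y \<in> {c x<..<d x}" unfolding W_def by blast
          then show ?thesis using abcd[of x] J(1) \<open>x \<in> J\<close> by blast
        qed
        then show "\<eta> \<in> s" using e by (auto simp: s)
      qed
    qed (use J in auto)
  qed
qed

text \<open>Every open set is the union of the finite intersections of windows that it contains, and
  there are only countably many such intersections. The converse inclusion is the measurability of
  the evaluations.\<close>

lemma sets_path_borel_cylinders: "sets path_borel = sigma_sets paths cylinders"
proof
  interpret sigma_algebra paths "sigma_sets paths cylinders"
    by (rule sigma_algebra_sigma_sets) (auto simp: cylinders_def)
  have "G \<in> sigma_sets paths cylinders" if G: "openin compact_open G" for G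
  proof -
    define \<T> where "\<T> = {T. finite T \<and> T \<subseteq> windows \<and> paths \<inter> \<Inter>T \<subseteq> G}"
    have "countable \<T>"
      by (rule countable_subset[OF _ countable_Collect_finite_subset[OF countable_windows]])
        (auto simp: \<T>_def)
    moreover have "paths \<inter> \<Inter>T \<in> sigma_sets paths cylinders" if "finite T" "T \<subseteq> windows" for T
      using that
    proof induction
      case empty
      then show ?case by (simp add: top)
    next
      case (insert X T)
      have "paths \<inter> \<Inter>(insert X T) = X \<inter> (paths \<inter> \<Inter>T)" by auto
      with insert window_generated[of X] show ?case by auto
    qed
    ultimately have "(\<Union>T\<in>\<T>. paths \<inter> \<Inter>T) \<in> sigma_sets paths cylinders"
      by (intro countable_UN') (auto simp: \<T>_def)
    moreover have "G = (\<Union>T\<in>\<T>. paths \<inter> \<Inter>T)"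
    proof
      show "G \<subseteq> (\<Union>T\<in>\<T>. paths \<inter> \<Inter>T)"
      proof
        fix \<omega> assume w: "\<omega> \<in> G"
        obtain T where T: "finite T" "T \<subseteq> windows" "\<omega> \<in> \<Inter>T" "paths \<inter> \<Inter>T \<subseteq> G"
          using compact_open_window_nbhd[OF G w] by blast
        moreover have "\<omega> \<in> paths" using openin_compact_open_subset[OF G] w by blast
        ultimately show "\<omega> \<in> (\<Union>T\<in>\<T>. paths \<inter> \<Inter>T)" unfolding \<T>_def by blast
      qed
    qed (auto simp: \<T>_def)
    ultimately show ?thesis by simp
  qed
  then show "sets path_borel \<subseteq> sigma_sets paths cylinders"
    unfolding sets_path_borel by (intro sigma_sets_subset) auto
  show "sigma_sets paths cylinders \<subseteq> sets path_borel"
  proof -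
    have "X \<in> sets path_borel" if cyl: "X \<in> cylinders" for X
    proof -
      obtain F B where X: "X = {\<omega> \<in> paths. \<forall>t\<in>F. \<omega> t \<in> B t}" "finite F" "range B \<subseteq> sets borel"
        using cyl unfolding cylinders_def by blast
      have "{\<omega> \<in> space path_borel. \<forall>t\<in>F. \<omega> t \<in> B t} \<in> sets path_borel"
      proof (rule sets.sets_Collect_finite_All[OF _ X(2)])
        fix t assume "t \<in> F"
        have "(\<lambda>\<omega>. \<omega> t) -` B t \<inter> space path_borel \<in> sets path_borel"
          using X(3) by (intro measurable_sets[OF measurable_eval_path_borel]) auto
        then show "{\<omega> \<in> space path_borel. \<omega> t \<in> B t} \<in> sets path_borel"
          by (simp add: vimage_def Int_def conj_commute)
      qed
      then show ?thesis unfolding X by simp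
    qed
    then have "sigma_sets (space path_borel) cylinders \<subseteq> sets path_borel"
      by (intro sets.sigma_sets_subset) auto
    then show ?thesis unfolding space_path_borel .
  qed
qed

section \<open>The joint law of increments and the effect of a shift of time\<close>

lemma finite_subset_range_strict_mono:
  fixes F :: "real set" assumes "finite F"
  shows "\<exists>T :: nat \<Rightarrow> real. strict_mono T \<and> F \<subseteq> range T"
proof -
  define xs where "xs = sorted_list_of_set F"
  \<comment> \<open>\<open>wiener_measure\<close> speaks of increments along infinite increasing
    sequences, so the sorted list of \<open>F\<close> is continued by an arithmetic progression.
    Inserting 0 keeps \<open>Max\<close> defined for empty \<open>F\<close>. If \<open>F\<close> is
    nonempty, the first continued index is at least 1, which makes the jump past the last entry
    strict.\<close>
  define T where "T i = (if i < length xs then xs ! i else Max (insert 0 F) + real i)" for i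
  have T_Suc: "T i < T (Suc i)" for i
  proof -
    consider "Suc i < length xs" | "Suc i = length xs" | "length xs \<le> i" by linarith
    then show ?thesis
    proof cases
      case 1
      then show ?thesis
        using sorted_wrt_nth_less[of "(<)" xs i "Suc i"] strict_sorted_list_of_set[of F] by (simp add: T_def xs_def)
    next
      case 2
      then have "xs ! i \<in> F" using assms unfolding xs_def by (metis lessI nth_mem set_sorted_list_of_set)
      then have "xs ! i \<le> Max (insert 0 F)" using assms by (intro Max_ge) auto
      then show ?thesis using 2 by (simp add: T_def)
    next
      case 3
      then show ?thesis by (simp add: T_def)
    qed
  qed
  have "F \<subseteq> range T"
  proof
    fix x assume "x \<in> F"
    then obtain i where "i < length xs" "xs ! i = x"
      using assms unfolding xs_def by (metis in_set_conv_nth set_sorted_list_of_set)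
    then have "T i = x" by (simp add: T_def)
    then show "x \<in> range T" by blast
  qed
  then show ?thesis using T_Suc by (meson strict_mono_Suc_iff)
qed

lemma wiener_measurable_eval:
  assumes "wiener_measure P" shows "(\<lambda>\<omega>. \<omega> t) \<in> borel_measurable P"
  using measurable_eval_path_borel[of t] assms measurable_cong_sets[of P path_borel borel borel]
  by (auto simp: wiener_measure_def)

text \<open>The right-hand side depends on the times only through the gaps
  \<open>T (Suc i) - T i\<close>, and a shift of all times leaves these unchanged. This is the
  source of the shift invariance.\<close>

lemma wiener_increments_law:
  fixes T :: "nat \<Rightarrow> real"
  assumes P: "wiener_measure P" and T: "strict_mono T"
  shows "distr P (Pi\<^sub>M UNIV (\<lambda>_. borel)) (\<lambda>\<omega> i. \<omega> (T (Suc i)) - \<omega> (T i))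
    = Pi\<^sub>M UNIV (\<lambda>i. density lborel (normal_density 0 (sqrt (T (Suc i) - T i))))"
proof -
  interpret prob_space P using P by (simp add: wiener_measure_def)
  note [measurable] = wiener_measurable_eval[OF P]
  have incr: "distr P borel (\<lambda>\<omega>. \<omega> (T (Suc i)) - \<omega> (T i))
      = density lborel (normal_density 0 (sqrt (T (Suc i) - T i)))" for i
  proof -
    have "distributed P lborel (\<lambda>\<omega>. \<omega> (T (Suc i)) - \<omega> (T i)) (normal_density 0 (sqrt (T (Suc i) - T i)))"
      using P strict_mono_less[OF T, of i "Suc i"] by (simp add: wiener_measure_def)
    then have "distr P lborel (\<lambda>\<omega>. \<omega> (T (Suc i)) - \<omega> (T i))
        = density lborel (normal_density 0 (sqrt (T (Suc i) - T i)))"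
      by (simp add: distributed_def)
    moreover have "distr P borel (\<lambda>\<omega>. \<omega> (T (Suc i)) - \<omega> (T i)) = distr P lborel (\<lambda>\<omega>. \<omega> (T (Suc i)) - \<omega> (T i))"
      by (rule distr_cong) simp_all
    ultimately show ?thesis by simp
  qed
  have "indep_vars (\<lambda>_. borel) (\<lambda>i \<omega>. \<omega> (T (Suc i)) - \<omega> (T i)) UNIV"
    using P T by (simp add: wiener_measure_def)
  then have "distr P (Pi\<^sub>M UNIV (\<lambda>_. borel)) (\<lambda>\<omega>. \<lambda>i\<in>UNIV. \<omega> (T (Suc i)) - \<omega> (T i))
      = Pi\<^sub>M UNIV (\<lambda>i. distr P borel (\<lambda>\<omega>. \<omega> (T (Suc i)) - \<omega> (T i)))"
    by (subst (asm) indep_vars_iff_distr_eq_PiM') auto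
  then show ?thesis by (simp add: incr restrict_UNIV)
qed

lemma path_shift_in_paths: "\<omega> \<in> paths \<Longrightarrow> path_shift t \<omega> \<in> paths"
  unfolding paths_def path_shift_def by (auto intro!: continuous_intros continuous_on_compose2[of UNIV \<omega>])

lemma measurable_path_shift:
  assumes P: "wiener_measure P" shows "path_shift t \<in> measurable P P"
proof -
  note [measurable] = wiener_measurable_eval[OF P]
  have sp: "space P = paths" "sets P = sigma_sets paths cylinders"
    using P by (simp_all add: wiener_measure_def sets_path_borel_cylinders)
  show ?thesis
  proof (rule measurable_sigma_sets[OF sp(2)])
    show "cylinders \<subseteq> Pow paths" by (auto simp: cylinders_def)
    show "path_shift t \<in> space P \<rightarrow> paths" using path_shift_in_paths sp by auto
    fix X assume "X \<in> cylinders"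
    then obtain F B where X: "X = {\<omega> \<in> paths. \<forall>t\<in>F. \<omega> t \<in> B t}" "finite F" "range B \<subseteq> sets borel"
      unfolding cylinders_def by blast
    have "{\<omega> \<in> space P. \<forall>s\<in>F. \<omega> (s + t) - \<omega> t \<in> B s} \<in> sets P"
    proof (rule sets.sets_Collect_finite_All[OF _ X(2)])
      fix s assume "s \<in> F"
      have [measurable]: "B s \<in> sets borel" using X(3) by auto
      show "{\<omega> \<in> space P. \<omega> (s + t) - \<omega> t \<in> B s} \<in> sets P" by measurable
    qed
    also have "{\<omega> \<in> space P. \<forall>s\<in>F. \<omega> (s + t) - \<omega> t \<in> B s} = path_shift t -` X \<inter> space P"
      using path_shift_in_paths[of _ t] unfolding X sp by (auto simp: path_shift_def)
    finally show "path_shift t -` X \<inter> space P \<in> sets P" .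
  qed
qed

text \<open>It suffices to compare the two measures on the pi-system of cylinders, and membership in
  a cylinder can be expressed by increments alone because paths vanish at 0.\<close>

theorem wiener_measure_shift_invariant:
  assumes P: "wiener_measure P" shows "distr P P (path_shift t) = P"
proof (rule measure_eqI_generator_eq[OF Int_stable_cylinders, of paths])
  interpret prob_space P using P by (simp add: wiener_measure_def)
  note [measurable] = wiener_measurable_eval[OF P]
  have sp: "space P = paths" "sets P = sigma_sets paths cylinders"
    using P by (simp_all add: wiener_measure_def sets_path_borel_cylinders)
  then show "sets P = sigma_sets paths cylinders" "sets (distr P P (path_shift t)) = sigma_sets paths cylinders"
    by simp_all
  show "cylinders \<subseteq> Pow paths" by (auto simp: cylinders_def)
  have "paths \<in> cylinders" using cylindersI[of "{}" "\<lambda>_. UNIV"] by simp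
  then show "range (\<lambda>_::nat. paths) \<subseteq> cylinders" "(\<Union>i::nat. paths) = paths" by auto
  interpret D: prob_space "distr P P (path_shift t)"
    by (rule prob_space_distr[OF measurable_path_shift[OF P]])
  show "emeasure (distr P P (path_shift t)) paths \<noteq> \<infinity>" by simp
  fix X assume "X \<in> cylinders"
  then obtain F B where X: "X = {\<omega> \<in> paths. \<forall>t\<in>F. \<omega> t \<in> B t}" and F: "finite F" and B: "range B \<subseteq> sets borel"
    unfolding cylinders_def by blast
  obtain T :: "nat \<Rightarrow> real" where T: "strict_mono T" "insert 0 F \<subseteq> range T"
    using finite_subset_range_strict_mono[OF finite.insertI[OF F, of 0]] by blast
  define j where "j s = inv_into UNIV T s" for s
  have j: "T (j s) = s" if "s \<in> insert 0 F" for s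
    using that T(2) unfolding j_def by (intro f_inv_into_f) auto
  define inc where "inc T \<omega> i = \<omega> (T (Suc i)) - \<omega> (T i)" for T :: "nat \<Rightarrow> real" and \<omega> :: "real \<Rightarrow> real" and i
  have inc_meas: "inc S \<in> measurable P (Pi\<^sub>M UNIV (\<lambda>_. borel))" for S
    unfolding inc_def by (rule measurable_PiM_single') auto
  \<comment> \<open>The cylinder condition in terms of increments: the value at \<open>s\<close> is
    the telescoped sum from \<open>T 0\<close> to \<open>s\<close> minus the one from
    \<open>T 0\<close> to 0, which is why 0 was included among the times. The same \<open>Y\<close>
    describes the shifted path along the times \<open>T i + t\<close>.\<close>
  define Y where "Y = {y \<in> space (Pi\<^sub>M UNIV (\<lambda>_. borel)). \<forall>s\<in>F. (\<Sum>i<j s. y i) - (\<Sum>i<j 0. y i :: real) \<in> B s}"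
  have Y: "Y \<in> sets (Pi\<^sub>M UNIV (\<lambda>_. borel))"
    unfolding Y_def
  proof (rule sets.sets_Collect_finite_All[OF _ F])
    fix s assume "s \<in> F"
    have [measurable]: "B s \<in> sets borel" using B by auto
    show "{y \<in> space (Pi\<^sub>M UNIV (\<lambda>_. borel)). (\<Sum>i<j s. y i) - (\<Sum>i<j 0. y i) \<in> B s} \<in> sets (Pi\<^sub>M UNIV (\<lambda>_. borel))"
      by measurable
  qed
  have tele: "(\<Sum>i<n. inc S \<omega> i) = \<omega> (S n) - \<omega> (S 0)" for S \<omega> n
    unfolding inc_def by (rule sum_lessThan_telescope)
  have 1: "X = inc T -` Y \<inter> space P"
    unfolding X Y_def sp(1) using j by (auto simp: tele space_PiM paths_def)
  have 2: "path_shift t -` X \<inter> space P = inc (\<lambda>i. T i + t) -` Y \<inter> space P"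
    unfolding X Y_def sp(1) using j path_shift_in_paths[of _ t]
    by (auto simp: tele space_PiM path_shift_def)
  have "emeasure (distr P P (path_shift t)) X = emeasure P (path_shift t -` X \<inter> space P)"
    using \<open>X \<in> cylinders\<close> sp by (intro emeasure_distr[OF measurable_path_shift[OF P]]) auto
  also have "\<dots> = emeasure (distr P (Pi\<^sub>M UNIV (\<lambda>_. borel)) (inc (\<lambda>i. T i + t))) Y"
    unfolding 2 by (rule emeasure_distr[OF inc_meas Y, symmetric])
  also have "distr P (Pi\<^sub>M UNIV (\<lambda>_. borel)) (inc (\<lambda>i. T i + t)) = distr P (Pi\<^sub>M UNIV (\<lambda>_. borel)) (inc T)"
    using wiener_increments_law[OF P T(1)] wiener_increments_law[OF P, of "\<lambda>i. T i + t"] T(1)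
    by (simp add: inc_def[abs_def] strict_mono_def)
  also have "emeasure \<dots> Y = emeasure P X"
    unfolding 1 by (rule emeasure_distr[OF inc_meas Y])
  finally show "emeasure (distr P P (path_shift t)) X = emeasure P X" .
qed

lemma AE_path_shift:
  assumes P: "wiener_measure P" and "AE \<omega> in P. Q \<omega>" shows "AE \<omega> in P. Q (path_shift t \<omega>)"
  using AE_distrD[OF measurable_path_shift[OF P]] assms(2) wiener_measure_shift_invariant[OF P] by metis

section \<open>Riesz representation of functionals concentrated on a compact set\<close>

text \<open>Positivity is tested on \<open>K\<close> alone. Hence \<open>I f\<close> depends only on
  the values of \<open>f\<close> on \<open>K\<close>, and \<open>I\<close> can be defined on all
  continuous functions, bounded or not.\<close>

locale compact_positive_functional =
  fixes K :: "'a::metric_space set" and I :: "('a \<Rightarrow> real) \<Rightarrow> real"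
  assumes compact_K: "compact K"
    and add: "continuous_on UNIV f \<Longrightarrow> continuous_on UNIV g \<Longrightarrow> I (\<lambda>x. f x + g x) = I f + I g"
    and scale: "continuous_on UNIV f \<Longrightarrow> I (\<lambda>x. c * f x) = c * I f"
    and nonneg: "continuous_on UNIV f \<Longrightarrow> (\<And>x. x \<in> K \<Longrightarrow> 0 \<le> f x) \<Longrightarrow> 0 \<le> I f"
    and one: "I (\<lambda>_. 1) = 1"
begin

lemma const: "I (\<lambda>_. c) = c"
  using scale[of "\<lambda>_. 1" c] one by simp

lemma mono:
  assumes f: "continuous_on UNIV f" and g: "continuous_on UNIV g" and le: "\<And>x. x \<in> K \<Longrightarrow> f x \<le> g x"
  shows "I f \<le> I g"
proof -
  have d: "continuous_on UNIV (\<lambda>x. g x - f x)" using f g by (intro continuous_intros)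
  have "0 \<le> I (\<lambda>x. g x - f x)" using d le by (intro nonneg) auto
  moreover have "I g = I f + I (\<lambda>x. g x - f x)" using add[OF f d] by simp
  ultimately show ?thesis by simp
qed

lemma sum:
  assumes "finite A" "\<And>i. i \<in> A \<Longrightarrow> continuous_on UNIV (f i)"
  shows "I (\<lambda>x. \<Sum>i\<in>A. f i x) = (\<Sum>i\<in>A. I (f i))"
  using assms
proof (induction A rule: finite_induct)
  case empty
  then show ?case by (simp add: const)
next
  case (insert i A)
  then have "I (\<lambda>x. f i x + (\<Sum>j\<in>A. f j x)) = I (f i) + I (\<lambda>x. \<Sum>j\<in>A. f j x)"
    by (intro add continuous_on_sum) auto
  with insert show ?case by simp
qed

section \<open>The outer measure determined by the values on open sets\<close>

definition below :: "'a set \<Rightarrow> ('a \<Rightarrow> real) set" where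
  "below U = {f. continuous_on UNIV f \<and> (\<forall>x. 0 \<le> f x \<and> f x \<le> 1 \<and> (x \<notin> U \<longrightarrow> f x = 0))}"

text \<open>The future measure of an open set, as in the Riesz-Markov construction. The test
  functions only have to vanish off \<open>U\<close>; asking for compact support would leave nothing
  but 0 on an infinite-dimensional space.\<close>

definition cap :: "'a set \<Rightarrow> ennreal" where
  "cap U = (SUP f\<in>below U. ennreal (I f))"

definition outer :: "'a set \<Rightarrow> ennreal" where
  "outer E = (INF U\<in>{U. open U \<and> E \<subseteq> U}. cap U)"

lemma below_nonempty: "below U \<noteq> {}"
  unfolding below_def by (auto intro!: exI[of _ "\<lambda>_. 0"])

lemma I_le_cap: "f \<in> below U \<Longrightarrow> ennreal (I f) \<le> cap U"
  unfolding cap_def by (rule SUP_upper)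

lemma below_nonneg: "f \<in> below U \<Longrightarrow> 0 \<le> I f"
  by (intro nonneg) (auto simp: below_def)

lemma cap_mono: "U \<subseteq> V \<Longrightarrow> cap U \<le> cap V"
  unfolding cap_def by (rule SUP_subset_mono) (auto simp: below_def)

lemma outer_le_cap: "open U \<Longrightarrow> E \<subseteq> U \<Longrightarrow> outer E \<le> cap U"
  unfolding outer_def by (rule INF_lower) simp

lemma outer_open: "open U \<Longrightarrow> outer U = cap U"
  by (rule antisym[OF outer_le_cap]) (auto simp: outer_def intro!: INF_greatest cap_mono)

lemma outer_mono: "E \<subseteq> E' \<Longrightarrow> outer E \<le> outer E'"
  unfolding outer_def by (rule INF_superset_mono) auto

lemma cap_UNIV: "cap UNIV = 1"
proof (rule antisym)
  show "cap UNIV \<le> 1"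
    unfolding cap_def
  proof (rule SUP_least)
    fix f assume "f \<in> below UNIV"
    then have "I f \<le> I (\<lambda>_. 1)" by (intro mono) (auto simp: below_def)
    then show "ennreal (I f) \<le> 1" using one by simp
  qed
  show "1 \<le> cap UNIV"
    using I_le_cap[of "\<lambda>_. 1" UNIV] one by (simp add: below_def)
qed

lemma cap_empty: "cap {} = 0"
proof -
  have "I f = 0" if "f \<in> below {}" for f
  proof -
    have "f = (\<lambda>_. 0)" using that by (auto simp: below_def)
    then show ?thesis by (simp add: const)
  qed
  then show ?thesis unfolding cap_def using below_nonempty[of "{}"] by (simp add: SUP_eq_const)
qed

lemma cap_complement: "cap (- K) = 0"
proof -
  have "I f = 0" if f: "f \<in> below (- K)" for f
    using mono[of f "\<lambda>_. 0"] below_nonneg[OF f] f by (force simp: below_def const)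
  then show ?thesis unfolding cap_def using below_nonempty[of "- K"] by (simp add: SUP_eq_const)
qed

text \<open>A Dini argument in place of a partition of unity. The functions \<open>b N n\<close>
  increase with \<open>N\<close> to the indicator of \<open>U n\<close>, so the open sets
  \<open>G N\<close> increase and cover \<open>K\<close>. By compactness a single \<open>G N\<close>
  contains \<open>K\<close>, which bounds \<open>I f\<close> by \<open>e\<close> plus a finite sum
  of values of \<open>I\<close> on test functions.\<close>

lemma cap_UN_le:
  assumes U: "\<And>n::nat. open (U n)"
  shows "cap (\<Union>n. U n) \<le> (\<Sum>n. cap (U n))"
  unfolding cap_def[of "\<Union>n. U n"]
proof (rule SUP_least)
  fix f assume f: "f \<in> below (\<Union>n. U n)"
  have cf: "continuous_on UNIV f" using f by (simp add: below_def)
  \<comment> \<open>The distance to the empty set is 0 by convention, so \<open>U n = UNIV\<close>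
    needs a positive value of its own.\<close>
  define d where "d n x = (if U n = UNIV then 1 else infdist x (- U n))" for n x
  define b where "b N n x = min 1 (real N * d n x)" for N n :: nat and x
  have cd: "continuous_on UNIV (d n)" for n
    by (cases "U n = UNIV") (auto simp: d_def[abs_def] intro!: continuous_intros)
  have cb: "continuous_on UNIV (b N n)" for N n
    unfolding b_def[abs_def] by (intro continuous_intros cd)
  have d0: "0 \<le> d n x" for n x by (simp add: d_def infdist_nonneg)
  have dpos: "0 < d n x" if "x \<in> U n" for n x
  proof (cases "U n = UNIV")
    case False
    have "closed (- U n)" using U by (simp add: closed_Compl)
    then have "infdist x (- U n) \<noteq> 0"
      using in_closed_iff_infdist_zero[of "- U n" x] False that by auto
    then show ?thesis using False infdist_nonneg[of x "- U n"] by (simp add: d_def)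
  qed (simp add: d_def)
  have below_b: "b N n \<in> below (U n)" for N n
    using cb[of N n] d0[of n] by (auto simp: below_def b_def d_def)
  have b_mono: "b N n x \<le> b N' n x" if "N \<le> N'" for N N' n x
    using mult_right_mono[of "real N" "real N'" "d n x"] that d0[of n x] by (simp add: b_def min_le_iff_disj)
  have b0: "0 \<le> b N n x" for N n x using below_b by (simp add: below_def)
  show "ennreal (I f) \<le> (\<Sum>n. cap (U n))"
  proof (rule ennreal_le_epsilon)
    fix e :: real assume e: "0 < e"
    define G where "G N = {x. f x < e + (\<Sum>n<N. b N n x)}" for N
    have "open (G N)" for N
      unfolding G_def by (intro open_Collect_less cf continuous_intros cb)
    moreover have "incseq G"
    proof (rule incseq_SucI)
      fix N
      have "(\<Sum>n<N. b N n x) \<le> (\<Sum>n<Suc N. b (Suc N) n x)" for x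
        using sum_mono[of "{..<N}" "\<lambda>n. b N n x" "\<lambda>n. b (Suc N) n x"] b_mono[of N "Suc N"] b0[of "Suc N" N x] by simp
      then show "G N \<subseteq> G (Suc N)" unfolding G_def by (auto intro: less_le_trans)
    qed
    moreover have "K \<subseteq> (\<Union>N. G N)"
    proof
      fix x assume "x \<in> K"
      show "x \<in> (\<Union>N. G N)"
      proof (cases "x \<in> (\<Union>n. U n)")
        case False
        then have "f x = 0" using f by (simp add: below_def)
        then have "x \<in> G 0" using e by (simp add: G_def)
        then show ?thesis by blast
      next
        case True
        then obtain n where n: "x \<in> U n" by blast
        obtain N where N: "1 / d n x < real N" using reals_Archimedean2 by blast
        \<comment> \<open>Large enough for the cutoff of \<open>U n\<close> to equal 1 at
          \<open>x\<close> and for \<open>n\<close> to occur among the summands.\<close>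
        define M where "M = max N (Suc n)"
        have "1 < real N * d n x" using N dpos[OF n] by (simp add: pos_divide_less_eq)
        also have "\<dots> \<le> real M * d n x" using d0 by (intro mult_right_mono) (auto simp: M_def)
        finally have "b M n x = 1" by (simp add: b_def)
        moreover have "b M n x \<le> (\<Sum>n<M. b M n x)"
          by (rule member_le_sum) (auto simp: M_def b0)
        moreover have "f x \<le> 1" using f by (simp add: below_def)
        ultimately have "x \<in> G M" using e by (simp add: G_def)
        then show ?thesis by blast
      qed
    qed
    ultimately obtain N where N: "K \<subseteq> G N"
    proof -
      obtain F where F: "finite F" "K \<subseteq> (\<Union>N\<in>F. G N)"
        using compactE_image[OF compact_K, of UNIV G] \<open>\<And>N. open (G N)\<close> \<open>K \<subseteq> (\<Union>N. G N)\<close> by auto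
      have sub: "(\<Union>N\<in>F. G N) \<subseteq> G (Max (insert 0 F))"
        using F(1) by (intro UN_least incseqD[OF \<open>incseq G\<close>] Max_ge) auto
      show thesis by (rule that[OF order_trans[OF F(2) sub]])
    qed
    have "I f \<le> I (\<lambda>x. e + (\<Sum>n<N. b N n x))"
      using N by (intro mono cf continuous_intros cb) (auto simp: G_def)
    also have "\<dots> = e + (\<Sum>n<N. I (b N n))"
      by (subst add) (auto simp: const sum cb intro!: continuous_intros)
    finally have "ennreal (I f) \<le> ennreal (e + (\<Sum>n<N. I (b N n)))" by (rule ennreal_leI)
    also have "\<dots> = (\<Sum>n<N. ennreal (I (b N n))) + ennreal e"
    proof -
      have nn: "0 \<le> I (b N n)" for n by (rule below_nonneg[OF below_b])
      then have "ennreal ((\<Sum>n<N. I (b N n)) + e) = ennreal (\<Sum>n<N. I (b N n)) + ennreal e"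
        using e by (intro ennreal_plus sum_nonneg) auto
      then show ?thesis using nn by (simp only: add.commute sum_ennreal)
    qed
    also have "\<dots> \<le> (\<Sum>n. cap (U n)) + ennreal e"
    proof (rule add_right_mono)
      have "(\<Sum>n<N. ennreal (I (b N n))) \<le> (\<Sum>n<N. cap (U n))"
        by (intro sum_mono I_le_cap below_b)
      also have "\<dots> \<le> (\<Sum>n. cap (U n))" by (rule sum_le_suminf) auto
      finally show "(\<Sum>n<N. ennreal (I (b N n))) \<le> (\<Sum>n. cap (U n))" .
    qed
    finally show "ennreal (I f) \<le> (\<Sum>n. cap (U n)) + ennreal e" .
  qed
qed

lemma outer_UN_le: "outer (\<Union>n. E n) \<le> (\<Sum>n. outer (E n))"
proof (rule ennreal_le_epsilon)
  fix e :: real assume e: "0 < e"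
  have "\<exists>V. open V \<and> E n \<subseteq> V \<and> cap V < outer (E n) + ennreal (e * (1/2) ^ Suc n)" for n
  proof -
    have "outer (E n) \<le> 1" using outer_mono[of "E n" UNIV] outer_open[of UNIV] cap_UNIV by simp
    \<comment> \<open>Finiteness makes the addition of a positive amount strict, so some open set
      beats the infimum by that amount.\<close>
    then have "outer (E n) < \<top>" using le_less_trans by fastforce
    then have "outer (E n) < outer (E n) + ennreal (e * (1/2) ^ Suc n)"
      using e by (simp add: ennreal_add_left_cancel_less[of _ 0, simplified])
    then show ?thesis unfolding outer_def INF_less_iff by auto
  qed
  then obtain V where V: "\<And>n. open (V n)" "\<And>n. E n \<subseteq> V n"
    "\<And>n. cap (V n) < outer (E n) + ennreal (e * (1/2) ^ Suc n)" by metis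
  have "outer (\<Union>n. E n) \<le> cap (\<Union>n. V n)" using V by (intro outer_le_cap) auto
  also have "\<dots> \<le> (\<Sum>n. cap (V n))" by (intro cap_UN_le V)
  also have "\<dots> \<le> (\<Sum>n. outer (E n) + ennreal (e * (1/2) ^ Suc n))"
    by (intro suminf_le less_imp_le V) auto
  also have "\<dots> = (\<Sum>n. outer (E n)) + (\<Sum>n. ennreal e * ennreal ((1/2) ^ Suc n))"
    using e by (subst suminf_add[symmetric]) (auto simp del: ennreal_suminf_cmult simp add: ennreal_mult[symmetric])
  also have "\<dots> = (\<Sum>n. outer (E n)) + e"
    unfolding ennreal_suminf_cmult
    by (subst suminf_ennreal_eq[OF zero_le_power power_half_series]) auto
  finally show "outer (\<Union>n. E n) \<le> (\<Sum>n. outer (E n)) + ennreal e" .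
qed

lemma outer_measure_space: "outer_measure_space (Pow UNIV) outer"
  unfolding outer_measure_space_def positive_def increasing_def countably_subadditive_def
  using outer_open[of "{}"] cap_empty outer_mono outer_UN_le by auto

text \<open>The test functions for \<open>V - U\<close> only see \<open>V \<inter> {f < e}\<close>, which is disjoint from the set where
  the truncation of \<open>f\<close> by \<open>e\<close> is positive.\<close>

lemma open_in_lambda_system:
  assumes U: "open U" shows "U \<in> lambda_system UNIV (Pow UNIV) outer"
proof -
  interpret sigma_algebra UNIV "Pow (UNIV :: 'a set)" by (rule sigma_algebra_Pow)
  have sub: "subadditive (Pow UNIV) outer"
    using outer_measure_space unfolding outer_measure_space_def
    by (intro countably_subadditive_subadditive) auto
  have "outer (E \<inter> U) + outer (E - U) \<le> outer E" for E
    unfolding outer_def[of E]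
  proof (rule INF_greatest, clarify)
    fix V assume V: "open V" "E \<subseteq> V"
    have "ennreal (I f) + outer (E - U) \<le> cap V" if f: "f \<in> below (V \<inter> U)" for f
    proof (rule ennreal_le_epsilon)
      fix e :: real assume e: "0 < e"
      have cf: "continuous_on UNIV f" using f by (simp add: below_def)
      \<comment> \<open>\<open>W\<close> is an open set containing \<open>E - U\<close>, because
        \<open>f\<close> vanishes off \<open>U\<close>.\<close>
      define W where "W = V \<inter> {x. f x < e}"
      define f' where "f' x = max 0 (f x - e)" for x
      have cf': "continuous_on UNIV f'" unfolding f'_def[abs_def] by (intro continuous_intros cf)
      have "open W" unfolding W_def by (intro open_Int V open_Collect_less cf continuous_intros)
      moreover have "E - U \<subseteq> W" using V(2) f e by (auto simp: W_def below_def)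
      ultimately have 1: "outer (E - U) \<le> cap W" by (rule outer_le_cap)
      have If: "I f \<le> I f' + e"
      proof -
        have "I f \<le> I (\<lambda>x. f' x + e)" by (intro mono cf continuous_intros cf') (auto simp: f'_def)
        then show ?thesis using add[OF cf', of "\<lambda>_. e"] by (simp add: const)
      qed
      have "ennreal (I f) + ennreal (I h) \<le> cap V + ennreal e" if h: "h \<in> below W" for h
      proof -
        have ch: "continuous_on UNIV h" using h by (simp add: below_def)
        have "(\<lambda>x. f' x + h x) \<in> below V"
          unfolding below_def
        proof (intro CollectI conjI allI impI)
          show "continuous_on UNIV (\<lambda>x. f' x + h x)" by (intro continuous_intros cf' ch)
          fix x
          show "0 \<le> f' x + h x" using h by (simp add: f'_def below_def)
          show "f' x + h x \<le> 1"
          proof (cases "x \<in> W")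
            case True
            then have "f' x = 0" by (simp add: f'_def W_def)
            then show ?thesis using h by (simp add: below_def)
          next
            case False
            then have "h x = 0" using h by (simp add: below_def)
            moreover have "f x \<le> 1" using f by (simp add: below_def)
            ultimately show ?thesis using e by (simp add: f'_def)
          qed
          show "f' x + h x = 0" if "x \<notin> V"
            using that h f e by (auto simp: below_def W_def f'_def)
        qed
        then have "ennreal (I f' + I h) \<le> cap V" using I_le_cap add[OF cf' ch] by metis
        then have "ennreal (I f' + I h) + ennreal e \<le> cap V + ennreal e" by (rule add_right_mono)
        moreover have "ennreal (I f) + ennreal (I h) \<le> ennreal (I f' + I h) + ennreal e"
        proof -
          have "0 \<le> I f'" by (intro nonneg cf') (simp add: f'_def)
          then show ?thesis
            using If e below_nonneg[OF f] below_nonneg[OF h]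
            by (simp flip: ennreal_plus)
        qed
        ultimately show ?thesis by (rule order_trans[rotated])
      qed
      then have "ennreal (I f) + cap W \<le> cap V + ennreal e"
        unfolding cap_def[of W] ennreal_SUP_add_right[OF below_nonempty]
        by (intro SUP_least)
      then show "ennreal (I f) + outer (E - U) \<le> cap V + ennreal e"
        using 1 by (meson add_left_mono order_trans)
    qed
    then have "cap (V \<inter> U) + outer (E - U) \<le> cap V"
      unfolding cap_def[of "V \<inter> U"] ennreal_SUP_add_left[OF below_nonempty, symmetric]
      by (intro SUP_least)
    moreover have "outer (E \<inter> U) \<le> cap (V \<inter> U)" using V U by (intro outer_le_cap) auto
    ultimately show "outer (E \<inter> U) + outer (E - U) \<le> cap V"
      by (meson add_right_mono order_trans)
  qed
  moreover have "outer E \<le> outer (E \<inter> U) + outer (E - U)" for E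
    using subadditiveD[OF sub, of "E \<inter> U" "E - U"] by (simp add: Int_Diff_Un Int_Diff_disjoint)
  ultimately show ?thesis
    unfolding lambda_system_eq by (auto intro: antisym)
qed

section \<open>The representing measure\<close>

definition rep :: "'a measure" where
  "rep = measure_of UNIV (sets borel) outer"

lemma sets_rep [simp, measurable_cong]: "sets rep = sets borel"
  and space_rep [simp]: "space rep = UNIV"
  unfolding rep_def using sets.sigma_sets_eq[of "borel :: 'a measure"] by (simp_all add: space_measure_of_conv)

text \<open>Open sets satisfy Caratheodory's splitting condition, so all Borel sets lie in the
  sigma-algebra on which \<open>outer\<close> is countably additive.\<close>

lemma emeasure_rep: "A \<in> sets borel \<Longrightarrow> emeasure rep A = outer A"
proof -
  interpret sigma_algebra UNIV "Pow (UNIV :: 'a set)" by (rule sigma_algebra_Pow)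
  have ms: "measure_space UNIV (lambda_system UNIV (Pow UNIV) outer) outer"
    by (rule caratheodory_lemma[OF outer_measure_space])
  then interpret L: sigma_algebra UNIV "lambda_system UNIV (Pow UNIV) outer"
    by (simp add: measure_space_def)
  have "sets borel \<subseteq> lambda_system UNIV (Pow (UNIV :: 'a set)) outer"
  proof -
    have "sets borel = sigma_sets UNIV {S :: 'a set. open S}"
      unfolding borel_def by (rule sets_measure_of) simp
    moreover have "sigma_sets UNIV {S :: 'a set. open S} \<subseteq> lambda_system UNIV (Pow UNIV) outer"
      by (rule L.sigma_sets_subset) (use open_in_lambda_system in blast)
    ultimately show ?thesis by (simp only:)
  qed
  moreover have "sigma_algebra UNIV (sets (borel :: 'a measure))"
    using sets.sigma_algebra_axioms[of "borel :: 'a measure"] by simp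
  ultimately have "measure_space UNIV (sets borel) outer"
    by (intro measure_down[OF ms])
  then show "A \<in> sets borel \<Longrightarrow> emeasure rep A = outer A"
    unfolding rep_def measure_space_def by (intro emeasure_measure_of_sigma) auto
qed

lemma emeasure_rep_open: "open U \<Longrightarrow> emeasure rep U = cap U"
  by (simp add: emeasure_rep outer_open)

lemma prob_space_rep: "prob_space rep"
  by (rule prob_spaceI) (simp add: emeasure_rep_open cap_UNIV)

lemma AE_rep: "AE x in rep. x \<in> K"
proof (rule AE_I)
  show "emeasure rep (- K) = 0"
    using compact_imp_closed[OF compact_K] by (simp add: emeasure_rep_open cap_complement open_Compl)
  show "- K \<in> sets rep"
    using compact_imp_closed[OF compact_K] by (simp add: open_Compl)
qed auto

lemma measurable_rep: "continuous_on UNIV f \<Longrightarrow> f \<in> borel_measurable rep"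
  by (simp add: borel_measurable_continuous_onI cong: measurable_cong_sets)

text \<open>The \<open>i\<close>-th summand is the length of the part of \<open>[0, y]\<close> that
  lies between \<open>i\<close> and \<open>i + 1\<close>.\<close>

lemma sum_clamp: "0 \<le> y \<Longrightarrow> (\<Sum>i<n. max 0 (min 1 (y - real i))) = min y (real n)" for y :: real
proof (induction n)
  case (Suc n)
  have "max 0 (min 1 (y - real n)) = min y (real (Suc n)) - min y (real n)"
    by (simp add: min_def max_def)
  then show ?case using Suc by simp
qed simp

text \<open>At most \<open>y + 1\<close> natural numbers lie below \<open>y\<close>. The second
  entry of the minimum carries the induction.\<close>

lemma sum_less_le:
  fixes y :: real assumes "0 \<le> y"
  shows "(\<Sum>i<n. if real i < y then 1 else 0) \<le> min (y + 1) (real n)"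
proof (induction n)
  case (Suc n)
  then show ?case by (cases "real n < y") (auto simp: min_def split: if_splits)
qed (use assms in simp)

text \<open>Layer cake: \<open>f\<close> is the average of the clamped functions \<open>max 0 (min 1 (n f - i))\<close>, and the
  \<open>i\<close>-th of them is a test function for the open set \<open>{f > i/n}\<close>.\<close>

lemma I_le_integral:
  assumes f: "continuous_on UNIV f" "\<And>x. 0 \<le> f x" "\<And>x. f x \<le> 1"
  shows "I f \<le> integral\<^sup>L rep f"
proof (rule field_le_epsilon)
  interpret prob_space rep by (rule prob_space_rep)
  have prob_UNIV: "prob UNIV = 1" using prob_space by simp
  have int_f: "integrable rep f"
    using f measurable_rep by (intro integrable_const_bound[of _ 1]) auto
  fix e :: real assume "0 < e"
  then obtain n where n: "n > 0" "1 / real n < e"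
    by (metis nat_approx_posE zero_less_Suc)
  define c where "c i x = max 0 (min 1 (real n * f x - real i))" for i x
  define S where "S i = {x. real i < real n * f x}" for i
  have cc: "continuous_on UNIV (c i)" for i
    unfolding c_def[abs_def] by (intro continuous_intros f)
  have oS: "open (S i)" for i
    unfolding S_def by (intro open_Collect_less continuous_intros f)
  have cS: "I (c i) \<le> prob (S i)" for i
  proof -
    have "c i \<in> below (S i)" using cc[of i] by (auto simp: below_def c_def S_def)
    then have "ennreal (I (c i)) \<le> emeasure rep (S i)"
      using I_le_cap by (simp add: emeasure_rep_open oS)
    then show ?thesis by (simp add: emeasure_eq_measure)
  qed
  have "real n * I f = I (\<lambda>x. \<Sum>i<n. c i x)"
  proof -
    have "(\<Sum>i<n. c i x) = real n * f x" for x
      unfolding c_def using f(2,3)[of x] n(1)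
      by (subst sum_clamp) (auto simp: min_def mult_le_cancel_left2)
    then show ?thesis using scale[OF f(1)] by simp
  qed
  also have "\<dots> = (\<Sum>i<n. I (c i))" by (intro sum cc) auto
  also have "\<dots> \<le> (\<Sum>i<n. prob (S i))" by (intro sum_mono cS)
  also have "\<dots> = (\<integral>x. (\<Sum>i<n. indicator (S i) x) \<partial>rep)"
    using oS by (subst Bochner_Integration.integral_sum) (auto intro!: integrable_real_indicator simp: emeasure_eq_measure)
  \<comment> \<open>At each point the number of levels below \<open>n f\<close> exceeds
    \<open>n f\<close> by at most 1. After division by \<open>n\<close> this is the error
    \<open>1 / n\<close>.\<close>
  also have "\<dots> \<le> (\<integral>x. real n * f x + 1 \<partial>rep)"
  proof (rule integral_mono)
    show "integrable rep (\<lambda>x. \<Sum>i<n. indicator (S i) x :: real)"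
      using oS by (intro Bochner_Integration.integrable_sum integrable_real_indicator) (auto simp: emeasure_eq_measure)
    show "integrable rep (\<lambda>x. real n * f x + 1)" using int_f by simp
    show "(\<Sum>i<n. indicator (S i) x) \<le> real n * f x + 1" for x
      using sum_less_le[of "real n * f x" n] f(2)[of x] by (simp add: indicator_def S_def of_bool_def)
  qed
  also have "\<dots> = real n * integral\<^sup>L rep f + 1" using int_f by (simp add: prob_UNIV)
  finally have "real n * I f \<le> real n * integral\<^sup>L rep f + 1" .
  then have "I f \<le> integral\<^sup>L rep f + 1 / real n" using n(1) by (simp add: field_simps)
  then show "I f \<le> integral\<^sup>L rep f + e" using n(2) by simp
qed

text \<open>The inequality of \<open>I_le_integral\<close>, applied to \<open>g\<close> and to
  \<open>1 - g\<close>, gives equality for functions with values in \<open>[0,1]\<close>. A general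
  \<open>f\<close> agrees on \<open>K\<close> with an affine image of such a \<open>g\<close>, and
  both \<open>I\<close> and the measure see only \<open>K\<close>.\<close>

theorem riesz_representation:
  assumes f: "continuous_on UNIV f"
  shows "integrable rep f" "integral\<^sup>L rep f = I f"
proof -
  interpret prob_space rep by (rule prob_space_rep)
  have prob_UNIV: "prob UNIV = 1" using prob_space by simp
  have "compact (f ` K)" by (intro compact_continuous_image continuous_on_subset[OF f] compact_K) auto
  then obtain M where M: "M > 0" "\<And>x. x \<in> K \<Longrightarrow> \<bar>f x\<bar> \<le> M"
    using bounded_pos[THEN iffD1, OF compact_imp_bounded] by force
  \<comment> \<open>\<open>M\<close> bounds \<open>f\<close> on \<open>K\<close>, so the clamping
    changes nothing there; elsewhere it makes \<open>g\<close> bounded.\<close>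
  define g where "g x = max 0 (min 1 ((f x + M) / (2 * M)))" for x
  have cg: "continuous_on UNIV g" unfolding g_def[abs_def] using M(1) by (intro continuous_intros f) auto
  have g01: "0 \<le> g x" "g x \<le> 1" for x by (auto simp: g_def)
  have fg: "f x = 2 * M * g x + (- M)" if "x \<in> K" for x
    using M(2)[OF that] M(1) by (auto simp: g_def min_def max_def field_simps abs_le_iff)
  have int_g: "integrable rep g"
    using g01 measurable_rep[OF cg] by (intro integrable_const_bound[of _ 1]) auto
  have AEfg: "AE x in rep. f x = 2 * M * g x + (- M)"
    using AE_rep fg by auto
  have int: "integrable rep (\<lambda>x. 2 * M * g x + (- M))" using int_g by simp
  show "integrable rep f"
    using int AEfg measurable_rep[OF f] measurable_rep[OF cg] by (subst integrable_cong_AE) auto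
  have "I g \<le> integral\<^sup>L rep g" by (intro I_le_integral cg g01)
  moreover have "1 - I g \<le> 1 - integral\<^sup>L rep g"
  proof -
    have cg': "continuous_on UNIV (\<lambda>x. (-1) * g x)" by (intro continuous_intros cg)
    have "I (\<lambda>x. 1 + (-1) * g x) \<le> (\<integral>x. 1 + (-1) * g x \<partial>rep)"
      using g01 by (intro I_le_integral continuous_intros cg) auto
    moreover have "I (\<lambda>x. 1 + (-1) * g x) = 1 - I g"
      using add[OF _ cg', of "\<lambda>_. 1"] scale[OF cg, of "-1"] by (simp add: const)
    ultimately show ?thesis using int_g by (simp add: prob_UNIV)
  qed
  ultimately have g: "integral\<^sup>L rep g = I g" by simp
  have cg2: "continuous_on UNIV (\<lambda>x. 2 * M * g x)" by (intro continuous_intros cg)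
  have "integral\<^sup>L rep f = (\<integral>x. 2 * M * g x + (- M) \<partial>rep)"
    using AEfg measurable_rep[OF f] measurable_rep[OF cg] by (intro integral_cong_AE) auto
  also have "\<dots> = 2 * M * I g - M" using int_g g by (simp add: prob_UNIV)
  also have "\<dots> = I (\<lambda>x. 2 * M * g x + (- M))"
    using add[OF cg2, of "\<lambda>_. - M"] scale[OF cg, of "2 * M"] by (simp add: const)
  also have "\<dots> = I f"
    using fg by (intro antisym mono f continuous_intros cg) auto
  finally show "integral\<^sup>L rep f = I f" .
qed

end

section \<open>Differential equations with a one-sided Lipschitz condition\<close>

lemma AE_lebesgue_on_iff:
  "S \<in> sets lebesgue \<Longrightarrow> (AE x in lebesgue_on S. P x) \<longleftrightarrow> (AE x in lebesgue. x \<in> S \<longrightarrow> P x)"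
  by (rule AE_restrict_space_iff) simp

lemma AE_lebesgue_on_subset:
  assumes "AE x in lebesgue_on S. P x" "T \<subseteq> S" "S \<in> sets lebesgue" "T \<in> sets lebesgue"
  shows "AE x in lebesgue_on T. P x"
  using assms(1,2) unfolding AE_lebesgue_on_iff[OF assms(3)] AE_lebesgue_on_iff[OF assms(4)] by auto

lemma set_integrable_lebesgue_iff:
  fixes f :: "real \<Rightarrow> 'a::{banach, second_countable_topology}"
  shows "S \<in> sets lebesgue \<Longrightarrow> integrable (lebesgue_on S) f \<longleftrightarrow> set_integrable lebesgue S f"
  by (simp add: integrable_restrict_space set_integrable_def)

lemma set_integral_lebesgue_eq:
  fixes f :: "real \<Rightarrow> 'a::{banach, second_countable_topology}"
  shows "S \<in> sets lebesgue \<Longrightarrow> integral\<^sup>L (lebesgue_on S) f = (LINT x:S|lebesgue. f x)"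
  by (simp add: integral_restrict_space set_lebesgue_integral_def)

lemma integrable_lebesgue_on_subset:
  fixes f :: "real \<Rightarrow> 'a::{banach, second_countable_topology}"
  assumes "integrable (lebesgue_on S) f" "T \<subseteq> S" "S \<in> sets lebesgue" "T \<in> sets lebesgue"
  shows "integrable (lebesgue_on T) f"
  using assms set_integrable_subset[of lebesgue S f T] by (simp add: set_integrable_lebesgue_iff)

lemma integral_lebesgue_on_split:
  fixes f :: "real \<Rightarrow> 'a::{banach, second_countable_topology}"
  assumes f: "integrable (lebesgue_on {a..c}) f" and "a \<le> b" "b \<le> c"
  shows "integral\<^sup>L (lebesgue_on {a..c}) f = integral\<^sup>L (lebesgue_on {a..b}) f + integral\<^sup>L (lebesgue_on {b..c}) f"
proof -
  have "AE x in lebesgue. x \<noteq> b"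
    using AE_completion[OF AE_lborel_singleton[of b]] by simp
  then have ae: "AE x in lebesgue. \<not> (x \<in> {a..b} \<and> x \<in> {b..c})" by eventually_elim auto
  have "{a..c} = {a..b} \<union> {b..c}" using assms by auto
  moreover have "set_integrable lebesgue {a..b} f" "set_integrable lebesgue {b..c} f"
    using assms integrable_lebesgue_on_subset[OF f] by (auto simp flip: set_integrable_lebesgue_iff)
  ultimately show ?thesis
    using set_integral_Un_AE[OF ae, of f] by (simp add: set_integral_lebesgue_eq)
qed

lemma integral_lebesgue_on_singleton:
  fixes f :: "real \<Rightarrow> 'a::{banach, second_countable_topology}"
  shows "integral\<^sup>L (lebesgue_on {a..a}) f = 0"
proof -
  have "AE x in lebesgue. x \<noteq> a"
    using AE_completion[OF AE_lborel_singleton[of a]] by simp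
  then have "AE x in lebesgue. x \<in> {a..a} \<longrightarrow> f x = 0"
    by eventually_elim auto
  then have "AE x in lebesgue_on {a..a}. f x = 0"
    by (subst AE_lebesgue_on_iff) auto
  then show ?thesis by (rule integral_eq_zero_AE)
qed

text \<open>By Cauchy-Schwarz the integrand is dominated by the product of the norms, whose iterated
  integral is finite.\<close>

lemma integrable_inner_pair:
  fixes g :: "real \<Rightarrow> 'a::{real_inner, banach, second_countable_topology}"
  assumes fin: "finite_measure M" and g: "integrable M g"
  shows "integrable (M \<Otimes>\<^sub>M M) (\<lambda>(x, y). g x \<bullet> g y)"
proof -
  interpret finite_measure M by fact
  interpret pair_sigma_finite M M ..
  have [measurable]: "g \<in> borel_measurable M" using g by simp
  have "integrable (M \<Otimes>\<^sub>M M) (\<lambda>(x, y). norm (g x) * norm (g y))"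
  proof (rule Fubini_integrable)
    show "(\<lambda>(x, y). norm (g x) * norm (g y)) \<in> borel_measurable (M \<Otimes>\<^sub>M M)" by measurable
    show "integrable M (\<lambda>x. \<integral>y. norm (case (x, y) of (x, y) \<Rightarrow> norm (g x) * norm (g y)) \<partial>M)"
      using g by (simp add: abs_mult)
    show "AE x in M. integrable M (\<lambda>y. case (x, y) of (x, y) \<Rightarrow> norm (g x) * norm (g y))"
      using g by simp
  qed
  then show ?thesis
    by (rule Bochner_Integration.integrable_bound) (auto simp: Cauchy_Schwarz_ineq2 split: prod.split)
qed

text \<open>By symmetry, the triangle below the diagonal contributes half of \<open>\<integral>\<integral> g x \<bullet> g y\<close>.\<close>

lemma norm_integral_square:
  fixes g :: "real \<Rightarrow> 'a::{real_inner, banach, second_countable_topology}"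
  assumes fin: "finite_measure M" and g: "integrable M g"
    and M: "(\<lambda>x. x) \<in> borel_measurable M" and nodiag: "\<And>a. AE x in M. x \<noteq> a"
  defines "h \<equiv> \<lambda>r. \<integral>y. indicator {..r} y *\<^sub>R g y \<partial>M"
  shows "integrable M (\<lambda>x. g x \<bullet> h x)"
    and "2 * (\<integral>x. g x \<bullet> h x \<partial>M) = (norm (integral\<^sup>L M g))\<^sup>2"
proof -
  interpret finite_measure M by fact
  interpret pair_sigma_finite M M ..
  note [measurable] = M
  have gm [measurable]: "g \<in> borel_measurable M" using g by simp
  have iprod: "integrable (M \<Otimes>\<^sub>M M) (\<lambda>(x, y). g x \<bullet> g y)"
    by (rule integrable_inner_pair[OF fin g])
  have icut: "integrable M (\<lambda>y. indicator (S :: real set) y *\<^sub>R g y)" if "S \<in> sets borel" for S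
  proof -
    have "S \<inter> space M \<in> sets M" using measurable_sets[OF M that] by simp
    then have "integrable M (\<lambda>y. indicator (S \<inter> space M) y *\<^sub>R g y)"
      using g by (rule integrable_mult_indicator)
    then show ?thesis
      by (rule Bochner_Integration.integrable_cong[THEN iffD1, rotated -1]) (auto simp: indicator_def)
  qed
  \<comment> \<open>The closed lower triangle and the open upper one. Since single points are null,
    both give the same iterated integral.\<close>
  define T :: "real \<times> real \<Rightarrow> real" where "T = (\<lambda>(x, y). (if y \<le> x then 1 else 0) * (g x \<bullet> g y))"
  define T' :: "real \<times> real \<Rightarrow> real" where "T' = (\<lambda>(x, y). (if x < y then 1 else 0) * (g x \<bullet> g y))"
  have iT: "integrable (M \<Otimes>\<^sub>M M) T" unfolding T_def
    by (rule Bochner_Integration.integrable_bound[OF iprod]) (measurable, auto split: prod.split)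
  have iT': "integrable (M \<Otimes>\<^sub>M M) T'" unfolding T'_def
    by (rule Bochner_Integration.integrable_bound[OF iprod]) (measurable, auto split: prod.split)
  have inner_T: "(\<integral>y. T (x, y) \<partial>M) = g x \<bullet> h x" for x
  proof -
    have "(\<integral>y. T (x, y) \<partial>M) = (\<integral>y. g x \<bullet> (indicator {..x} y *\<^sub>R g y) \<partial>M)"
      by (intro Bochner_Integration.integral_cong) (auto simp: T_def indicator_def)
    then show ?thesis unfolding h_def using integral_inner_right[of "g x" M "\<lambda>y. indicator {..x} y *\<^sub>R g y"] icut by simp
  qed
  have inner_T': "(\<integral>x. T' (x, y) \<partial>M) = g y \<bullet> h y" for y
  proof -
    have "(\<integral>x. T' (x, y) \<partial>M) = (\<integral>x. g y \<bullet> (indicator {..y} x *\<^sub>R g x) \<partial>M)"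
    proof (rule integral_cong_AE)
      show "AE x in M. T' (x, y) = g y \<bullet> (indicator {..y} x *\<^sub>R g x)"
        using nodiag[of y] by eventually_elim (auto simp: T'_def indicator_def inner_commute)
    qed (simp_all add: T'_def)
    then show ?thesis unfolding h_def using integral_inner_right[of "g y" M "\<lambda>x. indicator {..y} x *\<^sub>R g x"] icut by simp
  qed
  show "integrable M (\<lambda>x. g x \<bullet> h x)"
    using integrable_fst'[OF iT] by (simp add: inner_T)
  have "(norm (integral\<^sup>L M g))\<^sup>2 = (\<integral>x. (\<integral>y. g x \<bullet> g y \<partial>M) \<partial>M)"
    using g by (simp add: power2_norm_eq_inner)
  also have "\<dots> = integral\<^sup>L (M \<Otimes>\<^sub>M M) (\<lambda>(x, y). g x \<bullet> g y)"
    using integral_fst'[OF iprod] by simp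
  also have "(\<lambda>(x, y). g x \<bullet> g y) = (\<lambda>p. T p + T' p)"
    by (auto simp: T_def T'_def fun_eq_iff)
  also have "integral\<^sup>L (M \<Otimes>\<^sub>M M) (\<lambda>p. T p + T' p) = integral\<^sup>L (M \<Otimes>\<^sub>M M) T + integral\<^sup>L (M \<Otimes>\<^sub>M M) T'"
    by (rule Bochner_Integration.integral_add[OF iT iT'])
  also have "integral\<^sup>L (M \<Otimes>\<^sub>M M) T = (\<integral>x. g x \<bullet> h x \<partial>M)"
    using integral_fst'[OF iT] by (simp add: inner_T)
  also have "integral\<^sup>L (M \<Otimes>\<^sub>M M) T' = (\<integral>x. g x \<bullet> h x \<partial>M)"
    using integral_snd[of "\<lambda>x y. T' (x, y)"] iT' by (simp add: inner_T')
  finally show "2 * (\<integral>x. g x \<bullet> h x \<partial>M) = (norm (integral\<^sup>L M g))\<^sup>2" by simp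
qed

text \<open>The integrated form of differentiating the squared norm of \<open>D\<close>, valid for
  integrable \<open>g\<close>. One expands the square of \<open>p\<close> plus the integral of
  \<open>g\<close>; \<open>norm_integral_square\<close> turns the quadratic term into an integral
  against the primitive of \<open>g\<close>.\<close>

lemma energy_identity:
  fixes g :: "real \<Rightarrow> 'a::{real_inner, banach, second_countable_topology}"
  assumes g: "integrable (lebesgue_on {s..t}) g" and "s \<le> t"
    and D: "\<And>r. r \<in> {s..t} \<Longrightarrow> D r = p + integral\<^sup>L (lebesgue_on {s..r}) g"
  shows "integrable (lebesgue_on {s..t}) (\<lambda>r. g r \<bullet> D r)"
    and "(norm (D t))\<^sup>2 = (norm p)\<^sup>2 + 2 * integral\<^sup>L (lebesgue_on {s..t}) (\<lambda>r. g r \<bullet> D r)"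
proof -
  let ?M = "lebesgue_on {s..t}"
  define h where "h r = (\<integral>y. indicator {..r} y *\<^sub>R g y \<partial>?M)" for r
  have fin: "finite_measure ?M" by (rule finite_measure_lebesgue_on) simp
  have id: "(\<lambda>x. x) \<in> borel_measurable ?M"
    using id_borel_measurable_lebesgue_on[of "{s..t}"] by (simp add: id_def)
  have nodiag: "AE x in ?M. x \<noteq> a" for a
  proof -
    have "AE x in lebesgue. x \<noteq> a"
      using AE_completion[OF AE_lborel_singleton[of a]] by simp
    then show ?thesis by (subst AE_lebesgue_on_iff) auto
  qed
  note sq = norm_integral_square[OF fin g id nodiag, folded h_def]
  have h: "D r = p + h r" if "r \<in> {s..t}" for r
  proof -
    have "integral\<^sup>L (lebesgue_on {s..r}) g = h r"
      unfolding h_def using that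
      by (subst (1 2) integral_restrict_space) (auto intro!: Bochner_Integration.integral_cong simp: indicator_def)
    then show ?thesis using D that by simp
  qed
  have eq: "g r \<bullet> D r = g r \<bullet> p + g r \<bullet> h r" if "r \<in> {s..t}" for r
    using h[OF that] by (simp add: inner_add_right)
  have "integrable ?M (\<lambda>r. g r \<bullet> p + g r \<bullet> h r)"
    using g sq(1) by simp
  then show int: "integrable ?M (\<lambda>r. g r \<bullet> D r)"
    by (rule Bochner_Integration.integrable_cong[THEN iffD1, rotated -1]) (auto simp: eq)
  have "integral\<^sup>L ?M (\<lambda>r. g r \<bullet> D r) = integral\<^sup>L ?M (\<lambda>r. g r \<bullet> p + g r \<bullet> h r)"
    by (intro Bochner_Integration.integral_cong) (auto simp: eq)
  also have "\<dots> = integral\<^sup>L ?M g \<bullet> p + (\<integral>r. g r \<bullet> h r \<partial>?M)"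
    using g sq(1) by simp
  finally have "2 * integral\<^sup>L ?M (\<lambda>r. g r \<bullet> D r) = 2 * (integral\<^sup>L ?M g \<bullet> p) + (norm (integral\<^sup>L ?M g))\<^sup>2"
    using sq(2) by simp
  moreover have "D t = p + integral\<^sup>L ?M g" using D \<open>s \<le> t\<close> by simp
  ultimately show "(norm (D t))\<^sup>2 = (norm p)\<^sup>2 + 2 * integral\<^sup>L ?M (\<lambda>r. g r \<bullet> D r)"
    by (simp add: power2_norm_eq_inner inner_add_left inner_add_right inner_commute)
qed

section \<open>Gronwall's lemma and the continuation of bounds\<close>

lemma gronwall_const:
  fixes y :: "real \<Rightarrow> real"
  assumes y: "continuous_on {s..t} y" and "s \<le> t" "0 \<le> C"
    and le: "\<And>r. r \<in> {s..t} \<Longrightarrow> y r \<le> c + C * integral {s..r} y"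
  shows "y t \<le> c * exp (C * (t - s))"
proof -
  \<comment> \<open>The integrating factor makes \<open>Z\<close> nonincreasing, and
    \<open>Z s = c\<close>.\<close>
  define Z where "Z r = exp (- C * (r - s)) * (c + C * integral {s..r} y)" for r
  have der: "((\<lambda>r. integral {s..r} y) has_real_derivative y r) (at r within {s..t})" if "r \<in> {s..t}" for r
    by (rule integral_has_real_derivative[OF y that])
  have cont: "continuous_on {s..t} (\<lambda>r. integral {s..r} y)"
    using der by (meson DERIV_continuous continuous_on_eq_continuous_within)
  have "Z t \<le> Z s"
  proof (cases "s = t")
    case False
    show ?thesis
    proof (rule DERIV_nonpos_imp_decreasing_open[where f = Z and a = s and b = t])
      show "continuous_on {s..t} Z"
        unfolding Z_def[abs_def] by (intro continuous_intros cont)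
      fix r assume r: "s < r" "r < t"
      then have d: "((\<lambda>r. integral {s..r} y) has_real_derivative y r) (at r)"
        using der[of r] by (simp add: at_within_Icc_at)
      have "(Z has_real_derivative exp (- C * (r - s)) * C * (y r - (c + C * integral {s..r} y))) (at r)"
        unfolding Z_def[abs_def]
        by (auto intro!: derivative_eq_intros d simp: algebra_simps)
      moreover have "exp (- C * (r - s)) * C * (y r - (c + C * integral {s..r} y)) \<le> 0"
        using le[of r] r \<open>0 \<le> C\<close> by (intro mult_nonneg_nonpos) auto
      ultimately show "\<exists>d. (Z has_real_derivative d) (at r) \<and> d \<le> 0" by blast
    qed (use \<open>s \<le> t\<close> in simp)
  qed simp
  then have "exp (- C * (t - s)) * (c + C * integral {s..t} y) \<le> c" by (simp add: Z_def)
  then have "exp (C * (t - s)) * (exp (- C * (t - s)) * (c + C * integral {s..t} y)) \<le> exp (C * (t - s)) * c"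
    by (intro mult_left_mono) auto
  then have "c + C * integral {s..t} y \<le> exp (C * (t - s)) * c"
    by (simp add: mult.assoc[symmetric] exp_add[symmetric])
  then show ?thesis using le[of t] \<open>s \<le> t\<close> by (simp add: mult.commute)
qed

text \<open>At the first time at which \<open>y\<close> equals \<open>c\<close> the weak bound holds
  up to that time, and \<open>step\<close> contradicts the equality. This is how estimates known
  only inside a ball are shown to keep a solution inside it.\<close>

lemma continuous_bootstrap:
  fixes y :: "real \<Rightarrow> real"
  assumes y: "continuous_on {s..t} y" and "y s < c"
    and step: "\<And>r. s \<le> r \<Longrightarrow> r \<le> t \<Longrightarrow> (\<And>\<rho>. \<rho> \<in> {s..r} \<Longrightarrow> y \<rho> \<le> c) \<Longrightarrow> y r < c"
    and r: "r \<in> {s..t}"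
  shows "y r < c"
proof (rule ccontr)
  assume "\<not> y r < c"
  have cross: "\<exists>\<rho>\<in>{s..x}. y \<rho> = c" if "x \<in> {s..t}" "c \<le> y x" for x
    using IVT'[of y s c x] that \<open>y s < c\<close> continuous_on_subset[OF y, of "{s..x}"] by force
  define Z where "Z = {\<rho> \<in> {s..t}. y \<rho> = c}"
  have "Z \<noteq> {}" using cross[OF r] r \<open>\<not> y r < c\<close> by (force simp: Z_def)
  moreover have "compact Z"
  proof -
    have "closed Z" unfolding Z_def by (rule continuous_closed_preimage_constant[OF y]) simp
    moreover have "bounded Z" by (rule bounded_subset[of "{s..t}"]) (auto simp: Z_def)
    ultimately show ?thesis by (simp add: compact_eq_bounded_closed)
  qed
  ultimately obtain m where m: "m \<in> Z" "\<And>\<rho>. \<rho> \<in> Z \<Longrightarrow> m \<le> \<rho>"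
    using compact_attains_inf[of Z] by blast
  have "y \<rho> \<le> c" if \<rho>: "\<rho> \<in> {s..m}" for \<rho>
  proof (rule ccontr)
    assume "\<not> y \<rho> \<le> c"
    then obtain \<rho>' where \<rho>': "\<rho>' \<in> {s..\<rho>}" "y \<rho>' = c"
      using cross[of \<rho>] \<rho> m(1) by (auto simp: Z_def)
    then have "m \<le> \<rho>'" using m(2)[of \<rho>'] \<rho> m(1) by (auto simp: Z_def)
    then have "\<rho>' = \<rho>" using \<rho> \<rho>' by auto
    then show False using \<rho>'(2) \<open>\<not> y \<rho> \<le> c\<close> by simp
  qed
  then have "y m < c" using m(1) by (intro step) (auto simp: Z_def)
  then show False using m(1) by (simp add: Z_def)
qed

section \<open>Caratheodory solutions and their dependence on state and initial time\<close>

lemma solves_ivpD: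
  assumes "solves_ivp G \<tau> x w"
  shows "continuous_on {\<tau>..} w" "\<tau> \<le> t \<Longrightarrow> integrable (lebesgue_on {\<tau>..t}) (\<lambda>s. G s (w s))"
    "\<tau> \<le> t \<Longrightarrow> w t = x + integral\<^sup>L (lebesgue_on {\<tau>..t}) (\<lambda>s. G s (w s))"
  using assms by (simp_all add: solves_ivp_def)

lemma solves_ivp_start: "solves_ivp G \<tau> x w \<Longrightarrow> w \<tau> = x"
  using solves_ivpD(3)[of G \<tau> x w \<tau>] integral_lebesgue_on_singleton[of \<tau> "\<lambda>s. G s (w s)"] by simp

lemma solves_ivp_later:
  assumes w: "solves_ivp G \<tau> x w" and "\<tau> \<le> s" shows "solves_ivp G s (w s) w"
  unfolding solves_ivp_def
proof (intro conjI allI impI)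
  show "continuous_on {s..} w"
    using solves_ivpD(1)[OF w] by (rule continuous_on_subset) (use \<open>\<tau> \<le> s\<close> in auto)
  fix t assume "s \<le> t"
  have int: "integrable (lebesgue_on {\<tau>..t}) (\<lambda>s. G s (w s))"
    using \<open>\<tau> \<le> s\<close> \<open>s \<le> t\<close> by (intro solves_ivpD(2)[OF w]) simp
  then show "integrable (lebesgue_on {s..t}) (\<lambda>s. G s (w s))"
    by (rule integrable_lebesgue_on_subset) (use \<open>\<tau> \<le> s\<close> in auto)
  show "w t = w s + integral\<^sup>L (lebesgue_on {s..t}) (\<lambda>s. G s (w s))"
    using solves_ivpD(3)[OF w, of t] solves_ivpD(3)[OF w, of s]
      integral_lebesgue_on_split[OF int \<open>\<tau> \<le> s\<close> \<open>s \<le> t\<close>] \<open>\<tau> \<le> s\<close> \<open>s \<le> t\<close> by simp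
qed

text \<open>Only a one-sided Lipschitz condition is required, because the dissipative part of the vector
  field has no two-sided Lipschitz bound.\<close>

locale one_sided_lipschitz_flow =
  fixes G :: "real \<Rightarrow> ell2 \<Rightarrow> ell2" and v :: "real \<Rightarrow> real \<Rightarrow> ell2 \<Rightarrow> ell2"
  assumes sol: "solves_ivp G s x (\<lambda>t. v t s x)"
    and one_sided: "\<exists>C\<ge>0. AE t in lebesgue_on {a..b}. \<forall>x y. norm x \<le> R \<longrightarrow> norm y \<le> R \<longrightarrow>
        (G t x - G t y) \<bullet> (x - y) \<le> C * (norm (x - y))\<^sup>2"
    and bound: "\<exists>m. integrable (lebesgue_on {a..b}) m \<and> (AE t in lebesgue_on {a..b}. norm (G t x) \<le> m t)"
begin

lemma start [simp]: "v s s x = x"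
  using solves_ivp_start[OF sol] .

lemma continuous_time: "continuous_on {s..} (\<lambda>t. v t s x)"
  using solves_ivpD(1)[OF sol] .

text \<open>The solution is compared with the constant \<open>x\<close>, which is available for
  every starting time near \<open>s0\<close>. Writing the field as
  \<open>(G t v - G t x) + G t x\<close>, the first part is controlled by the one-sided constant
  \<open>C\<close> and the second by the integrable bound \<open>m\<close>. The growth of the
  squared distance is thus at most the increment of a continuous primitive of
  \<open>2 * (C + \<bar>m t\<bar>)\<close>.\<close>

lemma local_estimate:
  assumes e: "0 < e"
  shows "\<exists>\<delta>>0. \<forall>s r y. s0 - \<delta> < s \<longrightarrow> s \<le> r \<longrightarrow> r < s0 + \<delta> \<longrightarrow> norm (y - x) < \<delta> \<longrightarrow> norm (v r s y - x) < e"
proof -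
  \<comment> \<open>The cap at 1 keeps the solution in the ball of radius
    \<open>R = norm x + 1\<close>, where \<open>C\<close> is valid.\<close>
  define e' where "e' = min e 1"
  have e': "0 < e'" "e' \<le> e" "e' \<le> 1" using e by (auto simp: e'_def)
  define a b R where "a = s0 - 1" and "b = s0 + 1" and "R = norm x + 1"
  obtain C where C: "0 \<le> C" "AE t in lebesgue_on {a..b}. \<forall>x y. norm x \<le> R \<longrightarrow> norm y \<le> R \<longrightarrow>
        (G t x - G t y) \<bullet> (x - y) \<le> C * (norm (x - y))\<^sup>2" using one_sided by blast
  obtain m where m: "integrable (lebesgue_on {a..b}) m" "AE t in lebesgue_on {a..b}. norm (G t x) \<le> m t"
    using bound by blast
  define N where "N t = 2 * (C + \<bar>m t\<bar>)" for t
  have N0: "0 \<le> N t" for t using C by (simp add: N_def)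
  have iN: "integrable (lebesgue_on {a..b}) N" unfolding N_def[abs_def] using m(1) by simp
  have iN': "integrable (lebesgue_on {c..d}) N" if "{c..d} \<subseteq> {a..b}" for c d
    by (rule integrable_lebesgue_on_subset[OF iN that]) auto
  have N_int: "N integrable_on {a..b}" by (rule integrable_on_lebesgue_on[OF iN]) simp
  define J where "J r = integral {a..r} N" for r
  have J: "integral {s..r} N = J r - J s" if "a \<le> s" "s \<le> r" "r \<le> b" for s r
  proof -
    have "N integrable_on {a..r}" by (rule integrable_subinterval_real[OF N_int]) (use that in auto)
    then show ?thesis
      using Henstock_Kurzweil_Integration.integral_combine[of a s r N] that by (simp add: J_def)
  qed
  have J_mono: "J s \<le> J r" if "a \<le> s" "s \<le> r" "r \<le> b" for s r
  proof -
    have "0 \<le> integral {s..r} N"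
      by (rule Henstock_Kurzweil_Integration.integral_nonneg)
        (use integrable_subinterval_real[OF N_int] that N0 in auto)
    then show ?thesis using J[OF that] by simp
  qed
  have "continuous_on {a..b} J" unfolding J_def[abs_def] by (rule indefinite_integral_continuous_1[OF N_int])
  then have "isCont J s0" by (rule continuous_on_interior) (simp add: a_def b_def)
  then obtain d where d: "0 < d" "\<And>r. dist r s0 < d \<Longrightarrow> dist (J r) (J s0) < e'\<^sup>2 / 4"
    unfolding continuous_at_eps_delta using e'(1) by (metis zero_less_divide_iff zero_less_numeral zero_less_power)
  \<comment> \<open>The bound by \<open>e' / 2\<close> keeps the initial squared distance below
    \<open>e'\<^sup>2 / 2\<close>, and \<open>d\<close> keeps the growth below
    \<open>e'\<^sup>2 / 2\<close>; together they stay below \<open>e'\<^sup>2\<close>. The bound by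
    1 keeps all times in \<open>{a..b}\<close>.\<close>
  define \<delta> where "\<delta> = min (min d 1) (e' / 2)"
  have "norm (v r s y - x) < e" if sr: "s0 - \<delta> < s" "s \<le> r" "r < s0 + \<delta>" and y: "norm (y - x) < \<delta>" for s r y
  proof -
    have ab: "a \<le> s" "r \<le> b" and sub: "{s..r} \<subseteq> {a..b}" using sr by (auto simp: a_def b_def \<delta>_def)
    have "dist s s0 < d" "dist r s0 < d" using sr by (auto simp: \<delta>_def dist_real_def)
    then have "\<bar>J s - J s0\<bar> < e'\<^sup>2 / 4" "\<bar>J r - J s0\<bar> < e'\<^sup>2 / 4" using d(2) by (auto simp: dist_real_def)
    then have Jsr: "J r - J s < e'\<^sup>2 / 2" by linarith
    define D where "D t = v t s y - x" for t
    have cD: "continuous_on {s..r} D"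
      unfolding D_def by (intro continuous_intros continuous_on_subset[OF continuous_time]) auto
    have y2: "(norm (y - x))\<^sup>2 < e'\<^sup>2 / 2"
    proof -
      have "(norm (y - x))\<^sup>2 \<le> (e' / 2)\<^sup>2" using y by (intro power_mono) (auto simp: \<delta>_def)
      moreover have "(e' / 2)\<^sup>2 = e'\<^sup>2 / 4" by (simp add: power_divide)
      moreover have "0 < e'\<^sup>2" using e'(1) by simp
      ultimately show ?thesis by linarith
    qed
    have "(norm (D r))\<^sup>2 < e'\<^sup>2"
    proof (rule continuous_bootstrap[of s r "\<lambda>t. (norm (D t))\<^sup>2"])
      show "continuous_on {s..r} (\<lambda>t. (norm (D t))\<^sup>2)" by (intro continuous_intros cD)
      show "(norm (D s))\<^sup>2 < e'\<^sup>2" using y2 zero_le_power2[of e'] unfolding D_def start by linarith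
      fix t assume t: "s \<le> t" "t \<le> r" and small: "\<And>\<rho>. \<rho> \<in> {s..t} \<Longrightarrow> (norm (D \<rho>))\<^sup>2 \<le> e'\<^sup>2"
      have D1: "norm (D \<rho>) \<le> 1" if "\<rho> \<in> {s..t}" for \<rho>
        using small[OF that] e' by (meson abs_le_square_iff norm_ge_zero order_trans power2_le_imp_le less_imp_le)
      have R: "norm (v \<rho> s y) \<le> R" if "\<rho> \<in> {s..t}" for \<rho>
        using D1[OF that] norm_triangle_sub[of "v \<rho> s y" x] by (simp add: D_def R_def)
      let ?g = "\<lambda>\<rho>. G \<rho> (v \<rho> s y)"
      have ig: "integrable (lebesgue_on {s..t}) ?g" using solves_ivpD(2)[OF sol] t(1) by blast
      have Deq: "D \<rho> = (y - x) + integral\<^sup>L (lebesgue_on {s..\<rho>}) ?g" if "\<rho> \<in> {s..t}" for \<rho>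
        using solves_ivpD(3)[OF sol, of s \<rho> y] that by (simp add: D_def)
      note en = energy_identity[OF ig t(1) Deq]
      have sub': "{s..t} \<subseteq> {a..b}" using sub t by auto
      have C': "AE \<rho> in lebesgue_on {s..t}. \<forall>x y. norm x \<le> R \<longrightarrow> norm y \<le> R \<longrightarrow>
          (G \<rho> x - G \<rho> y) \<bullet> (x - y) \<le> C * (norm (x - y))\<^sup>2"
        by (rule AE_lebesgue_on_subset[OF C(2) sub']) auto
      have m': "AE \<rho> in lebesgue_on {s..t}. norm (G \<rho> x) \<le> m \<rho>"
        by (rule AE_lebesgue_on_subset[OF m(2) sub']) auto
      have ivl: "AE \<rho> in lebesgue_on {s..t}. \<rho> \<in> {s..t}"
        using AE_space[of "lebesgue_on {s..t}"] by simp
      have "AE \<rho> in lebesgue_on {s..t}. 2 * (?g \<rho> \<bullet> D \<rho>) \<le> N \<rho>"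
        using C' m' ivl
      proof eventually_elim
        case (elim \<rho>)
        have D: "norm (D \<rho>) \<le> 1" using D1 elim(3) by simp
        have "(G \<rho> (v \<rho> s y) - G \<rho> x) \<bullet> D \<rho> \<le> C * (norm (D \<rho>))\<^sup>2"
          using elim(1) R[of \<rho>] elim(3) by (simp add: D_def R_def)
        also have "\<dots> \<le> C * 1" using D C(1) by (intro mult_left_mono) (simp_all add: power_le_one)
        finally have 1: "(G \<rho> (v \<rho> s y) - G \<rho> x) \<bullet> D \<rho> \<le> C" by simp
        have "G \<rho> x \<bullet> D \<rho> \<le> norm (G \<rho> x) * norm (D \<rho>)" by (rule norm_cauchy_schwarz)
        also have "\<dots> \<le> \<bar>m \<rho>\<bar> * 1" using elim(2) D by (intro mult_mono) auto
        finally have "G \<rho> x \<bullet> D \<rho> \<le> \<bar>m \<rho>\<bar>" by simp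
        with 1 show ?case by (simp add: N_def inner_diff_left)
      qed
      then have "integral\<^sup>L (lebesgue_on {s..t}) (\<lambda>\<rho>. 2 * (?g \<rho> \<bullet> D \<rho>)) \<le> integral\<^sup>L (lebesgue_on {s..t}) N"
        using en(1) iN'[OF sub'] by (intro integral_mono_AE) auto
      also have "\<dots> = integral {s..t} N"
        by (rule lebesgue_integral_eq_integral[OF iN'[OF sub']]) simp
      also have "\<dots> \<le> J r - J s" using J[of s t] J_mono[of t r] ab t by simp
      finally have "(norm (D t))\<^sup>2 \<le> (norm (y - x))\<^sup>2 + (J r - J s)" using en(2) by simp
      then show "(norm (D t))\<^sup>2 < e'\<^sup>2" using y2 Jsr by linarith
    qed (use sr in simp)
    then have "norm (D r) < e'" using e'(1) by (simp add: power_less_imp_less_base)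
    then show ?thesis using e'(2) by (simp add: D_def)
  qed
  moreover have "0 < \<delta>" using d e' by (simp add: \<delta>_def)
  ultimately show ?thesis by blast
qed

text \<open>While two solutions are at distance at most 1, both lie in one ball and Gronwall gives
  the factor \<open>L = exp (C * (t - s0))\<close>. An initial distance below \<open>1 / L\<close>
  prevents the distance from ever reaching 1. Both \<open>L\<close> and \<epsilon> are uniform in
  the time \<open>s\<close> at which the second solution starts, as needed when the initial time
  varies.\<close>

lemma continuous_dependence:
  assumes "s0 \<le> t"
  shows "\<exists>L>0. \<exists>\<epsilon>>0. \<forall>s\<in>{s0..t}. \<forall>y. norm (y - v s s0 x) < \<epsilon> \<longrightarrow>
    norm (v t s y - v t s0 x) \<le> L * norm (y - v s s0 x)"
proof -
  have cw: "continuous_on {s0..t} (\<lambda>r. v r s0 x)"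
    by (rule continuous_on_subset[OF continuous_time]) auto
  then have "bounded ((\<lambda>r. v r s0 x) ` {s0..t})"
    by (intro compact_imp_bounded compact_continuous_image) auto
  then obtain B where B: "\<And>r. r \<in> {s0..t} \<Longrightarrow> norm (v r s0 x) \<le> B" unfolding bounded_iff by blast
  define R where "R = B + 1"
  obtain C where C: "0 \<le> C" "AE t in lebesgue_on {s0..t}. \<forall>x y. norm x \<le> R \<longrightarrow> norm y \<le> R \<longrightarrow>
        (G t x - G t y) \<bullet> (x - y) \<le> C * (norm (x - y))\<^sup>2" using one_sided by blast
  define L where "L = exp (C * (t - s0))"
  have L: "0 < L" by (simp add: L_def)
  have "norm (v t s y - v t s0 x) \<le> L * norm (y - v s s0 x)"
    if s: "s \<in> {s0..t}" and y: "norm (y - v s s0 x) < 1 / L" for s y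
  proof -
    define D where "D r = v r s y - v r s0 x" for r
    have cD: "continuous_on {s..t} D"
      unfolding D_def using s
      by (intro continuous_intros continuous_on_subset[OF continuous_time] continuous_on_subset[OF cw]) auto
    have grow: "(norm (D r))\<^sup>2 \<le> (norm (D s))\<^sup>2 * L\<^sup>2"
      if r: "s \<le> r" "r \<le> t" and small: "\<And>\<rho>. \<rho> \<in> {s..r} \<Longrightarrow> (norm (D \<rho>))\<^sup>2 \<le> 1" for r
    proof -
      have D1: "norm (D \<rho>) \<le> 1" if "\<rho> \<in> {s..r}" for \<rho>
        using small[OF that] by (simp add: abs_square_le_1)
      have R: "norm (v \<rho> s y) \<le> R" "norm (v \<rho> s0 x) \<le> R" if "\<rho> \<in> {s..r}" for \<rho>
        using D1[OF that] norm_triangle_sub[of "v \<rho> s y" "v \<rho> s0 x"] B[of \<rho>] that s r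
        by (auto simp: D_def R_def)
      let ?g = "\<lambda>\<rho>. G \<rho> (v \<rho> s y) - G \<rho> (v \<rho> s0 x)"
      have later: "solves_ivp G s (v s s0 x) (\<lambda>r. v r s0 x)"
        using s by (intro solves_ivp_later[OF sol]) auto
      have gr: "(norm (D q))\<^sup>2 \<le> (norm (D s))\<^sup>2 + 2 * C * integral {s..q} (\<lambda>\<rho>. (norm (D \<rho>))\<^sup>2)"
        if q: "q \<in> {s..r}" for q
      proof -
        have sq: "s \<le> q" using q by simp
        have ig: "integrable (lebesgue_on {s..q}) ?g"
          using solves_ivpD(2)[OF sol sq] solves_ivpD(2)[OF later sq] by (rule Bochner_Integration.integrable_diff)
        have Deq: "D \<rho> = D s + integral\<^sup>L (lebesgue_on {s..\<rho>}) ?g" if "\<rho> \<in> {s..q}" for \<rho>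
        proof -
          have "s \<le> \<rho>" using that by simp
          then show ?thesis
            using solves_ivpD(3)[OF sol, of s \<rho> y] solves_ivpD(3)[OF later, of \<rho>]
              solves_ivpD(2)[OF sol, of s \<rho> y] solves_ivpD(2)[OF later, of \<rho>] by (simp add: D_def)
        qed
        note en = energy_identity[OF ig sq Deq]
        have C': "AE \<rho> in lebesgue_on {s..q}. \<forall>x y. norm x \<le> R \<longrightarrow> norm y \<le> R \<longrightarrow>
            (G \<rho> x - G \<rho> y) \<bullet> (x - y) \<le> C * (norm (x - y))\<^sup>2"
          by (rule AE_lebesgue_on_subset[OF C(2)]) (use s q r in auto)
        have ivl: "AE \<rho> in lebesgue_on {s..q}. \<rho> \<in> {s..q}"
          using AE_space[of "lebesgue_on {s..q}"] by simp
        have cn: "continuous_on {s..q} (\<lambda>\<rho>. (norm (D \<rho>))\<^sup>2)"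
          using q r by (intro continuous_intros continuous_on_subset[OF cD]) auto
        have inn: "integrable (lebesgue_on {s..q}) (\<lambda>\<rho>. C * (norm (D \<rho>))\<^sup>2)"
          by (intro continuous_imp_integrable_real continuous_intros cn)
        have "AE \<rho> in lebesgue_on {s..q}. ?g \<rho> \<bullet> D \<rho> \<le> C * (norm (D \<rho>))\<^sup>2"
          using C' ivl
        proof eventually_elim
          case (elim \<rho>)
          then show ?case using R[of \<rho>] q by (simp add: D_def)
        qed
        then have "integral\<^sup>L (lebesgue_on {s..q}) (\<lambda>\<rho>. ?g \<rho> \<bullet> D \<rho>)
            \<le> integral\<^sup>L (lebesgue_on {s..q}) (\<lambda>\<rho>. C * (norm (D \<rho>))\<^sup>2)"
          by (intro integral_mono_AE en(1) inn)
        also have "\<dots> = integral {s..q} (\<lambda>\<rho>. C * (norm (D \<rho>))\<^sup>2)"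
          by (rule lebesgue_integral_eq_integral[OF inn]) simp
        also have "\<dots> = C * integral {s..q} (\<lambda>\<rho>. (norm (D \<rho>))\<^sup>2)" by simp
        finally show ?thesis using en(2) by simp
      qed
      have "(norm (D r))\<^sup>2 \<le> (norm (D s))\<^sup>2 * exp (2 * C * (r - s))"
        by (rule gronwall_const[of s r]) (use r C(1) gr in \<open>auto intro!: continuous_intros continuous_on_subset[OF cD]\<close>)
      also have "\<dots> \<le> (norm (D s))\<^sup>2 * L\<^sup>2"
      proof (rule mult_left_mono)
        have "C * (r - s) \<le> C * (t - s0)" using C(1) r s by (intro mult_left_mono) auto
        then have "exp (2 * C * (r - s)) \<le> exp (2 * (C * (t - s0)))" by simp
        also have "\<dots> = L\<^sup>2" unfolding L_def by (simp add: exp_double)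
        finally show "exp (2 * C * (r - s)) \<le> L\<^sup>2" .
      qed simp
      finally show ?thesis .
    qed
    have Ds: "norm (D s) * L < 1" using y L by (simp add: D_def pos_less_divide_eq)
    have Ds2: "(norm (D s))\<^sup>2 * L\<^sup>2 < 1"
    proof -
      have "(norm (D s) * L)\<^sup>2 < 1\<^sup>2" using Ds L by (intro power_strict_mono) auto
      then show ?thesis by (simp add: power_mult_distrib)
    qed
    have L1: "1 \<le> L" using C(1) \<open>s0 \<le> t\<close> by (simp add: L_def)
    have all: "(norm (D r))\<^sup>2 < 1" if "r \<in> {s..t}" for r
    proof (rule continuous_bootstrap[of s t "\<lambda>t. (norm (D t))\<^sup>2", OF _ _ _ that])
      show "continuous_on {s..t} (\<lambda>t. (norm (D t))\<^sup>2)" by (intro continuous_intros cD)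
      have "(norm (D s))\<^sup>2 * 1 \<le> (norm (D s))\<^sup>2 * L\<^sup>2" using L1 by (intro mult_left_mono) (auto simp: one_le_power)
      then show "(norm (D s))\<^sup>2 < 1" using Ds2 by simp
      fix r' assume r': "s \<le> r'" "r' \<le> t" and small: "\<And>\<rho>. \<rho> \<in> {s..r'} \<Longrightarrow> (norm (D \<rho>))\<^sup>2 \<le> 1"
      show "(norm (D r'))\<^sup>2 < 1" using grow[OF r' small] Ds2 by linarith
    qed
    have "(norm (D t))\<^sup>2 \<le> (norm (D s))\<^sup>2 * L\<^sup>2"
      by (rule grow) (use s all in \<open>auto intro: less_imp_le\<close>)
    then have "(norm (D t))\<^sup>2 \<le> (L * norm (D s))\<^sup>2" by (simp add: power_mult_distrib mult.commute)
    then have "norm (D t) \<le> L * norm (D s)" by (rule power2_le_imp_le) (use L in simp)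
    then show ?thesis by (simp add: D_def)
  qed
  then show ?thesis using L by (intro exI[of _ L] conjI exI[of _ "1 / L"]) auto
qed

text \<open>Uniqueness, read off from the estimate: the two solutions coincide at time
  \<open>r\<close>, so the bound for their distance at time \<open>t\<close> is 0.\<close>

lemma flow:
  assumes "s \<le> r" "r \<le> t" shows "v t r (v r s x) = v t s x"
proof -
  obtain L \<epsilon> where "0 < L" "0 < \<epsilon>" and *: "\<forall>q\<in>{s..t}. \<forall>y. norm (y - v q s x) < \<epsilon> \<longrightarrow>
    norm (v t q y - v t s x) \<le> L * norm (y - v q s x)"
    using continuous_dependence[of s t x] assms by auto
  have "norm (v t r (v r s x) - v t s x) \<le> L * norm (v r s x - v r s x)"
    using *[rule_format, of r "v r s x"] assms \<open>0 < \<epsilon>\<close> by simp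
  then show ?thesis by simp
qed

lemma continuous_state: "s \<le> t \<Longrightarrow> continuous_on UNIV (v t s)"
proof -
  assume "s \<le> t"
  have "\<exists>d>0. \<forall>y. dist y x < d \<longrightarrow> dist (v t s y) (v t s x) < e" if "0 < e" for x e
  proof -
    obtain L \<epsilon> where L: "0 < L" "0 < \<epsilon>" and *: "\<forall>q\<in>{s..t}. \<forall>y. norm (y - v q s x) < \<epsilon> \<longrightarrow>
      norm (v t q y - v t s x) \<le> L * norm (y - v q s x)"
      using continuous_dependence[OF \<open>s \<le> t\<close>, of x] by blast
    have "dist (v t s y) (v t s x) < e" if "dist y x < min \<epsilon> (e / L)" for y
    proof -
      have "norm (v t s y - v t s x) \<le> L * norm (y - x)"
        using *[rule_format, of s y] \<open>s \<le> t\<close> that by (simp add: dist_norm)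
      also have "\<dots> < e" using that L by (simp add: dist_norm pos_less_divide_eq mult.commute)
      finally show ?thesis by (simp add: dist_norm)
    qed
    moreover have "0 < min \<epsilon> (e / L)" using L \<open>0 < e\<close> by simp
    ultimately show ?thesis by blast
  qed
  then show ?thesis unfolding continuous_on_iff by blast
qed

text \<open>Both solutions are compared at the later of the starting times \<open>s\<close> and
  \<open>s0\<close>. If \<open>s\<close> is the earlier one, the solution from \<open>s\<close> is
  run up to \<open>s0\<close>; otherwise the solution from \<open>s0\<close> is run up to
  \<open>s\<close>. In both cases \<open>local_estimate\<close> keeps the moved solution close to
  \<open>x\<close>.\<close>

theorem continuous_initial_time:
  assumes \<xi>: "continuous_on {..t} \<xi>"
  shows "continuous_on {..t} (\<lambda>s. v t s (\<xi> s))"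
  unfolding continuous_on_iff
proof (intro ballI allI impI)
  fix s0 e :: real assume s0: "s0 \<in> {..t}" and e: "0 < e"
  define x where "x = \<xi> s0"
  obtain L \<epsilon> where L: "0 < L" "0 < \<epsilon>" and *: "\<forall>q\<in>{s0..t}. \<forall>y. norm (y - v q s0 x) < \<epsilon> \<longrightarrow>
    norm (v t q y - v t s0 x) \<le> L * norm (y - v q s0 x)"
    using continuous_dependence[of s0 t x] s0 by auto
  \<comment> \<open>Halved because for \<open>s0 < s\<close> two errors add up: the change of \<xi>
    and the drift of the solution from \<open>s0\<close>.\<close>
  define e1 where "e1 = min \<epsilon> (e / L) / 2"
  have e1: "0 < e1" using L e by (simp add: e1_def)
  have close: "norm (v t q y - v t s0 x) < e" if "q \<in> {s0..t}" "norm (y - v q s0 x) < 2 * e1" for q y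
  proof -
    have "norm (v t q y - v t s0 x) \<le> L * norm (y - v q s0 x)"
      using *[rule_format, of q y] that by (simp add: e1_def)
    also have "\<dots> < e" using that L by (simp add: e1_def pos_less_divide_eq mult.commute)
    finally show ?thesis .
  qed
  obtain \<delta> where \<delta>: "0 < \<delta>" and loc: "\<And>s r y. s0 - \<delta> < s \<Longrightarrow> s \<le> r \<Longrightarrow> r < s0 + \<delta> \<Longrightarrow>
      norm (y - x) < \<delta> \<Longrightarrow> norm (v r s y - x) < e1"
    using local_estimate[OF e1, of s0 x] by blast
  obtain d where d: "0 < d" "\<And>s. s \<in> {..t} \<Longrightarrow> dist s s0 < d \<Longrightarrow> dist (\<xi> s) x < min \<delta> e1"
    using \<xi> s0 \<delta> e1 unfolding continuous_on_iff x_def by (metis min_less_iff_conj)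
  show "\<exists>d>0. \<forall>s\<in>{..t}. dist s s0 < d \<longrightarrow> dist (v t s (\<xi> s)) (v t s0 (\<xi> s0)) < e"
  proof (intro exI[of _ "min d \<delta>"] conjI ballI impI)
    fix s assume s: "s \<in> {..t}" "dist s s0 < min d \<delta>"
    then have \<xi>s: "norm (\<xi> s - x) < \<delta>" "norm (\<xi> s - x) < e1" using d(2)[of s] by (auto simp: dist_norm)
    have "norm (v t s (\<xi> s) - v t s0 x) < e"
    proof (cases "s \<le> s0")
      case True
      have "norm (v s0 s (\<xi> s) - x) < e1"
        using s True \<delta> \<xi>s by (intro loc) (auto simp: dist_real_def)
      then have "norm (v t s0 (v s0 s (\<xi> s)) - v t s0 x) < e"
        using s0 e1 by (intro close) auto
      then show ?thesis using flow[OF True, of t] s0 by simp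
    next
      case False
      have "norm (v s s0 x - x) < e1"
        using s False \<delta> by (intro loc) (auto simp: dist_real_def)
      then have "norm (\<xi> s - v s s0 x) < 2 * e1"
        using \<xi>s(2) norm_triangle_ineq4[of "\<xi> s - x" "v s s0 x - x"] by simp
      then show ?thesis using False s by (intro close) auto
    qed
    then show "dist (v t s (\<xi> s)) (v t s0 (\<xi> s0)) < e" by (simp add: dist_norm x_def)
  qed (use d \<delta> in auto)
qed

end

section \<open>The lattice equation\<close>

lemma ell_2_comparison:
  assumes u: "u \<in> ell (ereal 2)" and le: "\<And>i. \<bar>w i\<bar> \<le> \<bar>u i\<bar>" shows "w \<in> ell (ereal 2)"
  unfolding ell_2_iff
  by (rule summable_on_comparison_test[OF u[unfolded ell_2_iff]]) (auto simp: abs_le_square_iff[symmetric] le)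

lemma norm_ell2_le:
  assumes "0 \<le> c" and le: "\<And>i. \<bar>coord a i\<bar> \<le> c * \<bar>coord b i\<bar>" shows "norm a \<le> c * norm b"
proof (rule power2_le_imp_le)
  have "(coord a i)\<^sup>2 \<le> c\<^sup>2 * (coord b i)\<^sup>2" for i
    using power_mono[OF le[of i] abs_ge_zero, of 2] by (simp add: power_mult_distrib)
  then have "(norm a)\<^sup>2 \<le> (\<Sum>\<^sub>\<infinity>i. c\<^sup>2 * (coord b i)\<^sup>2)"
    unfolding norm_ell2_sq by (intro infsum_mono coord_summable summable_on_cmult_right)
  also have "\<dots> = c\<^sup>2 * (norm b)\<^sup>2"
    unfolding norm_ell2_sq by (rule infsum_cmult_right')
  finally show "(norm a)\<^sup>2 \<le> (c * norm b)\<^sup>2" by (simp add: power_mult_distrib)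
qed (use assms in simp)

lemma inner_ell2_le:
  assumes "\<And>i. coord a i * coord b i \<le> c * (coord b i)\<^sup>2" shows "a \<bullet> b \<le> c * (norm b)\<^sup>2"
proof -
  have "a \<bullet> b \<le> (\<Sum>\<^sub>\<infinity>i. c * (coord b i)\<^sup>2)"
    unfolding inner_ell2_def
    by (intro infsum_mono coord_mult_summable summable_on_cmult_right coord_summable assms)
  then show ?thesis unfolding norm_ell2_sq by (simp add: infsum_cmult_right')
qed

text \<open>Expresses \<open>lapA\<close> as a combination of isometries, which yields its linearity
  and the norm bound 4 at once.\<close>

definition translate :: "int \<Rightarrow> ell2 \<Rightarrow> ell2" where
  "translate n u = ell2_of (\<lambda>i. coord u (i + n))"

lemma coord_translate: "coord (translate n u) i = coord u (i + n)"
  and norm_translate: "norm (translate n u) = norm u"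
proof -
  have bij: "bij_betw (\<lambda>i. i + n) UNIV UNIV"
    by (rule bij_betwI[of _ _ _ "\<lambda>i. i - n"]) auto
  have "(\<lambda>i. (coord u (i + n))\<^sup>2) summable_on UNIV"
    using summable_on_reindex_bij_betw[OF bij, of "\<lambda>i. (coord u i)\<^sup>2"] coord_summable[of u] by simp
  then show c: "coord (translate n u) i = coord u (i + n)" for i
    by (simp add: translate_def ell2_of_inverse ell_2_iff)
  have "(norm (translate n u))\<^sup>2 = (norm u)\<^sup>2"
    unfolding norm_ell2_sq c
    using infsum_reindex_bij_betw[OF bij, of "\<lambda>i. (coord u i)\<^sup>2"] by simp
  then show "norm (translate n u) = norm u" by simp
qed

lemma lapA_eq: "lapA u = 2 *\<^sub>R u - translate (-1) u - translate 1 u"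
  unfolding lapA_def coord_inject[symmetric]
  by (subst ell2_of_inverse)
    (use coord[of "2 *\<^sub>R u - translate (-1) u - translate 1 u"] in \<open>auto simp: fun_eq_iff coord_translate ell_2_iff\<close>)

lemma lapA_diff: "lapA (u - w) = lapA u - lapA w"
  by (rule ell2_eqI) (simp add: lapA_eq coord_translate)

lemma norm_lapA_le: "norm (lapA u) \<le> 4 * norm u"
proof -
  have "norm (lapA u) \<le> norm (2 *\<^sub>R u) + norm (translate (-1) u) + norm (translate 1 u)"
    unfolding lapA_eq by (intro order_trans[OF norm_triangle_ineq4] add_right_mono norm_triangle_ineq4)
  then show ?thesis by (simp add: norm_translate)
qed

lemma norm_lapA_lapA_le: "norm (lapA (lapA u)) \<le> 16 * norm u"
  using norm_lapA_le[of "lapA u"] norm_lapA_le[of u] by simp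

lemma abs_le_ell_norm_infinity: "u \<in> ell \<infinity> \<Longrightarrow> \<bar>u i\<bar> \<le> ell_norm \<infinity> u"
  unfolding ell_def ell_norm_def
  by (auto intro!: cSUP_upper simp: bounded_iff bdd_above_def)

text \<open>A single path \<omega> is fixed, so all estimates are pathwise and only time remains as
  a parameter.\<close>

locale lattice_equation =
  fixes lam k q :: real and f :: "int \<Rightarrow> real \<Rightarrow> real" and \<gamma> :: "real \<Rightarrow> real"
    and g :: "real \<Rightarrow> int \<Rightarrow> real \<Rightarrow> real" and \<psi>\<^sub>2 \<psi>\<^sub>3 \<psi>\<^sub>4 :: "real \<Rightarrow> int \<Rightarrow> real"
    and h h' :: "real \<Rightarrow> ell2" and \<omega> :: "real \<Rightarrow> real"
  assumes k: "0 < k" and q: "2 < q"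
    and F_maps: "u \<in> ell 2 \<Longrightarrow> (\<lambda>i. f i (u i)) \<in> ell 2"
    and \<gamma>_nonneg: "0 \<le> R \<Longrightarrow> 0 \<le> \<gamma> R"
    and F_lip: "0 \<le> R \<Longrightarrow> \<bar>a\<bar> \<le> R \<Longrightarrow> \<bar>b\<bar> \<le> R \<Longrightarrow> \<bar>f i a - f i b\<bar> \<le> \<gamma> R * \<bar>a - b\<bar>"
    and G_diff: "g t i differentiable (at a)"
    and G_deriv: "deriv (g t i) a \<le> \<psi>\<^sub>2 t i"
    and G_growth: "\<bar>g t i a\<bar> \<le> \<psi>\<^sub>3 t i * \<bar>a\<bar> powr (q - 1) + \<psi>\<^sub>4 t i"
    and G_spaces: "\<psi>\<^sub>2 \<in> bochner_L_loc \<infinity> \<infinity>" "\<psi>\<^sub>3 \<in> bochner_L_loc \<infinity> \<infinity>" "\<psi>\<^sub>4 \<in> bochner_L_loc 2 2"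
    and h_cont: "continuous_on UNIV h"
    and h'_L2: "(\<lambda>t. coord (h' t)) \<in> bochner_L_loc 2 2"
    and z_cont: "continuous_on UNIV (\<lambda>t. zOU (path_shift t \<omega>))"
begin

definition subst_u :: "real \<Rightarrow> ell2 \<Rightarrow> ell2" where
  "subst_u t x = exp (k * zOU (path_shift t \<omega>)) *\<^sub>R x - (1 / k) *\<^sub>R h t"

lemma L_infinity_loc_bound:
  assumes "\<psi> \<in> bochner_L_loc \<infinity> \<infinity>"
  shows "\<exists>C\<ge>0. AE t in lebesgue_on {a..b}. \<forall>i. \<bar>\<psi> t i\<bar> \<le> C"
proof -
  have L: "\<psi> \<in> bochner_L \<infinity> {a..b} \<infinity>" using assms by (simp add: bochner_L_loc_def)
  then obtain C where C: "AE t in lebesgue_on {a..b}. ell_norm \<infinity> (\<psi> t) \<le> C"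
    and mem: "\<And>t. t \<in> {a..b} \<Longrightarrow> \<psi> t \<in> ell \<infinity>"
    unfolding bochner_L_def by auto
  have ivl: "AE t in lebesgue_on {a..b}. t \<in> {a..b}"
    using AE_space[of "lebesgue_on {a..b}"] by simp
  have "AE t in lebesgue_on {a..b}. \<forall>i. \<bar>\<psi> t i\<bar> \<le> max C 0"
    using C ivl
  proof eventually_elim
    case (elim t)
    show ?case
    proof
      fix i
      have "\<bar>\<psi> t i\<bar> \<le> ell_norm \<infinity> (\<psi> t)" by (rule abs_le_ell_norm_infinity[OF mem[OF elim(2)]])
      then show "\<bar>\<psi> t i\<bar> \<le> max C 0" using elim(1) by linarith
    qed
  qed
  then show ?thesis by (intro exI[of _ "max C 0"]) auto
qed

lemma L2_loc_integrable:
  assumes "(\<lambda>t. coord (\<psi> t)) \<in> bochner_L_loc 2 2"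
  shows "integrable (lebesgue_on {a..b}) (\<lambda>t. (norm (\<psi> t))\<^sup>2)"
proof -
  have "(\<lambda>t. coord (\<psi> t)) \<in> bochner_L (ereal 2) {a..b} (ereal 2)"
    using assms by (simp add: bochner_L_loc_def)
  then have "integrable (lebesgue_on {a..b}) (\<lambda>t. (norm (\<psi> t)) powr 2)"
    by (simp add: bochner_L_def norm_ell2_eq_ell_norm)
  then show ?thesis using abs_powr_2[of "norm _"] by simp
qed

lemma psi4_mem: "\<psi>\<^sub>4 t \<in> ell (ereal 2)"
proof -
  have "\<psi>\<^sub>4 \<in> bochner_L (ereal 2) {t..t + 1} (ereal 2)" using G_spaces(3) by (simp add: bochner_L_loc_def)
  then show ?thesis unfolding bochner_L_def by auto
qed

lemma psi4_integrable: "integrable (lebesgue_on {a..b}) (\<lambda>t. (norm (ell2_of (\<psi>\<^sub>4 t)))\<^sup>2)"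
  by (rule L2_loc_integrable) (use psi4_mem G_spaces(3) in \<open>simp add: ell2_of_inverse\<close>)

lemma coord_nemytskii_f: "coord (nemytskii f u) i = f i (coord u i)"
proof -
  have "coord u \<in> ell 2" using coord[of u] by simp
  then have "(\<lambda>i. f i (coord u i)) \<in> ell (ereal 2)" using F_maps by simp
  then show ?thesis by (simp add: nemytskii_def ell2_of_inverse)
qed

lemma nemytskii_f_lipschitz:
  assumes "norm u \<le> R" "norm w \<le> R"
  shows "norm (nemytskii f u - nemytskii f w) \<le> \<gamma> R * norm (u - w)"
proof -
  have R: "0 \<le> R" using assms norm_ge_zero[of u] by linarith
  show ?thesis
  proof (rule norm_ell2_le)
    fix i
    have "\<bar>coord u i\<bar> \<le> R" "\<bar>coord w i\<bar> \<le> R"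
      using assms abs_coord_le_norm[of u i] abs_coord_le_norm[of w i] by auto
    then show "\<bar>coord (nemytskii f u - nemytskii f w) i\<bar> \<le> \<gamma> R * \<bar>coord (u - w) i\<bar>"
      using F_lip[OF R] by (simp add: coord_nemytskii_f)
  qed (rule \<gamma>_nonneg[OF R])
qed

text \<open>Coordinates of \<open>ell2_of\<close> are known only for members of
  \<open>ell 2\<close>, so membership has to come first. Since each coordinate is at most the norm,
  the power \<open>q - 1\<close> splits into \<open>norm u powr (q - 2)\<close> times the
  coordinate; this gives a dominating sequence in \<open>ell 2\<close>, hence both membership and
  the bound.\<close>

lemma nemytskii_g:
  assumes c: "0 \<le> c" "\<And>i. \<bar>\<psi>\<^sub>3 t i\<bar> \<le> c"
  shows "coord (nemytskii (g t) u) i = g t i (coord u i)"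
    and "norm (nemytskii (g t) u) \<le> c * norm u powr (q - 2) * norm u + norm (ell2_of (\<psi>\<^sub>4 t))"
proof -
  define p where "p = c * norm u powr (q - 2)"
  have p: "0 \<le> p" using c by (simp add: p_def)
  define y where "y = p *\<^sub>R ell2_of (\<lambda>i. \<bar>coord u i\<bar>) + ell2_of (\<lambda>i. \<bar>\<psi>\<^sub>4 t i\<bar>)"
  have abs_u: "(\<lambda>i. \<bar>coord u i\<bar>) \<in> ell (ereal 2)" by (rule ell_2_comparison[OF coord[of u]]) simp
  have abs_4: "(\<lambda>i. \<bar>\<psi>\<^sub>4 t i\<bar>) \<in> ell (ereal 2)" by (rule ell_2_comparison[OF psi4_mem[of t]]) simp
  have y: "coord y i = p * \<bar>coord u i\<bar> + \<bar>\<psi>\<^sub>4 t i\<bar>" for i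
    by (simp add: y_def ell2_of_inverse[OF abs_u] ell2_of_inverse[OF abs_4])
  have le: "\<bar>g t i (coord u i)\<bar> \<le> \<bar>coord y i\<bar>" for i
  proof -
    have "\<bar>coord u i\<bar> powr (q - 1) = \<bar>coord u i\<bar> powr (q - 2) * \<bar>coord u i\<bar>"
    proof (cases "coord u i = 0")
      case False
      have "\<bar>coord u i\<bar> powr (q - 1) = \<bar>coord u i\<bar> powr ((q - 2) + 1)" by simp
      also have "\<dots> = \<bar>coord u i\<bar> powr (q - 2) * \<bar>coord u i\<bar>" using False by (subst powr_add) simp
      finally show ?thesis .
    qed simp
    also have "\<dots> \<le> norm u powr (q - 2) * \<bar>coord u i\<bar>"
      using q by (intro mult_right_mono powr_mono2 abs_coord_le_norm) auto
    finally have "\<psi>\<^sub>3 t i * \<bar>coord u i\<bar> powr (q - 1) \<le> c * (norm u powr (q - 2) * \<bar>coord u i\<bar>)"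
      using c(2)[of i] by (intro mult_mono c) auto
    then show ?thesis
      using G_growth[of t i "coord u i"] y[of i] p by (simp add: p_def mult.assoc)
  qed
  have mem: "(\<lambda>i. g t i (coord u i)) \<in> ell (ereal 2)"
    by (rule ell_2_comparison[OF coord[of y] le])
  then show cg: "coord (nemytskii (g t) u) i = g t i (coord u i)" for i
    by (simp add: nemytskii_def ell2_of_inverse)
  have "norm (nemytskii (g t) u) \<le> 1 * norm y"
    by (rule norm_ell2_le) (use le in \<open>simp_all add: cg\<close>)
  also have "norm y \<le> p * norm (ell2_of (\<lambda>i. \<bar>coord u i\<bar>)) + norm (ell2_of (\<lambda>i. \<bar>\<psi>\<^sub>4 t i\<bar>))"
    unfolding y_def using norm_triangle_ineq[of "p *\<^sub>R ell2_of (\<lambda>i. \<bar>coord u i\<bar>)" "ell2_of (\<lambda>i. \<bar>\<psi>\<^sub>4 t i\<bar>)"] p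
    by simp
  also have "norm (ell2_of (\<lambda>i. \<bar>coord u i\<bar>)) \<le> 1 * norm u"
    by (rule norm_ell2_le) (simp_all add: ell2_of_inverse[OF abs_u])
  also have "norm (ell2_of (\<lambda>i. \<bar>\<psi>\<^sub>4 t i\<bar>)) \<le> 1 * norm (ell2_of (\<psi>\<^sub>4 t))"
    by (rule norm_ell2_le) (simp_all add: ell2_of_inverse[OF abs_4] ell2_of_inverse[OF psi4_mem])
  finally show "norm (nemytskii (g t) u) \<le> c * norm u powr (q - 2) * norm u + norm (ell2_of (\<psi>\<^sub>4 t))"
    using p by (simp add: p_def mult_left_mono)
qed

text \<open>The mean value theorem. The product with \<open>a - b\<close> is symmetric in
  \<open>a\<close> and \<open>b\<close>, so an upper bound on the derivative suffices in either
  order.\<close>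

lemma g_one_sided:
  assumes "\<psi>\<^sub>2 t i \<le> c" shows "(g t i a - g t i b) * (a - b) \<le> c * (a - b)\<^sup>2"
proof -
  have mvt: "g t i y - g t i x \<le> c * (y - x)" if lt: "x < y" for x y
  proof -
    have der: "(g t i has_real_derivative deriv (g t i) \<xi>) (at \<xi>)" for \<xi>
      using G_diff[of t i \<xi>] by (simp add: DERIV_deriv_iff_real_differentiable)
    then obtain \<xi> where "g t i y - g t i x = (y - x) * deriv (g t i) \<xi>"
      using MVT2[OF lt, of "g t i" "deriv (g t i)"] by blast
    also have "\<dots> \<le> (y - x) * c"
      using G_deriv[of t i \<xi>] assms lt by (intro mult_left_mono) auto
    finally show ?thesis by (simp add: mult.commute)
  qed
  consider "a < b" | "a = b" | "b < a" by linarith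
  then show ?thesis
  proof cases
    case 1
    have "(g t i b - g t i a) * (b - a) \<le> (c * (b - a)) * (b - a)"
      using mvt[OF 1] 1 by (intro mult_right_mono) auto
    then show ?thesis by (simp add: power2_eq_square algebra_simps)
  next
    case 3
    have "(g t i a - g t i b) * (a - b) \<le> (c * (a - b)) * (a - b)"
      using mvt[OF 3] 3 by (intro mult_right_mono) auto
    then show ?thesis by (simp add: power2_eq_square algebra_simps)
  qed simp
qed

lemma nemytskii_g_one_sided:
  assumes "0 \<le> c'" "\<And>i. \<bar>\<psi>\<^sub>3 t i\<bar> \<le> c'" and "\<And>i. \<bar>\<psi>\<^sub>2 t i\<bar> \<le> c"
  shows "(nemytskii (g t) u - nemytskii (g t) w) \<bullet> (u - w) \<le> c * (norm (u - w))\<^sup>2"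
  using assms(3) by (intro inner_ell2_le) (auto simp: nemytskii_g[OF assms(1,2)] abs_le_iff intro!: g_one_sided)

section \<open>One-sided bound and integrable bound for the vector field\<close>

lemma coefficients_bounded:
  "\<exists>Z H. 0 \<le> Z \<and> 0 \<le> H \<and> (\<forall>t\<in>{a..b}. \<bar>zOU (path_shift t \<omega>)\<bar> \<le> Z \<and> norm (h t) \<le> H)"
proof -
  have "bounded ((\<lambda>t. zOU (path_shift t \<omega>)) ` {a..b})"
    by (intro compact_imp_bounded compact_continuous_image continuous_on_subset[OF z_cont]) auto
  then obtain Z where Z: "0 < Z" "\<And>t. t \<in> {a..b} \<Longrightarrow> \<bar>zOU (path_shift t \<omega>)\<bar> \<le> Z" unfolding bounded_pos by auto
  have "bounded (h ` {a..b})"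
    by (intro compact_imp_bounded compact_continuous_image continuous_on_subset[OF h_cont]) auto
  then obtain H where H: "0 < H" "\<And>t. t \<in> {a..b} \<Longrightarrow> norm (h t) \<le> H" unfolding bounded_pos by auto
  show ?thesis using Z H by (intro exI[of _ Z] exI[of _ H]) auto
qed

lemma norm_subst_u_le:
  assumes "\<bar>zOU (path_shift t \<omega>)\<bar> \<le> Z" "norm (h t) \<le> H" "norm x \<le> R"
  shows "norm (subst_u t x) \<le> exp (k * Z) * R + H / k"
proof -
  have "norm (subst_u t x) \<le> exp (k * zOU (path_shift t \<omega>)) * norm x + norm (h t) / k"
    unfolding subst_u_def using norm_triangle_ineq4[of "exp (k * zOU (path_shift t \<omega>)) *\<^sub>R x" "(1 / k) *\<^sub>R h t"] k
    by simp
  also have "\<dots> \<le> exp (k * Z) * R + H / k"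
    using assms k by (intro add_mono mult_mono divide_right_mono) auto
  finally show ?thesis .
qed

text \<open>The constant adds up four contributions: 16 from the squared Laplacian,
  \<open>k * Z + \<bar>lam\<bar>\<close> from the linear term, \<open>4 * \<gamma> r\<close> from
  \<open>f\<close> and \<open>c2\<close> from \<open>g\<close>. The terms in \<open>h\<close> cancel
  in the difference, and the exponential weights cancel because the transformed states differ by
  \<open>exp (k * z)\<close> times \<open>x - y\<close>.\<close>

lemma rhsF_one_sided:
  "\<exists>C\<ge>0. AE t in lebesgue_on {a..b}. \<forall>x y. norm x \<le> R \<longrightarrow> norm y \<le> R \<longrightarrow>
    (rhsF lam k f g h h' t \<omega> x - rhsF lam k f g h h' t \<omega> y) \<bullet> (x - y) \<le> C * (norm (x - y))\<^sup>2"
proof -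
  obtain Z H where Z: "0 \<le> Z" "0 \<le> H" "\<And>t. t \<in> {a..b} \<Longrightarrow> \<bar>zOU (path_shift t \<omega>)\<bar> \<le> Z"
    "\<And>t. t \<in> {a..b} \<Longrightarrow> norm (h t) \<le> H"
    using coefficients_bounded by blast
  obtain c2 where c2: "0 \<le> c2" "AE t in lebesgue_on {a..b}. \<forall>i. \<bar>\<psi>\<^sub>2 t i\<bar> \<le> c2"
    using L_infinity_loc_bound[OF G_spaces(1)] by blast
  obtain c3 where c3: "0 \<le> c3" "AE t in lebesgue_on {a..b}. \<forall>i. \<bar>\<psi>\<^sub>3 t i\<bar> \<le> c3"
    using L_infinity_loc_bound[OF G_spaces(2)] by blast
  \<comment> \<open>Bounds the transformed states of the ball of radius \<open>R\<close>. Replacing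
    a negative \<open>R\<close> by 0 keeps \<open>r\<close> nonnegative, so that
    \<open>\<gamma> r\<close> is controlled.\<close>
  define r where "r = exp (k * Z) * max R 0 + H / k"
  have r: "0 \<le> r" using Z k by (simp add: r_def)
  define C where "C = 16 + (k * Z + \<bar>lam\<bar>) + 4 * \<gamma> r + c2"
  have ivl: "AE t in lebesgue_on {a..b}. t \<in> {a..b}"
    using AE_space[of "lebesgue_on {a..b}"] by simp
  have "AE t in lebesgue_on {a..b}. \<forall>x y. norm x \<le> R \<longrightarrow> norm y \<le> R \<longrightarrow>
    (rhsF lam k f g h h' t \<omega> x - rhsF lam k f g h h' t \<omega> y) \<bullet> (x - y) \<le> C * (norm (x - y))\<^sup>2"
    using c2(2) c3(2) ivl
  proof eventually_elim
    case (elim t)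
    show ?case
    proof (intro allI impI)
      fix x y :: ell2 assume xy: "norm x \<le> R" "norm y \<le> R"
      define z where "z = zOU (path_shift t \<omega>)"
      define d where "d = x - y"
      have zt: "\<bar>z\<bar> \<le> Z" using Z(3)[OF elim(3)] by (simp add: z_def)
      define u w where "u = subst_u t x" and "w = subst_u t y"
      have uw: "u - w = exp (k * z) *\<^sub>R d"
        by (simp add: u_def w_def subst_u_def z_def d_def algebra_simps)
      have d: "d = exp (- k * z) *\<^sub>R (u - w)"
        unfolding uw by (simp add: exp_add[symmetric])
      have bu: "norm u \<le> r" "norm w \<le> r"
        unfolding u_def w_def r_def using Z elim(3) xy by (auto intro!: norm_subst_u_le)
      have "rhsF lam k f g h h' t \<omega> x - rhsF lam k f g h h' t \<omega> y =
          - lapA (lapA d) + (k * z - lam) *\<^sub>R d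
          - exp (- k * z) *\<^sub>R lapA (nemytskii f u - nemytskii f w)
          + exp (- k * z) *\<^sub>R (nemytskii (g t) u - nemytskii (g t) w)"
        unfolding rhsF_def Let_def z_def[symmetric] u_def[unfolded subst_u_def, folded z_def, symmetric]
          w_def[unfolded subst_u_def, folded z_def, symmetric] d_def
        by (simp add: lapA_diff algebra_simps)
      then have split: "(rhsF lam k f g h h' t \<omega> x - rhsF lam k f g h h' t \<omega> y) \<bullet> d =
          - (lapA (lapA d) \<bullet> d) + (k * z - lam) * (norm d)\<^sup>2
          - exp (- k * z) * (lapA (nemytskii f u - nemytskii f w) \<bullet> d)
          + exp (- k * z) * ((nemytskii (g t) u - nemytskii (g t) w) \<bullet> d)"
        by (simp add: inner_add_left inner_diff_left power2_norm_eq_inner)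
      have cs: "- (p \<bullet> d) \<le> norm p * norm d" for p
        using norm_cauchy_schwarz[of "- p" d] by simp
      have 1: "- (lapA (lapA d) \<bullet> d) \<le> 16 * (norm d)\<^sup>2"
        using cs[of "lapA (lapA d)"] mult_right_mono[OF norm_lapA_lapA_le[of d] norm_ge_zero[of d]]
        by (simp add: power2_eq_square)
      have 2: "(k * z - lam) * (norm d)\<^sup>2 \<le> (k * Z + \<bar>lam\<bar>) * (norm d)\<^sup>2"
      proof (rule mult_right_mono)
        have "k * z \<le> k * Z" using zt k by (intro mult_left_mono) auto
        then show "k * z - lam \<le> k * Z + \<bar>lam\<bar>" by linarith
      qed simp
      have 3: "- exp (- k * z) * (lapA (nemytskii f u - nemytskii f w) \<bullet> d) \<le> 4 * \<gamma> r * (norm d)\<^sup>2"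
      proof -
        have "norm (lapA (nemytskii f u - nemytskii f w)) \<le> 4 * (\<gamma> r * norm (u - w))"
          using norm_lapA_le[of "nemytskii f u - nemytskii f w"] nemytskii_f_lipschitz[OF bu] by linarith
        also have "\<dots> = exp (k * z) * (4 * \<gamma> r * norm d)" unfolding uw by simp
        finally have "norm (lapA (nemytskii f u - nemytskii f w)) * norm d \<le> exp (k * z) * (4 * \<gamma> r * norm d) * norm d"
          by (rule mult_right_mono) simp
        then have "exp (- k * z) * - (lapA (nemytskii f u - nemytskii f w) \<bullet> d)
            \<le> exp (- k * z) * (exp (k * z) * (4 * \<gamma> r * norm d) * norm d)"
          using cs[of "lapA (nemytskii f u - nemytskii f w)"] by (intro mult_left_mono) auto
        also have "\<dots> = exp (- k * z + k * z) * (4 * \<gamma> r * (norm d)\<^sup>2)"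
          unfolding exp_add power2_eq_square by (simp only: mult.assoc)
        finally show ?thesis by simp
      qed
      \<comment> \<open>The bound for \<open>g\<close> pairs with \<open>u - w\<close>, not with
        \<open>d\<close>. Multiplying it by the square of the weight turns both sides into
        expressions in \<open>d\<close>.\<close>
      have 4: "exp (- k * z) * ((nemytskii (g t) u - nemytskii (g t) w) \<bullet> d) \<le> c2 * (norm d)\<^sup>2"
      proof -
        have "(nemytskii (g t) u - nemytskii (g t) w) \<bullet> (u - w) \<le> c2 * (norm (u - w))\<^sup>2"
          using elim by (intro nemytskii_g_one_sided[OF c3(1)]) auto
        then have "(exp (- k * z))\<^sup>2 * ((nemytskii (g t) u - nemytskii (g t) w) \<bullet> (u - w))
            \<le> (exp (- k * z))\<^sup>2 * (c2 * (norm (u - w))\<^sup>2)" by (intro mult_left_mono) auto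
        also have "\<dots> = c2 * (norm d)\<^sup>2" unfolding d by (simp add: power_mult_distrib)
        also have "(exp (- k * z))\<^sup>2 * ((nemytskii (g t) u - nemytskii (g t) w) \<bullet> (u - w))
            = exp (- k * z) * ((nemytskii (g t) u - nemytskii (g t) w) \<bullet> d)"
          unfolding d by (simp add: power2_eq_square)
        finally show ?thesis .
      qed
      show "(rhsF lam k f g h h' t \<omega> x - rhsF lam k f g h h' t \<omega> y) \<bullet> (x - y) \<le> C * (norm (x - y))\<^sup>2"
        using split 1 2 3 4 unfolding d_def[symmetric] C_def by (simp add: distrib_right)
    qed
  qed
  moreover have "0 \<le> C" using Z k \<gamma>_nonneg[OF r] c2(1) by (simp add: C_def)
  ultimately show ?thesis by blast
qed

text \<open>On a bounded interval everything is bounded except the norms of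
  \<open>\<psi>\<^sub>4\<close> and \<open>h'\<close>. These enter linearly while only their squares
  are known to be integrable; the elementary bound \<open>a \<le> 1 + a\<^sup>2\<close> closes the
  gap.\<close>

lemma rhsF_bound:
  "\<exists>m. integrable (lebesgue_on {a..b}) m \<and> (AE t in lebesgue_on {a..b}. norm (rhsF lam k f g h h' t \<omega> x) \<le> m t)"
proof -
  obtain Z H where Z: "0 \<le> Z" "0 \<le> H" "\<And>t. t \<in> {a..b} \<Longrightarrow> \<bar>zOU (path_shift t \<omega>)\<bar> \<le> Z"
    "\<And>t. t \<in> {a..b} \<Longrightarrow> norm (h t) \<le> H"
    using coefficients_bounded by blast
  obtain c3 where c3: "0 \<le> c3" "AE t in lebesgue_on {a..b}. \<forall>i. \<bar>\<psi>\<^sub>3 t i\<bar> \<le> c3"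
    using L_infinity_loc_bound[OF G_spaces(2)] by blast
  define r where "r = exp (k * Z) * norm x + H / k"
  have r: "0 \<le> r" using Z k by (simp add: r_def)
  define B where "B = 4 * (norm (nemytskii f 0) + \<gamma> r * r) + c3 * r powr (q - 2) * r"
  define m where "m t = (16 + k * Z + \<bar>lam\<bar>) * norm x + exp (k * Z) * (B + (1 + (norm (ell2_of (\<psi>\<^sub>4 t)))\<^sup>2))
      + exp (k * Z) / k * (16 * H + \<bar>lam\<bar> * H + (1 + (norm (h' t))\<^sup>2))" for t
  have "integrable (lebesgue_on {a..b}) m"
    unfolding m_def[abs_def] using psi4_integrable[of a b] L2_loc_integrable[OF h'_L2, of a b]
    by (intro Bochner_Integration.integrable_add integrable_mult_right) auto
  moreover have ivl: "AE t in lebesgue_on {a..b}. t \<in> {a..b}"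
    using AE_space[of "lebesgue_on {a..b}"] by simp
  have "AE t in lebesgue_on {a..b}. norm (rhsF lam k f g h h' t \<omega> x) \<le> m t"
    using c3(2) ivl
  proof eventually_elim
    case (elim t)
    define z where "z = zOU (path_shift t \<omega>)"
    have zt: "\<bar>z\<bar> \<le> Z" using Z(3)[OF elim(2)] by (simp add: z_def)
    define u where "u = subst_u t x"
    have bu: "norm u \<le> r" unfolding u_def r_def using Z elim(2) by (auto intro!: norm_subst_u_le)
    have sq: "a \<le> 1 + a\<^sup>2" for a :: real
      using sum_squares_bound[of a 1] zero_le_power2[of a] by (simp; linarith)
    have kz: "k * z \<le> k * Z" "- k * z \<le> k * Z" using zt k mult_left_mono[of z Z k] mult_left_mono[of "- z" Z k] by auto
    have ez: "exp (- k * z) \<le> exp (k * Z)" using kz by simp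
    have eq: "rhsF lam k f g h h' t \<omega> x = - lapA (lapA x) + (k * z - lam) *\<^sub>R x
        + exp (- k * z) *\<^sub>R (- lapA (nemytskii f u) + nemytskii (g t) u)
        + (exp (- k * z) / k) *\<^sub>R (lapA (lapA (h t)) + lam *\<^sub>R h t + h' t)"
      unfolding rhsF_def Let_def u_def subst_u_def z_def by simp
    have 1: "norm (- lapA (lapA x) + (k * z - lam) *\<^sub>R x) \<le> (16 + k * Z + \<bar>lam\<bar>) * norm x"
    proof -
      have "\<bar>k * z - lam\<bar> * norm x \<le> (k * Z + \<bar>lam\<bar>) * norm x"
        using kz by (intro mult_right_mono) auto
      then show ?thesis
        using norm_triangle_ineq[of "- lapA (lapA x)" "(k * z - lam) *\<^sub>R x"] norm_lapA_lapA_le[of x]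
        by (simp add: distrib_right)
    qed
    have 2: "norm (- lapA (nemytskii f u) + nemytskii (g t) u) \<le> B + (1 + (norm (ell2_of (\<psi>\<^sub>4 t)))\<^sup>2)"
    proof -
      have "norm (nemytskii f u - nemytskii f 0) \<le> \<gamma> r * norm (u - 0)"
        using bu r by (intro nemytskii_f_lipschitz) auto
      moreover have "\<gamma> r * norm (u - 0) \<le> \<gamma> r * r" using bu \<gamma>_nonneg[OF r] by (intro mult_left_mono) auto
      ultimately have "norm (nemytskii f u) \<le> norm (nemytskii f 0) + \<gamma> r * r"
        using norm_triangle_sub[of "nemytskii f u" "nemytskii f 0"] by linarith
      then have f: "norm (lapA (nemytskii f u)) \<le> 4 * (norm (nemytskii f 0) + \<gamma> r * r)"
        by (intro order_trans[OF norm_lapA_le] mult_left_mono) auto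
      have "norm (nemytskii (g t) u) \<le> c3 * norm u powr (q - 2) * norm u + norm (ell2_of (\<psi>\<^sub>4 t))"
        using elim(1) by (intro nemytskii_g c3(1)) auto
      also have "c3 * norm u powr (q - 2) * norm u \<le> c3 * r powr (q - 2) * r"
        using bu c3(1) q by (intro mult_mono powr_mono2 mult_nonneg_nonneg) auto
      finally show ?thesis
        using f sq[of "norm (ell2_of (\<psi>\<^sub>4 t))"] norm_triangle_ineq[of "- lapA (nemytskii f u)" "nemytskii (g t) u"]
        by (simp add: B_def)
    qed
    have 3: "norm (lapA (lapA (h t)) + lam *\<^sub>R h t + h' t) \<le> 16 * H + \<bar>lam\<bar> * H + (1 + (norm (h' t))\<^sup>2)"
    proof -
      have ht: "norm (h t) \<le> H" using Z(4)[OF elim(2)] .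
      have "norm (lapA (lapA (h t)) + lam *\<^sub>R h t + h' t) \<le> norm (lapA (lapA (h t))) + norm (lam *\<^sub>R h t) + norm (h' t)"
        by (intro order_trans[OF norm_triangle_ineq] add_right_mono norm_triangle_ineq)
      moreover have "norm (lapA (lapA (h t))) \<le> 16 * H" using norm_lapA_lapA_le[of "h t"] ht by linarith
      moreover have "norm (lam *\<^sub>R h t) \<le> \<bar>lam\<bar> * H" using ht by (simp add: mult_left_mono)
      ultimately show ?thesis using sq[of "norm (h' t)"] by linarith
    qed
    have "norm (rhsF lam k f g h h' t \<omega> x) \<le> norm (- lapA (lapA x) + (k * z - lam) *\<^sub>R x)
        + norm (exp (- k * z) *\<^sub>R (- lapA (nemytskii f u) + nemytskii (g t) u))
        + norm ((exp (- k * z) / k) *\<^sub>R (lapA (lapA (h t)) + lam *\<^sub>R h t + h' t))"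
      unfolding eq by (intro order_trans[OF norm_triangle_ineq] add_right_mono norm_triangle_ineq)
    also have "\<dots> \<le> m t"
    proof -
      have "norm (exp (- k * z) *\<^sub>R (- lapA (nemytskii f u) + nemytskii (g t) u))
          \<le> exp (k * Z) * (B + (1 + (norm (ell2_of (\<psi>\<^sub>4 t)))\<^sup>2))"
        using mult_mono[OF ez 2] by simp
      moreover have "norm ((exp (- k * z) / k) *\<^sub>R (lapA (lapA (h t)) + lam *\<^sub>R h t + h' t))
          \<le> exp (k * Z) / k * (16 * H + \<bar>lam\<bar> * H + (1 + (norm (h' t))\<^sup>2))"
        using mult_mono[OF divide_right_mono[OF ez, of k] 3] k by simp
      ultimately show ?thesis using 1 unfolding m_def by linarith
    qed
    finally show ?case .
  qed
  ultimately show ?thesis by blast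
qed

end

section \<open>Statistical solutions of pullback attracting processes\<close>

lemma (in compact_positive_functional) representing_measure:
  "\<exists>\<mu>. prob_space \<mu> \<and> sets \<mu> = sets borel \<and> (AE x in \<mu>. x \<in> K) \<and>
    (\<forall>f. continuous_on UNIV f \<longrightarrow> integrable \<mu> f \<and> integral\<^sup>L \<mu> f = I f)"
  using prob_space_rep AE_rep riesz_representation by (intro exI[of _ rep]) auto

text \<open>The averages considered below are bounded on the whole line, so the rules can be stated
  without the end point \<open>a\<close> of the half-line.\<close>

lemma generalized_Banach_limitD:
  assumes L: "generalized_Banach_limit L"
  shows "bounded (range \<zeta>) \<Longrightarrow> bounded (range \<eta>) \<Longrightarrow> L (\<lambda>t. \<zeta> t + \<eta> t) = L \<zeta> + L \<eta>"
    and "bounded (range \<zeta>) \<Longrightarrow> L (\<lambda>t. c * \<zeta> t) = c * L \<zeta>"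
    and "bounded (range \<zeta>) \<Longrightarrow> (\<And>t. 0 \<le> \<zeta> t) \<Longrightarrow> 0 \<le> L \<zeta>"
    and "bounded (range \<zeta>) \<Longrightarrow> (\<zeta> \<longlongrightarrow> l) at_bot \<Longrightarrow> L \<zeta> = l"
proof -
  obtain a where a: "let B = {\<zeta> :: real \<Rightarrow> real. bounded (\<zeta> ` {..a})} in
        (\<forall>\<zeta>\<in>B. \<forall>\<eta>\<in>B. L (\<lambda>t. \<zeta> t + \<eta> t) = L \<zeta> + L \<eta>) \<and>
        (\<forall>\<zeta>\<in>B. \<forall>c. L (\<lambda>t. c * \<zeta> t) = c * L \<zeta>) \<and>
        (\<forall>\<zeta>\<in>B. (\<forall>t\<le>a. 0 \<le> \<zeta> t) \<longrightarrow> 0 \<le> L \<zeta>) \<and>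
        (\<forall>\<zeta>\<in>B. \<forall>l. (\<zeta> \<longlongrightarrow> l) at_bot \<longrightarrow> L \<zeta> = l)"
    using L unfolding generalized_Banach_limit_def by blast
  have mem: "bounded (range \<zeta>) \<Longrightarrow> \<zeta> \<in> {\<zeta> :: real \<Rightarrow> real. bounded (\<zeta> ` {..a})}" for \<zeta>
    using bounded_subset[of "range \<zeta>" "\<zeta> ` {..a}"] by auto
  note a = a[unfolded Let_def]
  note add = a[THEN conjunct1] and scale = a[THEN conjunct2, THEN conjunct1]
    and nonneg = a[THEN conjunct2, THEN conjunct2, THEN conjunct1]
    and lim = a[THEN conjunct2, THEN conjunct2, THEN conjunct2]
  show "L (\<lambda>t. \<zeta> t + \<eta> t) = L \<zeta> + L \<eta>" if "bounded (range \<zeta>)" "bounded (range \<eta>)"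
    using bspec[OF bspec[OF add mem[OF that(1)]] mem[OF that(2)]] .
  show "L (\<lambda>t. c * \<zeta> t) = c * L \<zeta>" if "bounded (range \<zeta>)"
    using spec[OF bspec[OF scale mem[OF that]], of c] .
  show "0 \<le> L \<zeta>" if "bounded (range \<zeta>)" "\<And>t. 0 \<le> \<zeta> t"
    using mp[OF bspec[OF nonneg mem[OF that(1)]]] that(2) by simp
  show "L \<zeta> = l" if "bounded (range \<zeta>)" "(\<zeta> \<longlongrightarrow> l) at_bot"
    using mp[OF spec[OF bspec[OF lim mem[OF that(1)]], of l] that(2)] .
qed

section \<open>Time averages over the past\<close>

definition past_average :: "real \<Rightarrow> (real \<Rightarrow> real) \<Rightarrow> real \<Rightarrow> real" where
  "past_average t \<phi> \<tau> = 1 / (t - \<tau>) * (LBINT s:{\<tau>..t}. \<phi> s)"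

lemma set_integrable_past:
  "continuous_on {..t} \<phi> \<Longrightarrow> b \<le> t \<Longrightarrow> set_integrable lborel {a..b} (\<phi> :: real \<Rightarrow> real)"
  by (rule borel_integrable_atLeastAtMost', erule continuous_on_subset) auto

lemma past_average_add:
  "continuous_on {..t} \<phi> \<Longrightarrow> continuous_on {..t} \<psi> \<Longrightarrow>
    past_average t (\<lambda>s. \<phi> s + \<psi> s) \<tau> = past_average t \<phi> \<tau> + past_average t \<psi> \<tau>"
  using set_integral_add(2)[OF set_integrable_past[of t \<phi> t \<tau>] set_integrable_past[of t \<psi> t \<tau>]]
  by (simp add: past_average_def distrib_left)

lemma past_average_scale: "past_average t (\<lambda>s. c * \<phi> s) \<tau> = c * past_average t \<phi> \<tau>"
  by (simp add: past_average_def)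

lemma past_average_cong: "(\<And>s. s \<le> t \<Longrightarrow> \<phi> s = \<psi> s) \<Longrightarrow> past_average t \<phi> = past_average t \<psi>"
  unfolding past_average_def set_lebesgue_integral_def
  by (intro ext arg_cong2[where f = "(*)"] refl Bochner_Integration.integral_cong) (auto simp: indicator_def)

lemma past_average_nonneg: "(\<And>s. s \<le> t \<Longrightarrow> 0 \<le> \<phi> s) \<Longrightarrow> 0 \<le> past_average t \<phi> \<tau>"
proof (cases "\<tau> \<le> t")
  case True
  assume "\<And>s. s \<le> t \<Longrightarrow> 0 \<le> \<phi> s"
  then have "0 \<le> (LBINT s:{\<tau>..t}. \<phi> s)"
    unfolding set_lebesgue_integral_def by (intro Bochner_Integration.integral_nonneg) (simp add: indicator_def)
  then show ?thesis using True by (simp add: past_average_def)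
qed (simp add: past_average_def set_lebesgue_integral_def)

lemma LBINT_abs_le:
  fixes \<phi> :: "real \<Rightarrow> real"
  assumes \<phi>: "continuous_on {..t} \<phi>" and M: "\<And>s. s \<le> t \<Longrightarrow> \<bar>\<phi> s\<bar> \<le> M" and "a \<le> b" "b \<le> t"
  shows "\<bar>LBINT s:{a..b}. \<phi> s\<bar> \<le> M * (b - a)"
proof -
  have int: "set_integrable lborel {a..b} \<phi>" by (rule set_integrable_past[OF \<phi> \<open>b \<le> t\<close>])
  have "\<bar>LBINT s:{a..b}. \<phi> s\<bar> \<le> (LBINT s:{a..b}. \<bar>\<phi> s\<bar>)"
    using set_integral_norm_bound[OF int] by simp
  also have "\<dots> \<le> (LBINT s:{a..b}. M)"
    using M \<open>b \<le> t\<close>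
    by (intro set_integral_mono set_integrable_abs int set_integrable_past[of b]) auto
  also have "\<dots> = M * (b - a)" using \<open>a \<le> b\<close> by (simp add: set_lebesgue_integral_def)
  finally show ?thesis .
qed

lemma abs_past_average_le:
  assumes "continuous_on {..t} \<phi>" "\<And>s. s \<le> t \<Longrightarrow> \<bar>\<phi> s\<bar> \<le> M"
  shows "\<bar>past_average t \<phi> \<tau>\<bar> \<le> M"
proof (cases "\<tau> < t")
  case True
  then have "\<bar>LBINT s:{\<tau>..t}. \<phi> s\<bar> \<le> M * (t - \<tau>)" using LBINT_abs_le[OF assms, of \<tau> t] by simp
  then show ?thesis using True by (simp add: past_average_def abs_mult field_simps)
next
  \<comment> \<open>For \<tau> beyond \<open>t\<close> the integral runs over the empty set, and for
    \<tau> = \<open>t\<close> the factor \<open>1 / 0\<close> is 0. The value 0 is what makes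
    averages bounded on the whole line.\<close>
  case False
  have "0 \<le> M" using assms(2)[of t] abs_ge_zero[of "\<phi> t"] by linarith
  moreover have "past_average t \<phi> \<tau> = 0"
    using False by (cases "\<tau> = t") (auto simp: past_average_def set_lebesgue_integral_def)
  ultimately show ?thesis by simp
qed

lemma bounded_past_average:
  "continuous_on {..t} \<phi> \<Longrightarrow> (\<And>s. s \<le> t \<Longrightarrow> \<bar>\<phi> s\<bar> \<le> M) \<Longrightarrow> bounded (range (past_average t \<phi>))"
  using abs_past_average_le[of t \<phi> M] by (intro boundedI[of _ M]) auto

lemma LBINT_split:
  fixes \<phi> :: "real \<Rightarrow> real"
  assumes \<phi>: "continuous_on {..t} \<phi>" and "a \<le> b" "b \<le> c" "c \<le> t"
  shows "(LBINT s:{a..c}. \<phi> s) = (LBINT s:{a..b}. \<phi> s) + (LBINT s:{b..c}. \<phi> s)"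
proof -
  have ae: "AE x in lborel. \<not> (x \<in> {a..b} \<and> x \<in> {b..c})"
    using AE_lborel_singleton[of b] by eventually_elim auto
  have "{a..c} = {a..b} \<union> {b..c}" using assms by auto
  then show ?thesis
    using set_integral_Un_AE[OF ae, of \<phi>] set_integrable_past[OF \<phi>] assms by simp
qed

lemma tendsto_const_over_past: "((\<lambda>\<tau>. c / (t - \<tau>)) \<longlongrightarrow> (0::real)) at_bot"
proof (rule tendsto_divide_0[OF tendsto_const])
  have "LIM \<tau> at_bot. t + - \<tau> :> at_top"
    by (rule filterlim_tendsto_add_at_top[OF tendsto_const filterlim_uminus_at_top_at_bot])
  then show "LIM \<tau> at_bot. t - \<tau> :> at_infinity"
    by (auto intro: filterlim_at_top_imp_at_infinity)
qed

text \<open>With \<open>A\<close> the average up to \<open>s\<close> and \<open>B\<close> the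
  integral over \<open>{s..t}\<close>, the difference is
  \<open>(B - (t - s) * A) / (t - \<tau>)\<close>. The numerator is at most
  \<open>2 * M * (t - s)\<close>, while the denominator tends to infinity.\<close>

lemma past_average_change_end:
  assumes \<phi>: "continuous_on {..t} \<phi>" and M: "\<And>s. s \<le> t \<Longrightarrow> \<bar>\<phi> s\<bar> \<le> M" and "s \<le> t"
  shows "((\<lambda>\<tau>. past_average t \<phi> \<tau> - past_average s \<phi> \<tau>) \<longlongrightarrow> 0) at_bot"
proof (rule Lim_null_comparison)
  have \<phi>s: "continuous_on {..s} \<phi>" using \<phi> by (rule continuous_on_subset) (use \<open>s \<le> t\<close> in auto)
  show "((\<lambda>\<tau>. 2 * M * (t - s) / (t - \<tau>)) \<longlongrightarrow> 0) at_bot" by (rule tendsto_const_over_past)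
  show "\<forall>\<^sub>F \<tau> in at_bot. norm (past_average t \<phi> \<tau> - past_average s \<phi> \<tau>) \<le> 2 * M * (t - s) / (t - \<tau>)"
    using eventually_gt_at_bot[of s]
  proof eventually_elim
    case (elim \<tau>)
    define A B where "A = past_average s \<phi> \<tau>" and "B = (LBINT s:{s..t}. \<phi> s)"
    have A: "\<bar>A\<bar> \<le> M" unfolding A_def using M \<open>s \<le> t\<close> by (intro abs_past_average_le \<phi>s) auto
    have B: "\<bar>B\<bar> \<le> M * (t - s)" unfolding B_def using LBINT_abs_le[OF \<phi> M \<open>s \<le> t\<close>] by simp
    have "(LBINT s:{\<tau>..t}. \<phi> s) = (s - \<tau>) * A + B"
      using LBINT_split[OF \<phi>, of \<tau> s t] elim \<open>s \<le> t\<close> by (simp add: A_def B_def past_average_def)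
    then have "past_average t \<phi> \<tau> - A = ((s - \<tau>) * A + B) / (t - \<tau>) - A"
      by (simp add: past_average_def)
    also have "\<dots> = (B - (t - s) * A) / (t - \<tau>)"
      using elim \<open>s \<le> t\<close> by (simp add: field_simps)
    finally have "norm (past_average t \<phi> \<tau> - A) = \<bar>B - (t - s) * A\<bar> / (t - \<tau>)"
      using elim \<open>s \<le> t\<close> by simp
    also have "\<dots> \<le> 2 * M * (t - s) / (t - \<tau>)"
    proof (rule divide_right_mono)
      have "\<bar>(t - s) * A\<bar> \<le> (t - s) * M"
        using A \<open>s \<le> t\<close> by (simp add: abs_mult mult_left_mono)
      then show "\<bar>B - (t - s) * A\<bar> \<le> 2 * M * (t - s)" using B by (simp add: algebra_simps abs_le_iff)
    qed (use elim \<open>s \<le> t\<close> in simp)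
    finally show ?case by (simp add: A_def)
  qed
qed

text \<open>The Cesaro argument: move the end point so far back that the function is below
  \<open>e / 2\<close> throughout, which changes the average only by a null function of
  \<tau>.\<close>

lemma past_average_null:
  assumes \<phi>: "continuous_on {..t} \<phi>" and M: "\<And>s. s \<le> t \<Longrightarrow> \<bar>\<phi> s\<bar> \<le> M" and null: "(\<phi> \<longlongrightarrow> 0) at_bot"
  shows "(past_average t \<phi> \<longlongrightarrow> 0) at_bot"
proof (rule tendstoI)
  fix e :: real assume e: "0 < e"
  then have "\<forall>\<^sub>F s in at_bot. dist (\<phi> s) 0 < e / 2" using tendstoD[OF null, of "e / 2"] by simp
  then obtain S0 where S0: "\<And>s. s \<le> S0 \<Longrightarrow> \<bar>\<phi> s\<bar> < e / 2" unfolding eventually_at_bot_linorder by auto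
  define S where "S = min S0 t"
  have \<phi>S: "continuous_on {..S} \<phi>" using \<phi> by (rule continuous_on_subset) (auto simp: S_def)
  have S: "\<bar>past_average S \<phi> \<tau>\<bar> \<le> e / 2" for \<tau>
    using S0 by (intro abs_past_average_le \<phi>S) (auto simp: S_def intro: less_imp_le)
  have "((\<lambda>\<tau>. past_average t \<phi> \<tau> - past_average S \<phi> \<tau>) \<longlongrightarrow> 0) at_bot"
    by (rule past_average_change_end[OF \<phi> M]) (auto simp: S_def)
  then have "\<forall>\<^sub>F \<tau> in at_bot. dist (past_average t \<phi> \<tau> - past_average S \<phi> \<tau>) 0 < e / 2"
    using e by (intro tendstoD) auto
  then show "\<forall>\<^sub>F \<tau> in at_bot. dist (past_average t \<phi> \<tau>) 0 < e"
  proof eventually_elim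
    case (elim \<tau>)
    then show ?case using S[of \<tau>] unfolding dist_real_def diff_0_right by linarith
  qed
qed

text \<open>A continuous function need not be uniformly continuous, but close to a compact set it is
  uniformly close to its values there. A sequence of counterexamples has near points in
  \<open>K\<close>, and a convergent subsequence of those contradicts continuity at the
  limit.\<close>

lemma continuous_near_compact:
  fixes f :: "'a::metric_space \<Rightarrow> real" and K :: "'a set"
  assumes f: "continuous_on UNIV f" and K: "compact K" "K \<noteq> {}" and e: "0 < e"
  shows "\<exists>\<delta>>0. \<forall>y. infdist y K < \<delta> \<longrightarrow> (\<exists>c\<in>K. \<bar>f y - f c\<bar> < e)"
proof (rule ccontr)
  assume "\<not> ?thesis"
  then have "\<exists>y. infdist y K < 1 / Suc n \<and> (\<forall>c\<in>K. e \<le> \<bar>f y - f c\<bar>)" for n :: nat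
    by (metis not_less of_nat_0_less_iff zero_less_Suc zero_less_divide_1_iff)
  then obtain y where y: "\<And>n::nat. infdist (y n) K < 1 / Suc n" "\<And>n c. c \<in> K \<Longrightarrow> e \<le> \<bar>f (y n) - f c\<bar>"
    by metis
  have "\<exists>c\<in>K. dist (y n) c < 1 / Suc n" for n
    using y(1)[of n] K(2) unfolding infdist_notempty[OF K(2)]
    by (subst (asm) cINF_less_iff) (auto intro: bdd_belowI[of _ 0])
  then obtain c where c: "\<And>n. c n \<in> K" "\<And>n. dist (y n) (c n) < 1 / Suc n" by metis
  obtain l r where lr: "l \<in> K" "strict_mono (r :: nat \<Rightarrow> nat)" "(c \<circ> r) \<longlonglongrightarrow> l"
    using K(1) c(1) unfolding compact_def by metis
  have "(\<lambda>n. dist (y n) (c n)) \<longlonglongrightarrow> 0"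
  proof (rule Lim_null_comparison)
    show "(\<lambda>n. 1 / real (Suc n)) \<longlonglongrightarrow> 0" using LIMSEQ_inverse_real_of_nat by (simp add: inverse_eq_divide)
    show "\<forall>\<^sub>F n in sequentially. norm (dist (y n) (c n)) \<le> 1 / real (Suc n)"
      using c(2) by (intro always_eventually allI) (simp add: less_imp_le)
  qed
  then have "(\<lambda>n. dist (y (r n)) (c (r n))) \<longlonglongrightarrow> 0"
    using LIMSEQ_subseq_LIMSEQ[OF _ lr(2)] by (force simp: o_def)
  moreover have "(\<lambda>n. dist (c (r n)) l) \<longlonglongrightarrow> 0" using lr(3) tendsto_dist_iff[of "c \<circ> r"] by (simp add: o_def)
  ultimately have "(\<lambda>n. dist (y (r n)) (c (r n)) + dist (c (r n)) l) \<longlonglongrightarrow> 0"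
    using tendsto_add by fastforce
  then have "(\<lambda>n. dist (y (r n)) l) \<longlonglongrightarrow> 0"
    by (rule Lim_null_comparison[rotated]) (intro always_eventually allI, simp add: dist_triangle)
  then have "(\<lambda>n. y (r n)) \<longlonglongrightarrow> l" using tendsto_dist_iff[of "\<lambda>n. y (r n)"] by simp
  then have "(\<lambda>n. f (y (r n))) \<longlonglongrightarrow> f l"
    using f by (intro isCont_tendsto_compose[of l f]) (auto simp: continuous_on_eq_continuous_at)
  then have "\<forall>\<^sub>F n in sequentially. dist (f (y (r n))) (f l) < e" by (rule tendstoD[OF _ e])
  then obtain n where "dist (f (y (r n))) (f l) < e" by (auto simp: eventually_sequentially)
  then show False using y(2)[OF lr(1), of "r n"] by (simp add: dist_real_def)
qed

text \<open>Here \<open>U t s\<close> carries a state from time \<open>s\<close> to time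
  \<open>t\<close>. Compactness is required at every \<open>t\<close>; the probabilistic work
  consists in showing that almost every path provides it.\<close>

locale pullback_process =
  fixes U :: "real \<Rightarrow> real \<Rightarrow> 'a::metric_space \<Rightarrow> 'a" and K :: "real \<Rightarrow> 'a set"
    and \<xi> :: "real \<Rightarrow> 'a" and L :: "(real \<Rightarrow> real) \<Rightarrow> real"
  assumes K: "compact (K t)" "K t \<noteq> {}"
    and flow: "r \<le> s \<Longrightarrow> s \<le> t \<Longrightarrow> U t s (U s r x) = U t r x"
    and continuous_state: "s \<le> t \<Longrightarrow> continuous_on UNIV (U t s)"
    and continuous_time: "continuous_on {..t} (\<lambda>s. U t s (\<xi> s))"
    and attraction: "((\<lambda>s. infdist (U t s (\<xi> s)) (K t)) \<longlongrightarrow> 0) at_bot"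
    and L: "generalized_Banach_limit L"
begin

lemma continuous_observable:
  "continuous_on UNIV f \<Longrightarrow> continuous_on {..t} (\<lambda>s. f (U t s (\<xi> s)))"
  by (rule continuous_on_compose2[of UNIV f, OF _ continuous_time]) auto

lemma eventually_near:
  fixes f :: "'a \<Rightarrow> real"
  assumes "continuous_on UNIV f" "0 < e"
  shows "\<forall>\<^sub>F s in at_bot. \<exists>c\<in>K t. \<bar>f (U t s (\<xi> s)) - f c\<bar> < e"
proof -
  obtain \<delta> where \<delta>: "0 < \<delta>" "\<And>y. infdist y (K t) < \<delta> \<Longrightarrow> \<exists>c\<in>K t. \<bar>f y - f c\<bar> < e"
    using continuous_near_compact[OF assms(1) K[of t] assms(2)] by blast
  have "\<forall>\<^sub>F s in at_bot. dist (infdist (U t s (\<xi> s)) (K t)) 0 < \<delta>"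
    by (rule tendstoD[OF attraction \<delta>(1)])
  then show ?thesis by eventually_elim (use \<delta>(2) in auto)
qed

text \<open>Although \<open>f\<close> may be unbounded, far in the past the values are within 1 of
  those on the compact set \<open>K t\<close>, and the remaining initial times form a compact
  interval.\<close>

lemma bounded_observable:
  fixes f :: "'a \<Rightarrow> real"
  assumes f: "continuous_on UNIV f"
  shows "\<exists>M. \<forall>s\<le>t. \<bar>f (U t s (\<xi> s))\<bar> \<le> M"
proof -
  have "bounded (f ` K t)"
    by (intro compact_imp_bounded compact_continuous_image continuous_on_subset[OF f] K) auto
  then obtain B where B: "\<And>c. c \<in> K t \<Longrightarrow> \<bar>f c\<bar> \<le> B" unfolding bounded_iff by auto
  obtain S where S: "\<And>s. s \<le> S \<Longrightarrow> \<exists>c\<in>K t. \<bar>f (U t s (\<xi> s)) - f c\<bar> < 1"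
    using eventually_near[OF f, of 1 t] unfolding eventually_at_bot_linorder by auto
  have "bounded ((\<lambda>s. f (U t s (\<xi> s))) ` {S..t})"
    by (intro compact_imp_bounded compact_continuous_image continuous_on_subset[OF continuous_observable[OF f]]) auto
  then obtain B' where "\<forall>y\<in>(\<lambda>s. f (U t s (\<xi> s))) ` {S..t}. norm y \<le> B'" unfolding bounded_iff by blast
  then have B': "\<bar>f (U t s (\<xi> s))\<bar> \<le> B'" if "s \<in> {S..t}" for s using that by simp
  have "\<bar>f (U t s (\<xi> s))\<bar> \<le> max (B + 1) B'" if "s \<le> t" for s
  proof (cases "s \<le> S")
    case True
    then obtain c where "c \<in> K t" "\<bar>f (U t s (\<xi> s)) - f c\<bar> < 1" using S by blast
    then show ?thesis using B[of c] by linarith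
  next
    case False
    then show ?thesis using B'[of s] that by simp
  qed
  then show ?thesis by blast
qed

lemma observable_null:
  fixes f :: "'a \<Rightarrow> real"
  assumes f: "continuous_on UNIV f" and 0: "\<And>c. c \<in> K t \<Longrightarrow> f c = 0"
  shows "((\<lambda>s. f (U t s (\<xi> s))) \<longlongrightarrow> 0) at_bot"
proof (rule tendstoI)
  fix e :: real assume "0 < e"
  show "\<forall>\<^sub>F s in at_bot. dist (f (U t s (\<xi> s))) 0 < e"
    using eventually_near[OF f, of e t, OF \<open>0 < e\<close>] by eventually_elim (use 0 in auto)
qed

definition mean :: "real \<Rightarrow> ('a \<Rightarrow> real) \<Rightarrow> real" where
  "mean t f = L (past_average t (\<lambda>s. f (U t s (\<xi> s))))"

lemma bounded_average:
  "continuous_on UNIV f \<Longrightarrow> bounded (range (past_average t (\<lambda>s. f (U t s (\<xi> s)))))"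
  using bounded_observable[of f t] by (auto intro: bounded_past_average[OF continuous_observable])

lemma mean_add:
  "continuous_on UNIV f \<Longrightarrow> continuous_on UNIV g \<Longrightarrow> mean t (\<lambda>x. f x + g x) = mean t f + mean t g"
proof -
  assume f: "continuous_on UNIV f" and g: "continuous_on UNIV g"
  have "past_average t (\<lambda>s. f (U t s (\<xi> s)) + g (U t s (\<xi> s)))
      = (\<lambda>\<tau>. past_average t (\<lambda>s. f (U t s (\<xi> s))) \<tau> + past_average t (\<lambda>s. g (U t s (\<xi> s))) \<tau>)"
    by (rule ext) (rule past_average_add[OF continuous_observable[OF f] continuous_observable[OF g]])
  then show ?thesis
    using generalized_Banach_limitD(1)[OF L bounded_average[OF f] bounded_average[OF g]] by (simp add: mean_def)
qed

lemma mean_scale: "continuous_on UNIV f \<Longrightarrow> mean t (\<lambda>x. c * f x) = c * mean t f"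
  using generalized_Banach_limitD(2)[OF L bounded_average, of f c t]
  by (simp add: mean_def past_average_scale[abs_def])

text \<open>A nonnegative observable on \<open>K t\<close> may be negative along the orbit, but its negative part
  tends to \<open>0\<close> there and so does not contribute to the mean.\<close>

lemma mean_nonneg:
  assumes f: "continuous_on UNIV f" and pos: "\<And>c. c \<in> K t \<Longrightarrow> 0 \<le> f c"
  shows "0 \<le> mean t f"
proof -
  define p m where "p x = max 0 (f x)" and "m x = max 0 (- f x)" for x
  have cp: "continuous_on UNIV p" and cm: "continuous_on UNIV m"
    unfolding p_def[abs_def] m_def[abs_def] by (intro continuous_intros f)+
  obtain M where M: "\<And>s. s \<le> t \<Longrightarrow> \<bar>m (U t s (\<xi> s))\<bar> \<le> M" using bounded_observable[OF cm] by blast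
  have "m c = 0" if "c \<in> K t" for c using pos[OF that] by (simp add: m_def)
  then have "((\<lambda>s. m (U t s (\<xi> s))) \<longlongrightarrow> 0) at_bot" by (rule observable_null[OF cm])
  then have "mean t m = 0"
    unfolding mean_def
    by (intro generalized_Banach_limitD(4)[OF L bounded_average[OF cm]]
        past_average_null[OF continuous_observable[OF cm] M])
  moreover have "0 \<le> mean t p"
    unfolding mean_def
    by (intro generalized_Banach_limitD(3)[OF L bounded_average[OF cp]] past_average_nonneg) (simp add: p_def)
  moreover have "mean t p = mean t f + mean t m"
  proof -
    have "p = (\<lambda>x. f x + m x)" by (auto simp: p_def m_def fun_eq_iff)
    then show ?thesis using mean_add[OF f cm] by simp
  qed
  ultimately show ?thesis by simp
qed

lemma past_average_const_tendsto: "(past_average t (\<lambda>_. c) \<longlongrightarrow> c) at_bot"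
proof (rule tendsto_eventually)
  show "\<forall>\<^sub>F \<tau> in at_bot. past_average t (\<lambda>_. c) \<tau> = c"
    using eventually_gt_at_bot[of t] by eventually_elim (simp add: past_average_def set_lebesgue_integral_def)
qed

lemma L_past_average_const: "L (past_average t (\<lambda>_. c)) = c"
  by (rule generalized_Banach_limitD(4)[OF L _ past_average_const_tendsto])
    (rule bounded_past_average[of _ _ "\<bar>c\<bar>"], auto)

text \<open>By the flow property both means average the same function of the initial time; only the
  end points of the averages differ, and the generalized limit does not see this.\<close>

lemma mean_invariant:
  assumes f: "continuous_on UNIV f" and st: "s \<le> t"
  shows "mean s (\<lambda>x. f (U t s x)) = mean t f"
proof -
  define \<phi> where "\<phi> r = f (U t r (\<xi> r))" for r
  have \<phi>: "continuous_on {..t} \<phi>" unfolding \<phi>_def[abs_def] by (rule continuous_observable[OF f])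
  obtain M where M: "\<And>r. r \<le> t \<Longrightarrow> \<bar>\<phi> r\<bar> \<le> M" unfolding \<phi>_def using bounded_observable[OF f] by blast
  have \<phi>s: "continuous_on {..s} \<phi>" using \<phi> by (rule continuous_on_subset) (use st in auto)
  have bs: "bounded (range (past_average s \<phi>))" by (rule bounded_past_average[OF \<phi>s M]) (use st in simp)
  have bt: "bounded (range (past_average t \<phi>))" by (rule bounded_past_average[OF \<phi> M])
  have "mean s (\<lambda>x. f (U t s x)) = L (past_average s \<phi>)"
    unfolding mean_def \<phi>_def using flow st by (intro arg_cong[where f = L] past_average_cong) auto
  moreover have "L (past_average t \<phi>) = L (past_average s \<phi>)"
  proof -
    define d where "d \<tau> = past_average t \<phi> \<tau> - past_average s \<phi> \<tau>" for \<tau>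
    have bd: "bounded (range d)" unfolding d_def by (rule bounded_minus_comp[OF bt bs])
    have "L d = 0"
      by (rule generalized_Banach_limitD(4)[OF L bd])
        (unfold d_def, rule past_average_change_end[OF \<phi> M st])
    then show ?thesis using generalized_Banach_limitD(1)[OF L bs bd] by (simp add: d_def)
  qed
  ultimately show ?thesis by (simp add: mean_def \<phi>_def[abs_def])
qed

theorem invariant_measures:
  "\<exists>\<mu> :: real \<Rightarrow> 'a measure.
    (\<forall>t. prob_space (\<mu> t) \<and> sets (\<mu> t) = sets borel \<and> (AE x in \<mu> t. x \<in> K t)) \<and>
    (\<forall>t f. continuous_on UNIV f \<longrightarrow>
       L (past_average t (\<lambda>s. f (U t s (\<xi> s)))) = integral\<^sup>L (\<mu> t) f \<and>
       (\<forall>s\<le>t. (\<integral>x. f (U t s x) \<partial>\<mu> s) = integral\<^sup>L (\<mu> t) f) \<and>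
       L (past_average t (\<lambda>s. \<integral>x. f (U t s x) \<partial>\<mu> s)) = integral\<^sup>L (\<mu> t) f)"
proof -
  have "\<exists>\<mu>. prob_space \<mu> \<and> sets \<mu> = sets borel \<and> (AE x in \<mu>. x \<in> K t) \<and>
    (\<forall>f. continuous_on UNIV f \<longrightarrow> integrable \<mu> f \<and> integral\<^sup>L \<mu> f = mean t f)" for t
  proof -
    have "mean t (\<lambda>_. 1) = 1" by (simp add: mean_def L_past_average_const)
    then interpret compact_positive_functional "K t" "mean t"
      by unfold_locales (auto simp: K mean_add mean_scale mean_nonneg)
    show ?thesis by (rule representing_measure)
  qed
  then obtain \<mu> where \<mu>: "\<And>t. prob_space (\<mu> t)" "\<And>t. sets (\<mu> t) = sets borel" "\<And>t. AE x in \<mu> t. x \<in> K t"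
    "\<And>t f. continuous_on UNIV f \<Longrightarrow> integral\<^sup>L (\<mu> t) f = mean t f"
    by metis
  have inv: "(\<integral>x. f (U t s x) \<partial>\<mu> s) = integral\<^sup>L (\<mu> t) f" if f: "continuous_on UNIV f" and "s \<le> t"
    for f :: "'a \<Rightarrow> real" and s t
  proof -
    have "continuous_on UNIV (\<lambda>x. f (U t s x))"
      by (rule continuous_on_compose2[OF f continuous_state[OF \<open>s \<le> t\<close>]]) auto
    then show ?thesis using \<mu>(4) f mean_invariant[OF f \<open>s \<le> t\<close>] by simp
  qed
  have avg: "L (past_average t (\<lambda>s. \<integral>x. f (U t s x) \<partial>\<mu> s)) = integral\<^sup>L (\<mu> t) f"
    if f: "continuous_on UNIV f" for f :: "'a \<Rightarrow> real" and t
  proof -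
    \<comment> \<open>By invariance the inner integral does not depend on \<open>s\<close>, so the
      second average in the claim is that of a constant.\<close>
    have "past_average t (\<lambda>s. \<integral>x. f (U t s x) \<partial>\<mu> s) = past_average t (\<lambda>_. integral\<^sup>L (\<mu> t) f)"
      by (rule past_average_cong) (rule inv[OF f])
    then show ?thesis by (simp add: L_past_average_const)
  qed
  show ?thesis
    using \<mu> inv avg by (intro exI[of _ \<mu>]) (simp add: mean_def)
qed

end

section \<open>The stochastic lattice system\<close>

lemma path_shift_path_shift: "path_shift a (path_shift b \<omega>) = path_shift (a + b) \<omega>"
  by (simp add: path_shift_def fun_eq_iff add.assoc)

lemma path_shift_0: "\<omega> \<in> paths \<Longrightarrow> path_shift 0 \<omega> = \<omega>"
  by (simp add: path_shift_def paths_def)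

text \<open>The shift by \<open>- s\<close> inside \<open>cocycle\<close> undoes the shift by
  \<open>s\<close>, so along an orbit every state belongs to the single path \<omega>.\<close>

lemma cocycle_along_orbit:
  "\<omega> \<in> paths \<Longrightarrow> cocycle k h v (t - s) s (path_shift s \<omega>) x = sol_u k h v t s \<omega> x"
  by (simp add: cocycle_def path_shift_path_shift path_shift_0)

lemma tendsto_ennreal_0_imp:
  assumes "((\<lambda>x. ennreal (f x)) \<longlongrightarrow> 0) F" "\<And>x. 0 \<le> f x" shows "(f \<longlongrightarrow> 0) F"
proof -
  have "((\<lambda>x. enn2real (ennreal (f x))) \<longlongrightarrow> enn2real 0) F"
    by (rule tendsto_enn2real) (use assms(1) in simp_all)
  then show ?thesis using assms(2) by simp
qed

lemma measure_support_subset: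
  assumes "closed K" "sets \<mu> = sets borel" "AE x in \<mu>. x \<in> K" shows "measure_support \<mu> \<subseteq> K"
proof
  fix x assume x: "x \<in> measure_support \<mu>"
  show "x \<in> K"
  proof (rule ccontr)
    assume "x \<notin> K"
    then have "0 < emeasure \<mu> (- K)"
      using x \<open>closed K\<close> unfolding measure_support_def by (simp add: open_Compl)
    moreover have "emeasure \<mu> (- K) = 0"
    proof -
      have "- K \<in> sets \<mu>" using assms(1,2) by simp
      moreover have "{x \<in> space \<mu>. x \<notin> K} = - K"
        using sets_eq_imp_space_eq[OF assms(2)] by auto
      ultimately show ?thesis using AE_iff_measurable[of "- K" \<mu> "\<lambda>x. x \<in> K"] assms(3) by simp
    qed
    ultimately show False by simp
  qed
qed

lemma set_integral_eq_integral_AE: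
  fixes f :: "ell2 \<Rightarrow> real"
  assumes "closed K" "sets \<mu> = sets borel" "AE x in \<mu>. x \<in> K" "continuous_on UNIV f"
  shows "(LINT x:K|\<mu>. f x) = integral\<^sup>L \<mu> f"
proof -
  have [measurable]: "f \<in> borel_measurable \<mu>" "K \<in> sets \<mu>"
    using assms by (simp_all add: borel_measurable_continuous_onI cong: measurable_cong_sets)
  show ?thesis
    unfolding set_lebesgue_integral_def
    by (rule integral_cong_AE) (use assms(3) in \<open>auto elim!: eventually_mono\<close>)
qed

text \<open>At each time \<open>sol_u\<close> is conjugate to \<open>v\<close> by an invertible
  affine map of the state. At an intermediate time the map and its inverse cancel, and continuity is
  inherited since the coefficients are continuous in time.\<close>

lemma flow_sol_u:
  assumes G: "one_sided_lipschitz_flow G (\<lambda>t s x. v t s \<omega> x)"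
    and h: "continuous_on UNIV h" and z: "continuous_on UNIV (\<lambda>t. zOU (path_shift t \<omega>))"
  shows "r \<le> s \<Longrightarrow> s \<le> t \<Longrightarrow> sol_u k h v t s \<omega> (sol_u k h v s r \<omega> x) = sol_u k h v t r \<omega> x"
    and "s \<le> t \<Longrightarrow> continuous_on UNIV (sol_u k h v t s \<omega>)"
    and "continuous_on {..t} \<xi> \<Longrightarrow> continuous_on {..t} (\<lambda>s. sol_u k h v t s \<omega> (\<xi> s))"
proof -
  interpret one_sided_lipschitz_flow G "\<lambda>t s x. v t s \<omega> x" by (rule G)
  have cancel: "exp (- k * c) *\<^sub>R (exp (k * c) *\<^sub>R y) = y" for c and y :: ell2
    by (simp add: exp_add[symmetric])
  show "sol_u k h v t s \<omega> (sol_u k h v s r \<omega> x) = sol_u k h v t r \<omega> x" if "r \<le> s" "s \<le> t"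
    unfolding sol_u_def using flow[OF that] by (simp only: diff_add_cancel cancel)
  show "continuous_on UNIV (sol_u k h v t s \<omega>)" if "s \<le> t"
    unfolding sol_u_def
    by (intro continuous_intros continuous_on_compose2[OF continuous_state[OF that]]) auto
  show "continuous_on {..t} (\<lambda>s. sol_u k h v t s \<omega> (\<xi> s))" if "continuous_on {..t} \<xi>"
    unfolding sol_u_def
    by (intro continuous_on_diff continuous_on_scaleR continuous_on_const continuous_initial_time
        continuous_on_add continuous_on_exp continuous_on_mult that
        continuous_on_subset[OF h subset_UNIV] continuous_on_subset[OF z subset_UNIV])
qed

theorem theorem3p11:
  fixes lam lam0 lam1 k q eps beta :: real
    and f :: "int \<Rightarrow> real \<Rightarrow> real" and \<alpha>\<^sub>1 \<alpha>\<^sub>2 :: "int \<Rightarrow> real" and \<gamma> :: "real \<Rightarrow> real"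
    and g :: "real \<Rightarrow> int \<Rightarrow> real \<Rightarrow> real" and \<psi>\<^sub>1 \<psi>\<^sub>2 \<psi>\<^sub>3 \<psi>\<^sub>4 :: "real \<Rightarrow> int \<Rightarrow> real"
    and h h' :: "real \<Rightarrow> ell2"
    and P :: "(real \<Rightarrow> real) measure" and \<Omega> :: "(real \<Rightarrow> real) set"
    and v :: "real \<Rightarrow> real \<Rightarrow> (real \<Rightarrow> real) \<Rightarrow> ell2 \<Rightarrow> ell2"
    and \<A> :: "real \<Rightarrow> (real \<Rightarrow> real) \<Rightarrow> ell2 set"
    and LIM_bot :: "(real \<Rightarrow> real) \<Rightarrow> real"
    and \<xi> :: "real \<Rightarrow> (real \<Rightarrow> real) \<Rightarrow> ell2"
  defines "\<phi> \<equiv> cocycle k h v"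
    and "\<D> \<equiv> tempered P \<Omega> lam0 k"
  assumes params: "0 < lam" "0 < k" "0 < lam1" "lam1 < lam0" "lam0 < lam"
    and prob: "wiener_measure P" "admissible_paths P \<Omega>"
    and F_params: "2 < q" "0 < eps" "0 < q - 1 - eps" "\<alpha>\<^sub>1 \<in> ell 1" "\<alpha>\<^sub>2 \<in> ell 1"
    and F_maps: "\<And>u. u \<in> ell 2 \<Longrightarrow> (\<lambda>i. f i (u i)) \<in> ell 2"
    and F_loc_lip: "\<And>u. \<exists>r>0. \<exists>C. C-lipschitz_on (ball u r) (nemytskii f)"
    and F_gamma: "\<And>R. 0 \<le> R \<Longrightarrow> 0 \<le> \<gamma> R" "\<And>M. bounded (\<gamma> ` {0..M})"
    and F_lip: "\<And>i R a b. 0 \<le> R \<Longrightarrow> \<bar>a\<bar> \<le> R \<Longrightarrow> \<bar>b\<bar> \<le> R \<Longrightarrow> \<bar>f i a - f i b\<bar> \<le> \<gamma> R * \<bar>a - b\<bar>"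
    and F_growth: "\<And>i a. \<bar>f i a\<bar> \<le> \<alpha>\<^sub>1 i * \<bar>a\<bar> powr (q - 1 - eps) + \<alpha>\<^sub>2 i"
    and G1_cont: "\<And>i. continuous_on UNIV (\<lambda>(t, a). g t i a)"
    and G1_diff: "\<And>t i a. g t i differentiable (at a)"
    and G1_beta: "0 < beta"
    and G1_diss: "\<And>t i a. g t i a * a \<le> - beta * \<bar>a\<bar> powr q + \<psi>\<^sub>1 t i"
    and G1_deriv: "\<And>t i a. deriv (g t i) a \<le> \<psi>\<^sub>2 t i"
    and G1_growth: "\<And>t i a. \<bar>g t i a\<bar> \<le> \<psi>\<^sub>3 t i * \<bar>a\<bar> powr (q - 1) + \<psi>\<^sub>4 t i"
    and G1_spaces: "\<psi>\<^sub>1 \<in> bochner_L_loc 1 1" "\<psi>\<^sub>2 \<in> bochner_L_loc \<infinity> \<infinity>"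
      "\<psi>\<^sub>3 \<in> bochner_L_loc \<infinity> \<infinity>" "\<psi>\<^sub>4 \<in> bochner_L_loc 2 2"
    and G2: "integrable (lebesgue_on {..0})
        (\<lambda>s. exp (lam1 * s) * (ell_norm 1 (\<psi>\<^sub>1 s) + (ell_norm 2 (\<psi>\<^sub>4 s))\<^sup>2))"
      "\<psi>\<^sub>3 \<in> bochner_L \<infinity> {..0} \<infinity>"
    and H1_diff: "\<And>t. (h has_vector_derivative h' t) (at t)"
    and H1_spaces: "\<And>t. coord (h t) \<in> ell q" "(\<lambda>t. coord (h t)) \<in> bochner_L_loc 2 2"
      "(\<lambda>t. coord (h t)) \<in> bochner_L_loc q q" "(\<lambda>t. coord (h' t)) \<in> bochner_L_loc 2 2"
    and H2: "integrable (lebesgue_on {..0})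
        (\<lambda>s. exp (lam1 * s) * ((norm (h s))\<^sup>2 + ell_norm q (coord (h s)) powr q + (norm (h' s))\<^sup>2))"
    and v_sol: "\<And>\<tau> \<omega> v\<^sub>\<tau>. \<omega> \<in> \<Omega> \<Longrightarrow>
        solves_ivp (\<lambda>t. rhsF lam k f g h h' t \<omega>) \<tau> v\<^sub>\<tau> (\<lambda>t. v t \<tau> \<omega> v\<^sub>\<tau>)"
    and attractor: "pullback_attractor P \<Omega> \<D> \<phi> \<A>"
    and LIM: "generalized_Banach_limit LIM_bot"
    and xi_D: "(\<lambda>\<tau> \<omega>. {\<xi> \<tau> \<omega>}) \<in> \<D>"
    and xi_cont: "\<And>\<omega>. \<omega> \<in> \<Omega> \<Longrightarrow> continuous_on UNIV (\<lambda>\<tau>. \<xi> \<tau> (path_shift \<tau> \<omega>))"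
  shows "\<exists>\<mu> :: real \<Rightarrow> (real \<Rightarrow> real) \<Rightarrow> ell2 measure.
      (\<forall>\<tau>. \<forall>\<omega>\<in>\<Omega>. prob_space (\<mu> \<tau> \<omega>) \<and> sets (\<mu> \<tau> \<omega>) = sets borel \<and>
          measure_support (\<mu> \<tau> \<omega>) \<subseteq> \<A> \<tau> \<omega>) \<and>
      (\<forall>\<Upsilon> :: ell2 \<Rightarrow> real. continuous_on UNIV \<Upsilon> \<longrightarrow> (\<forall>t. AE \<omega> in P. \<omega> \<in> \<Omega> \<longrightarrow>
          LIM_bot (\<lambda>\<tau>. 1 / (t - \<tau>) *
              (LBINT s:{\<tau>..t}. \<Upsilon> (\<phi> (t - s) s (path_shift s \<omega>) (\<xi> s (path_shift s \<omega>)))))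
            = (LINT u:\<A> t (path_shift t \<omega>)|\<mu> t (path_shift t \<omega>). \<Upsilon> u) \<and>
          (LINT u:\<A> t (path_shift t \<omega>)|\<mu> t (path_shift t \<omega>). \<Upsilon> u) = (LINT u|\<mu> t (path_shift t \<omega>). \<Upsilon> u) \<and>
          (LINT u|\<mu> t (path_shift t \<omega>). \<Upsilon> u)
            = LIM_bot (\<lambda>\<tau>. 1 / (t - \<tau>) *
              (LBINT s:{\<tau>..t}. (LINT u|\<mu> s (path_shift s \<omega>). \<Upsilon> (\<phi> (t - s) s (path_shift s \<omega>) u)))))) \<and>
      (\<forall>\<tau>. AE \<omega> in P. \<omega> \<in> \<Omega> \<longrightarrow>
          (\<forall>\<Upsilon> :: ell2 \<Rightarrow> real. continuous_on UNIV \<Upsilon> \<longrightarrow> (\<forall>t\<ge>0.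
            (LINT u:\<A> (\<tau> + t) (path_shift t \<omega>)|\<mu> (\<tau> + t) (path_shift t \<omega>). \<Upsilon> u)
              = (LINT u:\<A> \<tau> \<omega>|\<mu> \<tau> \<omega>. \<Upsilon> (\<phi> t \<tau> \<omega> u)))))"
proof -
  have \<Omega>: "path_shift t \<omega> \<in> \<Omega>" and z_cont: "continuous_on UNIV (\<lambda>t. zOU (path_shift t \<omega>))"
    if "\<omega> \<in> \<Omega>" for t \<omega>
    using prob(2) that unfolding admissible_paths_def by auto
  have "\<Omega> \<in> sets P" "space P = paths" and AE_\<Omega>: "AE \<omega> in P. \<omega> \<in> \<Omega>"
    using prob unfolding admissible_paths_def wiener_measure_def by auto
  then have paths: "\<omega> \<in> paths" if "\<omega> \<in> \<Omega>" for \<omega> using sets.sets_into_space that by blast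
  have h_cont: "continuous_on UNIV h"
    using H1_diff by (auto intro!: continuous_at_imp_continuous_on has_vector_derivative_continuous)
  have flow: "one_sided_lipschitz_flow (\<lambda>t. rhsF lam k f g h h' t \<omega>) (\<lambda>t s x. v t s \<omega> x)" if \<omega>: "\<omega> \<in> \<Omega>" for \<omega>
  proof -
    interpret lattice_equation lam k q f \<gamma> g \<psi>\<^sub>2 \<psi>\<^sub>3 \<psi>\<^sub>4 h h' \<omega>
      by unfold_locales (fact params(2) F_params(1) F_maps F_gamma(1) F_lip G1_diff G1_deriv G1_growth
          G1_spaces(2-4) h_cont H1_spaces(4) z_cont[OF \<omega>])+
    show ?thesis
      by unfold_locales (fact v_sol[OF \<omega>] rhsF_one_sided rhsF_bound)+
  qed
  have sol_flow: "sol_u k h v t s \<omega> (sol_u k h v s r \<omega> x) = sol_u k h v t r \<omega> x"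
    if "\<omega> \<in> \<Omega>" "r \<le> s" "s \<le> t" for r s t \<omega> x
    using flow_sol_u(1)[where v = v and \<omega> = \<omega>, OF flow[OF that(1)] h_cont z_cont[OF that(1)] that(2,3)] .
  have sol_state: "continuous_on UNIV (sol_u k h v t s \<omega>)" if "\<omega> \<in> \<Omega>" "s \<le> t" for s t \<omega>
    using flow_sol_u(2)[where v = v and \<omega> = \<omega>, OF flow[OF that(1)] h_cont z_cont[OF that(1)] that(2)] .
  have sol_time: "continuous_on {..t} (\<lambda>s. sol_u k h v t s \<omega> (\<zeta> s))"
    if "\<omega> \<in> \<Omega>" "continuous_on {..t} \<zeta>" for t \<omega> \<zeta>
    using flow_sol_u(3)[where v = v and \<omega> = \<omega>, OF flow[OF that(1)] h_cont z_cont[OF that(1)] that(2)] .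
  have A_nonempty: "\<A> \<tau> \<omega> \<noteq> {}" if "\<omega> \<in> \<Omega>" for \<tau> \<omega>
    using attractor that unfolding pullback_attractor_def random_set_def by auto
  have A_compact: "AE \<omega> in P. \<omega> \<in> \<Omega> \<longrightarrow> compact (\<A> \<tau> \<omega>)" for \<tau>
    using attractor unfolding pullback_attractor_def by blast
  have A_invariant: "\<phi> t \<tau> \<omega> ` \<A> \<tau> \<omega> = \<A> (\<tau> + t) (path_shift t \<omega>)" if "\<omega> \<in> \<Omega>" "0 \<le> t" for t \<tau> \<omega>
    using attractor that unfolding pullback_attractor_def by blast
  note attracts = attractor[unfolded pullback_attractor_def, THEN conjunct2, THEN conjunct2, THEN conjunct2, THEN conjunct1]
  have A_attracts: "((\<lambda>t. semidist (\<phi> t (\<tau> - t) (path_shift (- t) \<omega>) ` {\<xi> (\<tau> - t) (path_shift (- t) \<omega>)}) (\<A> \<tau> \<omega>))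
      \<longlongrightarrow> 0) at_top" if "\<omega> \<in> \<Omega>" for \<tau> \<omega>
    using bspec[OF spec[OF bspec[OF attracts xi_D]] that] .

  define good where "good \<omega> \<longleftrightarrow> (\<forall>t. compact (\<A> t (path_shift t \<omega>)))" for \<omega>
  \<comment> \<open>Compactness propagates forward along an orbit, so countably many times suffice; invariance of
    \<open>P\<close> under the shifts keeps the exceptional sets null.\<close>
  have good_AE: "AE \<omega> in P. good \<omega>"
  proof -
    have "AE \<omega> in P. \<forall>n::nat. path_shift (- real n) \<omega> \<in> \<Omega> \<longrightarrow> compact (\<A> (- real n) (path_shift (- real n) \<omega>))"
      unfolding AE_all_countable by (intro allI AE_path_shift[OF prob(1) A_compact])
    then show ?thesis using AE_\<Omega>
    proof eventually_elim
      case (elim \<omega>)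
      have "compact (\<A> t (path_shift t \<omega>))" for t
      proof -
        obtain n :: nat where n: "- t \<le> real n" using real_arch_simple by blast
        let ?s = "- real n"
        have "\<phi> (t - ?s) ?s (path_shift ?s \<omega>) ` \<A> ?s (path_shift ?s \<omega>) = \<A> t (path_shift t \<omega>)"
          using A_invariant[OF \<Omega>[OF elim(2)], of "t - ?s" ?s ?s] n by (simp add: path_shift_path_shift)
        moreover have "\<phi> (t - ?s) ?s (path_shift ?s \<omega>) = sol_u k h v t ?s \<omega>"
          unfolding \<phi>_def using cocycle_along_orbit[OF paths[OF elim(2)]] by (intro ext)
        moreover have "continuous_on UNIV (sol_u k h v t ?s \<omega>)"
          by (rule sol_state[OF elim(2)]) (use n in simp)
        moreover have "compact (\<A> ?s (path_shift ?s \<omega>))" using elim(1) \<Omega>[OF elim(2)] by blast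
        ultimately show ?thesis by (metis compact_continuous_image continuous_on_subset subset_UNIV)
      qed
      then show ?case by (simp add: good_def)
    qed
  qed

  define invariant_family where "invariant_family \<omega> \<mu> \<longleftrightarrow>
    (\<forall>t. prob_space (\<mu> t) \<and> sets (\<mu> t) = sets borel \<and> (AE x in \<mu> t. x \<in> \<A> t (path_shift t \<omega>))) \<and>
    (\<forall>t (\<Upsilon> :: ell2 \<Rightarrow> real). continuous_on UNIV \<Upsilon> \<longrightarrow>
       LIM_bot (past_average t (\<lambda>s. \<Upsilon> (sol_u k h v t s \<omega> (\<xi> s (path_shift s \<omega>))))) = integral\<^sup>L (\<mu> t) \<Upsilon> \<and>
       (\<forall>s\<le>t. (\<integral>x. \<Upsilon> (sol_u k h v t s \<omega> x) \<partial>\<mu> s) = integral\<^sup>L (\<mu> t) \<Upsilon>) \<and>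
       LIM_bot (past_average t (\<lambda>s. \<integral>x. \<Upsilon> (sol_u k h v t s \<omega> x) \<partial>\<mu> s)) = integral\<^sup>L (\<mu> t) \<Upsilon>)"
    for \<omega> and \<mu> :: "real \<Rightarrow> ell2 measure"
  have "\<exists>\<mu>. invariant_family \<omega> \<mu>" if \<omega>: "\<omega> \<in> \<Omega>" and good: "good \<omega>" for \<omega>
  proof -
    have attr: "((\<lambda>s. infdist (sol_u k h v t s \<omega> (\<xi> s (path_shift s \<omega>))) (\<A> t (path_shift t \<omega>))) \<longlongrightarrow> 0) at_bot" for t
    proof (rule tendsto_ennreal_0_imp)
      define \<delta> where "\<delta> s = ennreal (infdist (sol_u k h v t s \<omega> (\<xi> s (path_shift s \<omega>))) (\<A> t (path_shift t \<omega>)))" for s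
      \<comment> \<open>Attraction is used in the fibre over \<open>path_shift t \<omega>\<close>:
        the elapsed time \<open>r\<close> corresponds to the initial time \<open>t - r\<close>, and
        the semidistance from a singleton is \<open>infdist\<close>.\<close>
      have eq: "semidist (\<phi> r (t - r) (path_shift (- r) (path_shift t \<omega>)) `
          {\<xi> (t - r) (path_shift (- r) (path_shift t \<omega>))}) (\<A> t (path_shift t \<omega>)) = \<delta> (t - r)" for r
        using cocycle_along_orbit[OF paths[OF \<omega>], of k h v t "t - r"]
        by (simp add: semidist_def \<delta>_def \<phi>_def path_shift_path_shift)
      have lim: "((\<lambda>r. \<delta> (t - r)) \<longlongrightarrow> 0) at_top"
        using A_attracts[OF \<Omega>[OF \<omega>], of t t] unfolding eq .
      have "LIM s at_bot. t + - s :> at_top"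
        by (rule filterlim_tendsto_add_at_top[OF tendsto_const filterlim_uminus_at_top_at_bot])
      from filterlim_compose[OF lim this]
      show "(\<delta> \<longlongrightarrow> 0) at_bot" by simp
    qed (rule infdist_nonneg)
    interpret pullback_process "\<lambda>t s. sol_u k h v t s \<omega>" "\<lambda>t. \<A> t (path_shift t \<omega>)"
      "\<lambda>s. \<xi> s (path_shift s \<omega>)" LIM_bot
    proof
      show "compact (\<A> t (path_shift t \<omega>))" for t using good by (simp add: good_def)
      show "\<A> t (path_shift t \<omega>) \<noteq> {}" for t by (rule A_nonempty[OF \<Omega>[OF \<omega>]])
      show "continuous_on {..t} (\<lambda>s. sol_u k h v t s \<omega> (\<xi> s (path_shift s \<omega>)))" for t
        by (intro sol_time[OF \<omega>] continuous_on_subset[OF xi_cont[OF \<omega>]]) auto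
    qed (use sol_flow[OF \<omega>] sol_state[OF \<omega>] attr LIM in blast)+
    show ?thesis unfolding invariant_family_def by (rule invariant_measures)
  qed
  then obtain M where M: "\<And>\<omega>. \<omega> \<in> \<Omega> \<Longrightarrow> good \<omega> \<Longrightarrow> invariant_family \<omega> (M \<omega>)" by metis
  \<comment> \<open>On the null set of bad orbits only the support condition is required, and a point mass in \<open>\<A>\<close>
    meets it.\<close>
  define \<mu> where "\<mu> \<tau> \<omega> = (if good (path_shift (- \<tau>) \<omega>) then M (path_shift (- \<tau>) \<omega>) \<tau>
      else return borel (SOME x. x \<in> \<A> \<tau> \<omega>))" for \<tau> \<omega>
  \<comment> \<open>The base path of \<open>(t, path_shift t \<omega>)\<close> is \<omega> itself,
    so all measures along one orbit come from one and the same choice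
    \<open>M \<omega>\<close>.\<close>
  have \<mu>_orbit: "\<mu> t (path_shift t \<omega>) = M \<omega> t" if "\<omega> \<in> \<Omega>" "good \<omega>" for t \<omega>
    using that by (simp add: \<mu>_def path_shift_path_shift path_shift_0 paths)
  have M_set: "(LINT u:\<A> t (path_shift t \<omega>)|M \<omega> t. \<Upsilon> u) = integral\<^sup>L (M \<omega> t) \<Upsilon>"
    if "\<omega> \<in> \<Omega>" "good \<omega>" "continuous_on UNIV \<Upsilon>" for \<omega> t and \<Upsilon> :: "ell2 \<Rightarrow> real"
    using M[OF that(1,2)] that(2,3)
    by (intro set_integral_eq_integral_AE) (auto simp: invariant_family_def good_def compact_imp_closed)
  show ?thesis
  proof (intro exI[of _ \<mu>] conjI allI ballI impI)
    fix \<tau> \<omega> assume \<omega>: "\<omega> \<in> \<Omega>"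
    define \<eta> where "\<eta> = path_shift (- \<tau>) \<omega>"
    have \<eta>: "\<eta> \<in> \<Omega>" "path_shift \<tau> \<eta> = \<omega>"
      using \<Omega>[OF \<omega>] by (simp_all add: \<eta>_def path_shift_path_shift path_shift_0 paths[OF \<omega>])
    have "prob_space (\<mu> \<tau> \<omega>) \<and> sets (\<mu> \<tau> \<omega>) = sets borel \<and> measure_support (\<mu> \<tau> \<omega>) \<subseteq> \<A> \<tau> \<omega>"
    proof (cases "good \<eta>")
      case True
      have "\<mu> \<tau> \<omega> = M \<eta> \<tau>" using \<mu>_orbit[OF \<eta>(1) True, of \<tau>] \<eta>(2) by simp
      moreover have "closed (\<A> \<tau> \<omega>)" using True \<eta>(2) unfolding good_def by (metis compact_imp_closed)
      moreover have "prob_space (M \<eta> \<tau>)" "sets (M \<eta> \<tau>) = sets borel" "AE x in M \<eta> \<tau>. x \<in> \<A> \<tau> \<omega>"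
        using M[OF \<eta>(1) True] \<eta>(2) unfolding invariant_family_def by auto
      ultimately show ?thesis using measure_support_subset by simp
    next
      case False
      define x where "x = (SOME x. x \<in> \<A> \<tau> \<omega>)"
      have x: "x \<in> \<A> \<tau> \<omega>" unfolding x_def using A_nonempty[OF \<omega>] by (simp add: some_in_eq)
      have \<mu>: "\<mu> \<tau> \<omega> = return borel x" using False by (simp add: \<mu>_def \<eta>_def x_def)
      have "AE y in return borel x. y \<in> {x}" by (subst AE_return) auto
      then have "measure_support (return borel x) \<subseteq> {x}" by (intro measure_support_subset) auto
      then show ?thesis using x by (auto simp: \<mu> prob_space_return)
    qed
    then show "prob_space (\<mu> \<tau> \<omega>)" "sets (\<mu> \<tau> \<omega>) = sets borel" "measure_support (\<mu> \<tau> \<omega>) \<subseteq> \<A> \<tau> \<omega>"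
      by auto
  next
    fix \<Upsilon> :: "ell2 \<Rightarrow> real" and t assume \<Upsilon>: "continuous_on UNIV \<Upsilon>"
    let ?phi = "\<lambda>\<omega> s u. \<Upsilon> (\<phi> (t - s) s (path_shift s \<omega>) u)"
    show "AE \<omega> in P. \<omega> \<in> \<Omega> \<longrightarrow>
          LIM_bot (\<lambda>\<tau>. 1 / (t - \<tau>) * (LBINT s:{\<tau>..t}. ?phi \<omega> s (\<xi> s (path_shift s \<omega>))))
            = (LINT u:\<A> t (path_shift t \<omega>)|\<mu> t (path_shift t \<omega>). \<Upsilon> u) \<and>
          (LINT u:\<A> t (path_shift t \<omega>)|\<mu> t (path_shift t \<omega>). \<Upsilon> u) = (LINT u|\<mu> t (path_shift t \<omega>). \<Upsilon> u) \<and>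
          (LINT u|\<mu> t (path_shift t \<omega>). \<Upsilon> u)
            = LIM_bot (\<lambda>\<tau>. 1 / (t - \<tau>) * (LBINT s:{\<tau>..t}. (LINT u|\<mu> s (path_shift s \<omega>). ?phi \<omega> s u)))"
      using good_AE
    proof (eventually_elim, intro impI)
      fix \<omega> assume good: "good \<omega>" and \<omega>: "\<omega> \<in> \<Omega>"
      have "LIM_bot (past_average t (\<lambda>s. \<Upsilon> (sol_u k h v t s \<omega> (\<xi> s (path_shift s \<omega>))))) = integral\<^sup>L (M \<omega> t) \<Upsilon>"
        "LIM_bot (past_average t (\<lambda>s. \<integral>x. \<Upsilon> (sol_u k h v t s \<omega> x) \<partial>M \<omega> s)) = integral\<^sup>L (M \<omega> t) \<Upsilon>"
        using M[OF \<omega> good] \<Upsilon> unfolding invariant_family_def by auto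
      then show "LIM_bot (\<lambda>\<tau>. 1 / (t - \<tau>) * (LBINT s:{\<tau>..t}. ?phi \<omega> s (\<xi> s (path_shift s \<omega>))))
            = (LINT u:\<A> t (path_shift t \<omega>)|\<mu> t (path_shift t \<omega>). \<Upsilon> u) \<and>
          (LINT u:\<A> t (path_shift t \<omega>)|\<mu> t (path_shift t \<omega>). \<Upsilon> u) = (LINT u|\<mu> t (path_shift t \<omega>). \<Upsilon> u) \<and>
          (LINT u|\<mu> t (path_shift t \<omega>). \<Upsilon> u)
            = LIM_bot (\<lambda>\<tau>. 1 / (t - \<tau>) * (LBINT s:{\<tau>..t}. (LINT u|\<mu> s (path_shift s \<omega>). ?phi \<omega> s u)))"
        unfolding past_average_def[abs_def]
        by (simp add: \<mu>_orbit[OF \<omega> good] M_set[OF \<omega> good \<Upsilon>] \<phi>_def cocycle_along_orbit[OF paths[OF \<omega>]])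
    qed
  next
    fix \<tau>
    show "AE \<omega> in P. \<omega> \<in> \<Omega> \<longrightarrow> (\<forall>\<Upsilon> :: ell2 \<Rightarrow> real. continuous_on UNIV \<Upsilon> \<longrightarrow> (\<forall>t\<ge>0.
            (LINT u:\<A> (\<tau> + t) (path_shift t \<omega>)|\<mu> (\<tau> + t) (path_shift t \<omega>). \<Upsilon> u)
              = (LINT u:\<A> \<tau> \<omega>|\<mu> \<tau> \<omega>. \<Upsilon> (\<phi> t \<tau> \<omega> u))))"
      \<comment> \<open>The measure at (\<tau>, \<omega>) was chosen for the base path
        \<open>path_shift (- \<tau>) \<omega>\<close>, so this is the path that must be good. Shift
        invariance of \<open>P\<close> makes it good almost surely.\<close>
      using AE_path_shift[OF prob(1) good_AE, of "- \<tau>"]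
    proof (eventually_elim, intro impI allI)
      fix \<omega> and \<Upsilon> :: "ell2 \<Rightarrow> real" and t :: real
      assume good: "good (path_shift (- \<tau>) \<omega>)" and \<omega>: "\<omega> \<in> \<Omega>" and \<Upsilon>: "continuous_on UNIV \<Upsilon>" and t: "0 \<le> t"
      define \<eta> where "\<eta> = path_shift (- \<tau>) \<omega>"
      have \<eta>: "\<eta> \<in> \<Omega>" "path_shift \<tau> \<eta> = \<omega>" "path_shift (\<tau> + t) \<eta> = path_shift t \<omega>" "good \<eta>"
        using \<Omega>[OF \<omega>] good by (simp_all add: \<eta>_def path_shift_path_shift path_shift_0 paths[OF \<omega>])
      have \<phi>: "\<phi> t \<tau> \<omega> u = sol_u k h v (\<tau> + t) \<tau> \<eta> u" for u
        by (simp add: \<phi>_def cocycle_def \<eta>_def add.commute)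
      have c: "continuous_on UNIV (\<lambda>u. \<Upsilon> (sol_u k h v (\<tau> + t) \<tau> \<eta> u))"
        by (rule continuous_on_compose2[OF \<Upsilon> sol_state[OF \<eta>(1)]]) (use t in auto)
      have "(LINT u:\<A> (\<tau> + t) (path_shift t \<omega>)|\<mu> (\<tau> + t) (path_shift t \<omega>). \<Upsilon> u) = integral\<^sup>L (M \<eta> (\<tau> + t)) \<Upsilon>"
        using M_set[OF \<eta>(1,4) \<Upsilon>, of "\<tau> + t"] \<mu>_orbit[OF \<eta>(1,4), of "\<tau> + t"] by (simp add: \<eta>(3))
      also have "\<dots> = (\<integral>u. \<Upsilon> (sol_u k h v (\<tau> + t) \<tau> \<eta> u) \<partial>M \<eta> \<tau>)"
        using M[OF \<eta>(1,4)] \<Upsilon> t unfolding invariant_family_def by simp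
      also have "\<dots> = (LINT u:\<A> \<tau> \<omega>|\<mu> \<tau> \<omega>. \<Upsilon> (\<phi> t \<tau> \<omega> u))"
        using M_set[OF \<eta>(1,4) c, of \<tau>] \<mu>_orbit[OF \<eta>(1,4), of \<tau>] by (simp add: \<eta>(2) \<phi>)
      finally show "(LINT u:\<A> (\<tau> + t) (path_shift t \<omega>)|\<mu> (\<tau> + t) (path_shift t \<omega>). \<Upsilon> u)
              = (LINT u:\<A> \<tau> \<omega>|\<mu> \<tau> \<omega>. \<Upsilon> (\<phi> t \<tau> \<omega> u))" .
    qed
  qed
qed

end
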